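(* There exists a universal constant $c>0$ with the following property. Let $d\ge 1$, let $X=(X_1,\dots,X_d)$ be an unconditional log-concave random vector in $\mathbb R^d$, and assume that the vector of magnitudes $(|X_i|)_{i=1}^d$ has negatively associated coordinates. For every $P\ge1$, every finite $T\subset\mathbb R^d$ with $|T|\ge e^P$, and every $a>0$ such that $$\|\langle t-s,X\rangle\|_P\ge a\qquad\text{for all } s,t\in T,\ s\ne t,$$ one has $$\mathbb E\max_{t\in T}\langle t,X\rangle\ \ge\ c\,a .$$ The constant $c$ is independent of the dimension $d$, the law of $X$, $P$, and $T$.
   Context: For a real random variable $V$ and $p\ge1$, $\|V\|_p=(\mathbb E|V|^p)^{1/p}$. A random vector $X$ in $\mathbb R^d$ is log-concave if its law $\mu$ satisfies $\mu(\theta A+(1-\theta)B)\ge\mu(A)^\theta\mu(B)^{1-\theta}$ for all nonempty compact $A,B$ and $\theta\in(0,1)$ (degenerate laws, supported on a proper subspace, are allowed). The law is unconditional if it is invariant under changing the signs of any collection of coordinates. A random vector $Y=(Y_i)_{i=1}^d$ has negatively associated (NA) coordinates if, for all disjoint $I,J\subset\{1,\dots,d\}$ and all bounded coordinatewise increasing (nondecreasing) functions $f,g$, one has $\mathbb E f(Y_I)g(Y_J)\le \mathbb E f(Y_I)\,\mathbb E g(Y_J)$, where $Y_I=(Y_i)_{i\in I}$. *)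

theory Defs
  imports "HOL-Probability.Probability"
begin

text \<open>
  Points of $\mathbb{R}^d$ are the elements of \<open>{..<d} \<rightarrow>\<^sub>E UNIV\<close>, i.e. functions on \<open>nat\<close> that are
  \<open>undefined\<close> outside \<open>{..<d}\<close>, so that equality of functions is equality of vectors. The dimension
  is a term and not a type because constants are to be uniform in it.

  A random vector is given by its law, a probability measure \<open>\<mu>\<close> on the Borel sets of
  $\mathbb{R}^d$; the vector itself is the identity on the sample space \<open>space \<mu>\<close>. This also keeps
  the type of an underlying sample space out of statements about uniform constants.
\<close>

abbreviation Rd_space :: "nat \<Rightarrow> (nat \<Rightarrow> real) set" where
  "Rd_space d \<equiv> {..<d} \<rightarrow>\<^sub>E UNIV"

abbreviation Rd_borel :: "nat \<Rightarrow> (nat \<Rightarrow> real) measure" where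
  "Rd_borel d \<equiv> Pi\<^sub>M {..<d} (\<lambda>_. borel)"

abbreviation Rd_topology :: "nat \<Rightarrow> (nat \<Rightarrow> real) topology" where
  "Rd_topology d \<equiv> product_topology (\<lambda>_. euclideanreal) {..<d}"

definition Rd_inner :: "nat \<Rightarrow> (nat \<Rightarrow> real) \<Rightarrow> (nat \<Rightarrow> real) \<Rightarrow> real" where
  "Rd_inner d t x = (\<Sum>i<d. t i * x i)"

definition law_on_Rd :: "nat \<Rightarrow> (nat \<Rightarrow> real) measure \<Rightarrow> bool" where
  "law_on_Rd d \<mu> \<longleftrightarrow> prob_space \<mu> \<and> sets \<mu> = sets (Rd_borel d)"

definition Lp_norm :: "'a measure \<Rightarrow> real \<Rightarrow> ('a \<Rightarrow> real) \<Rightarrow> real" where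
  "Lp_norm M p V = (\<integral>\<omega>. \<bar>V \<omega>\<bar> powr p \<partial>M) powr (1 / p)"

definition Rd_convex_comb ::
    "nat \<Rightarrow> real \<Rightarrow> (nat \<Rightarrow> real) set \<Rightarrow> (nat \<Rightarrow> real) set \<Rightarrow> (nat \<Rightarrow> real) set" where
  "Rd_convex_comb d \<theta> A B =
     {(\<lambda>i\<in>{..<d}. \<theta> * x i + (1 - \<theta>) * y i) | x y. x \<in> A \<and> y \<in> B}"

definition log_concave_law :: "nat \<Rightarrow> (nat \<Rightarrow> real) measure \<Rightarrow> bool" where
  "log_concave_law d \<mu> \<longleftrightarrow>
     (\<forall>A B \<theta>. compactin (Rd_topology d) A \<and> A \<noteq> {} \<and>
              compactin (Rd_topology d) B \<and> B \<noteq> {} \<and> 0 < \<theta> \<and> \<theta> < 1 \<longrightarrow>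
        measure \<mu> (Rd_convex_comb d \<theta> A B) \<ge>
          measure \<mu> A powr \<theta> * measure \<mu> B powr (1 - \<theta>))"

definition unconditional_law :: "nat \<Rightarrow> (nat \<Rightarrow> real) measure \<Rightarrow> bool" where
  "unconditional_law d \<mu> \<longleftrightarrow>
     (\<forall>S\<subseteq>{..<d}. distr \<mu> (Rd_borel d) (\<lambda>x. \<lambda>i\<in>{..<d}. if i \<in> S then - x i else x i) = \<mu>)"

text \<open>
  The test functions of negative association are taken to be Borel: a coordinatewise nondecreasing
  function of several variables need not be Borel, and its expectation is then not defined.
\<close>

definition NA_test_function :: "nat set \<Rightarrow> ((nat \<Rightarrow> real) \<Rightarrow> real) \<Rightarrow> bool" where
  "NA_test_function I f \<longleftrightarrow>
     f \<in> borel_measurable (Pi\<^sub>M I (\<lambda>_. borel)) \<and>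
     (\<exists>C. \<forall>x \<in> I \<rightarrow>\<^sub>E UNIV. \<bar>f x\<bar> \<le> C) \<and>
     (\<forall>x \<in> I \<rightarrow>\<^sub>E UNIV. \<forall>y \<in> I \<rightarrow>\<^sub>E UNIV. (\<forall>i\<in>I. x i \<le> y i) \<longrightarrow> f x \<le> f y)"

definition negatively_associated :: "'a measure \<Rightarrow> nat \<Rightarrow> ('a \<Rightarrow> nat \<Rightarrow> real) \<Rightarrow> bool" where
  "negatively_associated M d Y \<longleftrightarrow>
     (\<forall>I J f g. I \<subseteq> {..<d} \<and> J \<subseteq> {..<d} \<and> I \<inter> J = {} \<and>
                NA_test_function I f \<and> NA_test_function J g \<longrightarrow>
        (\<integral>\<omega>. f (restrict (Y \<omega>) I) * g (restrict (Y \<omega>) J) \<partial>M) \<le>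
          (\<integral>\<omega>. f (restrict (Y \<omega>) I) \<partial>M) * (\<integral>\<omega>. g (restrict (Y \<omega>) J) \<partial>M))"

end

theory Submission
  imports Defs
begin

text \<open>
  Suppose that the expected supremum is smaller than \<open>c a\<close>. It dominates the Rademacher average
  of the points \<open>(t i * E|X i|)\<close>, so a chaining argument localizes: most of \<open>T\<close> can be assumed to
  differ from a fixed point by a vector with few large coordinates, plus a part that is
  negligible in \<open>L\<^sup>P\<close>. After keeping one typical large value per coordinate and a contraction,
  the points become sets \<open>A t\<close> of at most \<open>P/96\<close> coordinates, with \<open>\<langle>t, X\<rangle> = (\<Sum>i\<in>A t. b i * X i)\<close>, and
  the \<open>L\<^sup>P\<close> separation says that \<open>A t - A s\<close> or \<open>A s - A t\<close> carries a large moment.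

  Now let \<open>t\<close> be a hidden uniform point and observe \<open>X\<close> conditioned on \<open>b i * X i \<ge> y t i\<close> on
  \<open>A t\<close>, an event of probability at least \<open>exp (- q P)\<close>. Let \<open>s\<close> be a posterior sample of \<open>t\<close>. By
  exchangeability the scores of \<open>s\<close> and \<open>t\<close> have the same mean, so the forced levels on
  \<open>A t - A s\<close> are compensated by noise; as negative association makes the unforced coordinates
  only smaller, this noise is bounded by the expected supremum. Hence it suffices to find levels
  \<open>y\<close> with \<open>E (\<Sum>i\<in>A t - A s. y t i)\<close> of order \<open>a\<close>. The feasible levels form a convex set by
  log-concavity, and by a minimax argument they may depend on the joint law of \<open>t\<close> and \<open>s\<close>. If
  they did not exist, \<open>s\<close> would essentially reveal \<open>t\<close>; a sequential code then describes \<open>t\<close> given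
  \<open>s\<close> by so few bits that it contradicts the smallness \<open>q P\<close> of the information.
\<close>

section \<open>Rademacher averages\<close>

text \<open>Passing to the Rademacher average keeps only the means of the magnitudes, so it cannot
  see the tails of X. These matter for the few large coordinates, and the reduction to sets isolates
  them. The obstacle there is a circle: good levels must put weight on what the replica s misses,
  but the joint law of t and s depends on the levels. The circle is broken by enlarging the possible
  joint laws to \<open>replica_laws U w\<close>, a convex class that depends on the levels only
  through a lower bound w for the probabilities of the forced events. The decoding argument uses no
  more about a joint law than membership in this class, so it answers every law in it with good
  levels. Minimax then gives one mixture of levels that is good against the whole class, in
  particular against the law that this mixture itself generates.\<close>

abbreviation signs :: "'i set \<Rightarrow> ('i \<Rightarrow> real) set" where
  "signs I \<equiv> PiE I (\<lambda>_. {-1, 1})"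

lemma finite_signs: "finite I \<Longrightarrow> finite (signs I)"
  by (simp add: finite_PiE)

lemma card_signs: "finite I \<Longrightarrow> card (signs I) = 2 ^ card I"
  by (simp add: card_PiE numeral_2_eq_2)

lemma signs_abs: "\<sigma> \<in> signs I \<Longrightarrow> i \<in> I \<Longrightarrow> \<bar>\<sigma> i\<bar> = 1"
  by (drule (1) PiE_mem) auto

lemma sum_signs_insert:
  assumes "i \<notin> I"
  shows "(\<Sum>\<sigma>\<in>signs (insert i I). G \<sigma>) = (\<Sum>\<sigma>\<in>signs I. G (\<sigma>(i := 1)) + G (\<sigma>(i := -1)))"
proof -
  have inj: "inj_on (\<lambda>(y, g). g(i := y)) ({-1, 1::real} \<times> signs I)"
    using inj_combinator[OF assms, of "\<lambda>_. {-1, 1::real}"] by simp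
  have "(\<Sum>\<sigma>\<in>signs (insert i I). G \<sigma>) = (\<Sum>(y, g)\<in>{-1, 1} \<times> signs I. G (g(i := y)))"
    unfolding PiE_insert_eq using inj by (subst sum.reindex) (auto simp: case_prod_unfold)
  also have "\<dots> = (\<Sum>y\<in>{-1, 1}. \<Sum>g\<in>signs I. G (g(i := y)))"
    by (simp add: sum.cartesian_product)
  finally show ?thesis by (simp add: sum.distrib add.commute)
qed

lemma sum_upd:
  assumes "i \<notin> I"
  shows "(\<Sum>j\<in>I. a j * (if j = i then y else \<sigma> j)) = (\<Sum>j\<in>I. a j * (\<sigma> j::real))"
  using assms by (intro sum.cong) auto

lemma sum_signs_prod:
  fixes g :: "'i \<Rightarrow> real \<Rightarrow> real"
  assumes "finite I"
  shows "(\<Sum>\<sigma>\<in>signs I. \<Prod>i\<in>I. g i (\<sigma> i)) = (\<Prod>i\<in>I. g i 1 + g i (-1))"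
  using prod_sum_PiE[OF assms, of "\<lambda>_. {-1, 1::real}" g] by (simp add: add.commute)

lemma sum_signs_linear:
  assumes "finite I"
  shows "(\<Sum>\<sigma>\<in>signs I. \<Sum>i\<in>I. a i * \<sigma> i) = 0"
  using assms
proof induct
  case (insert i I)
  then show ?case
    by (simp add: sum_signs_insert sum_upd sum.distrib flip: sum_distrib_left)
qed auto

text \<open>Coordinates are added one at a time; odd powers of the new term cancel between its two
  signs. The fourth moment bound is the one that Khintchine's inequality needs.\<close>

lemma sum_signs_moments:
  fixes a :: "'i \<Rightarrow> real"
  assumes "finite I"
  defines "V \<equiv> \<lambda>\<sigma>. \<Sum>i\<in>I. a i * \<sigma> i"
  shows "(\<Sum>\<sigma>\<in>signs I. (V \<sigma>)\<^sup>2) = 2 ^ card I * (\<Sum>i\<in>I. (a i)\<^sup>2)" (is ?A)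
    and "(\<Sum>\<sigma>\<in>signs I. (V \<sigma>) ^ 4) \<le> 2 ^ card I * (3 * (\<Sum>i\<in>I. (a i)\<^sup>2)\<^sup>2)" (is ?B)
proof -
  have "(\<Sum>\<sigma>\<in>signs I. (\<Sum>i\<in>I. a i * \<sigma> i)\<^sup>2) = 2 ^ card I * (\<Sum>i\<in>I. (a i)\<^sup>2) \<and>
        (\<Sum>\<sigma>\<in>signs I. (\<Sum>i\<in>I. a i * \<sigma> i) ^ 4) \<le> 2 ^ card I * (3 * (\<Sum>i\<in>I. (a i)\<^sup>2)\<^sup>2)"
    using assms(1)
  proof induct
    case (insert i I)
    define W where "W = (\<lambda>\<sigma>. \<Sum>j\<in>I. a j * \<sigma> j)"
    define s where "s = (\<Sum>j\<in>I. (a j)\<^sup>2)"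
    have s0: "0 \<le> s" by (simp add: s_def sum_nonneg)
    have IH1: "(\<Sum>\<sigma>\<in>signs I. (W \<sigma>)\<^sup>2) = 2 ^ card I * s"
      and IH2: "(\<Sum>\<sigma>\<in>signs I. (W \<sigma>)^4) \<le> 2 ^ card I * (3 * s\<^sup>2)"
      using insert by (auto simp: W_def s_def)
    have "(\<Sum>\<sigma>\<in>signs (insert i I). (\<Sum>j\<in>insert i I. a j * \<sigma> j)\<^sup>2)
        = (\<Sum>\<sigma>\<in>signs I. (a i + W \<sigma>)\<^sup>2 + (- a i + W \<sigma>)\<^sup>2)"
      using insert by (simp add: sum_signs_insert sum_upd W_def)
    also have "\<dots> = (\<Sum>\<sigma>\<in>signs I. 2 * (a i)\<^sup>2 + 2 * (W \<sigma>)\<^sup>2)"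
      by (intro sum.cong) (auto simp: power2_eq_square algebra_simps)
    also have "\<dots> = 2 ^ card (insert i I) * (\<Sum>j\<in>insert i I. (a j)\<^sup>2)"
      using insert IH1
      by (simp add: sum.distrib s_def card_signs algebra_simps flip: sum_distrib_left)
    finally have 1: "(\<Sum>\<sigma>\<in>signs (insert i I). (\<Sum>j\<in>insert i I. a j * \<sigma> j)\<^sup>2)
        = 2 ^ card (insert i I) * (\<Sum>j\<in>insert i I. (a j)\<^sup>2)" .
    have "(\<Sum>\<sigma>\<in>signs (insert i I). (\<Sum>j\<in>insert i I. a j * \<sigma> j)^4)
        = (\<Sum>\<sigma>\<in>signs I. (a i + W \<sigma>)^4 + (- a i + W \<sigma>)^4)"
      using insert by (simp add: sum_signs_insert sum_upd W_def)
    also have "\<dots> = (\<Sum>\<sigma>\<in>signs I. 2 * (a i)^4 + 12 * (a i)\<^sup>2 * (W \<sigma>)\<^sup>2 + 2 * (W \<sigma>)^4)"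
      by (intro sum.cong) (auto simp: power2_eq_square power4_eq_xxxx algebra_simps)
    also have "\<dots> = 2 ^ card I * (2 * (a i)^4 + 12 * (a i)\<^sup>2 * s) + 2 * (\<Sum>\<sigma>\<in>signs I. (W \<sigma>)^4)"
      using insert IH1
      by (simp add: sum.distrib card_signs sum_distrib_left[symmetric]) (simp add: algebra_simps)
    also have "\<dots> \<le> 2 ^ card I * (2 * (a i)^4 + 12 * (a i)\<^sup>2 * s) + 2 * (2 ^ card I * (3 * s\<^sup>2))"
      using IH2 by linarith
    also have "\<dots> = 2 ^ card I * (2 * (a i)^4 + 12 * (a i)\<^sup>2 * s + 6 * s\<^sup>2)"
      by (simp add: algebra_simps)
    also have "\<dots> \<le> 2 ^ card I * (2 * (3 * ((a i)\<^sup>2 + s)\<^sup>2))"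
    proof (intro mult_left_mono)
      have "2 * (3 * ((a i)\<^sup>2 + s)\<^sup>2) = 6 * (a i)^4 + 12 * (a i)\<^sup>2 * s + 6 * s\<^sup>2"
        by (simp add: power2_eq_square power4_eq_xxxx algebra_simps)
      then show "2 * (a i)^4 + 12 * (a i)\<^sup>2 * s + 6 * s\<^sup>2 \<le> 2 * (3 * ((a i)\<^sup>2 + s)\<^sup>2)"
        by simp
    qed simp
    also have "\<dots> = 2 ^ card (insert i I) * (3 * (\<Sum>j\<in>insert i I. (a j)\<^sup>2)\<^sup>2)"
      using insert by (simp add: s_def)
    finally show ?case using 1 by simp
  qed simp
  then show ?A ?B by (auto simp: V_def)
qed

text \<open>A quartic minorant of the absolute value that touches it at \<bar>x\<bar> = 3/2 s, where
  the difference has a double root. It bounds a first moment below by the second and fourth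
  moments.\<close>

lemma abs_ge_square_minus_fourth:
  fixes x s :: real
  assumes "s > 0"
  shows "\<bar>x\<bar> \<ge> x\<^sup>2 / s - 4/27 * x^4 / s^3"
proof -
  define y where "y = \<bar>x\<bar> / s"
  have y0: "y \<ge> 0" using assms by (simp add: y_def)
  have "4/27 * y^3 - y + 1 = 4/27 * ((y - 3/2)\<^sup>2 * (y + 3))"
    by (simp add: power2_eq_square power3_eq_cube field_simps)
  also have "\<dots> \<ge> 0" using y0 by simp
  finally have "y * (4/27 * y^3 - y + 1) \<ge> 0" using y0 by simp
  then have "y \<ge> y^2 - 4/27 * y^4"
    by (simp add: power2_eq_square power3_eq_cube power4_eq_xxxx algebra_simps)
  then have "s * y \<ge> s * (y^2 - 4/27 * y^4)" using assms by simp
  moreover have "s * y = \<bar>x\<bar>" using assms by (simp add: y_def)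
  moreover have "\<bar>x\<bar>^4 = x^4" by (simp add: power_even_abs)
  then have "s * (y^2 - 4/27 * y^4) = x\<^sup>2 / s - 4/27 * x^4 / s^3"
    using assms by (simp add: y_def power_divide power2_eq_square power3_eq_cube power4_eq_xxxx field_simps)
  ultimately show ?thesis by simp
qed

text \<open>The quartic minorant is taken at s equal to the standard deviation; the fourth moment is
  at most 3 s^4, and 5/9 = 1 - 3 * 4/27.\<close>

lemma khintchine:
  assumes "finite I"
  shows "(\<Sum>\<sigma>\<in>signs I. \<bar>\<Sum>i\<in>I. a i * \<sigma> i\<bar>) / 2 ^ card I \<ge> 5/9 * sqrt (\<Sum>i\<in>I. (a i)\<^sup>2)"
proof (cases "(\<Sum>i\<in>I. (a i)\<^sup>2) = 0")
  case True
  then show ?thesis by (simp add: sum_nonneg)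
next
  case False
  define S where "S = (\<Sum>i\<in>I. (a i)\<^sup>2)"
  define s where "s = sqrt S"
  define V where "V = (\<lambda>\<sigma>. \<Sum>i\<in>I. a i * \<sigma> i)"
  have S0: "S > 0" using False by (simp add: S_def sum_nonneg order_less_le)
  then have s0: "s > 0" and sS: "s\<^sup>2 = S" by (auto simp: s_def)
  have "(\<Sum>\<sigma>\<in>signs I. \<bar>V \<sigma>\<bar>) \<ge> (\<Sum>\<sigma>\<in>signs I. (V \<sigma>)\<^sup>2 / s - 4/27 * (V \<sigma>)^4 / s^3)"
    using s0 by (intro sum_mono abs_ge_square_minus_fourth)
  also have "(\<Sum>\<sigma>\<in>signs I. (V \<sigma>)\<^sup>2 / s - 4/27 * (V \<sigma>)^4 / s^3)
    = (\<Sum>\<sigma>\<in>signs I. (V \<sigma>)\<^sup>2) / s - 4/27 * (\<Sum>\<sigma>\<in>signs I. (V \<sigma>)^4) / s^3"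
    by (simp add: sum_subtractf sum_divide_distrib sum_distrib_left)
  also have "\<dots> \<ge> 2 ^ card I * S / s - 4/27 * (2 ^ card I * (3 * S\<^sup>2)) / s^3"
    using sum_signs_moments[OF assms, of a] s0
    by (intro diff_mono divide_right_mono mult_left_mono) (auto simp: V_def S_def)
  also have "2 ^ card I * S / s - 4/27 * (2 ^ card I * (3 * S\<^sup>2)) / s^3 = 2 ^ card I * (5/9 * s)"
    using s0 by (simp add: sS[symmetric] power2_eq_square power3_eq_cube field_simps)
  finally show ?thesis by (simp add: V_def s_def S_def field_simps)
qed

section \<open>Comparison of maxima under sign averages\<close>

text \<open>One coordinate of the contraction principle. If t and s attain the two maxima with
  \<open>b\<close>, the gain b t - b s is at most \<bar>a t - a s\<bar>; using t and s in the two
  maxima with \<open>a\<close>, in the order given by the sign of a t - a s, recovers it.\<close>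

lemma Max_add_le_of_close:
  fixes a b d :: "'t \<Rightarrow> real"
  assumes "finite T" "T \<noteq> {}" and close: "\<And>s t. s \<in> T \<Longrightarrow> t \<in> T \<Longrightarrow> \<bar>b t - b s\<bar> \<le> \<bar>a t - a s\<bar>"
  shows "(MAX t\<in>T. d t + b t) + (MAX t\<in>T. d t - b t) \<le> (MAX t\<in>T. d t + a t) + (MAX t\<in>T. d t - a t)"
proof -
  have "(MAX t\<in>T. d t + b t) \<in> (\<lambda>t. d t + b t) ` T" "(MAX t\<in>T. d t - b t) \<in> (\<lambda>t. d t - b t) ` T"
    using assms by (auto intro!: Max_in)
  then obtain t s where t: "t \<in> T" "(MAX t\<in>T. d t + b t) = d t + b t"
    and s: "s \<in> T" "(MAX t\<in>T. d t - b t) = d s - b s" by auto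
  have M: "d r + a r \<le> (MAX t\<in>T. d t + a t)" "d r - a r \<le> (MAX t\<in>T. d t - a t)" if "r \<in> T" for r
    using assms(1) that by (auto intro!: Max_ge)
  show ?thesis using close[OF s(1) t(1)] M[OF t(1)] M[OF s(1)] t(2) s(2) by linarith
qed

text \<open>Coefficients are exchanged one coordinate at a time. The offset \<open>c\<close> is
  arbitrary so that it can absorb the coordinate already treated.\<close>

lemma signs_contraction:
  fixes a b :: "'t \<Rightarrow> 'i \<Rightarrow> real"
  assumes "finite I" "finite T" "T \<noteq> {}"
    and "\<And>s t i. s \<in> T \<Longrightarrow> t \<in> T \<Longrightarrow> i \<in> I \<Longrightarrow> \<bar>b t i - b s i\<bar> \<le> \<bar>a t i - a s i\<bar>"
  shows "(\<Sum>\<sigma>\<in>signs I. MAX t\<in>T. c t + (\<Sum>i\<in>I. b t i * \<sigma> i))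
       \<le> (\<Sum>\<sigma>\<in>signs I. MAX t\<in>T. c t + (\<Sum>i\<in>I. a t i * \<sigma> i))"
  using assms(1,4)
proof (induct arbitrary: c)
  case (insert i I)
  have "(\<Sum>\<sigma>\<in>signs (insert i I). MAX t\<in>T. c t + (\<Sum>i\<in>insert i I. b t i * \<sigma> i))
     = (\<Sum>\<sigma>\<in>signs I. (MAX t\<in>T. (c t + (\<Sum>i\<in>I. b t i * \<sigma> i)) + b t i) + (MAX t\<in>T. (c t + (\<Sum>i\<in>I. b t i * \<sigma> i)) - b t i))"
    using insert by (simp add: sum_signs_insert sum_upd) (simp add: algebra_simps)
  also have "\<dots> \<le> (\<Sum>\<sigma>\<in>signs I. (MAX t\<in>T. (c t + (\<Sum>i\<in>I. b t i * \<sigma> i)) + a t i) + (MAX t\<in>T. (c t + (\<Sum>i\<in>I. b t i * \<sigma> i)) - a t i))"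
    using insert assms by (intro sum_mono Max_add_le_of_close) auto
  also have "\<dots> = (\<Sum>\<sigma>\<in>signs I. MAX t\<in>T. (c t + a t i) + (\<Sum>i\<in>I. b t i * \<sigma> i))
       + (\<Sum>\<sigma>\<in>signs I. MAX t\<in>T. (c t - a t i) + (\<Sum>i\<in>I. b t i * \<sigma> i))"
    by (simp add: sum.distrib algebra_simps)
  also have "\<dots> \<le> (\<Sum>\<sigma>\<in>signs I. MAX t\<in>T. (c t + a t i) + (\<Sum>i\<in>I. a t i * \<sigma> i))
       + (\<Sum>\<sigma>\<in>signs I. MAX t\<in>T. (c t - a t i) + (\<Sum>i\<in>I. a t i * \<sigma> i))"
    using insert by (intro add_mono insert(3)) auto
  also have "\<dots> = (\<Sum>\<sigma>\<in>signs (insert i I). MAX t\<in>T. c t + (\<Sum>i\<in>insert i I. a t i * \<sigma> i))"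
    using insert by (simp add: sum_signs_insert sum_upd) (simp add: algebra_simps sum.distrib)
  finally show ?case .
qed simp

text \<open>A sign of mean h, centred, has mean 0 and values in [-2, 2]. The maximum is convex in
  this value, hence below its chord over [-2, 2], and the chord averages to the case of twice a
  symmetric sign.\<close>

lemma biased_pair_le:
  fixes a d :: "'t \<Rightarrow> real"
  assumes "finite T" "T \<noteq> {}" "\<bar>h\<bar> \<le> 1"
  shows "(1 + h) * (MAX t\<in>T. d t + a t * (1 - h)) + (1 - h) * (MAX t\<in>T. d t + a t * (-1 - h))
    \<le> (MAX t\<in>T. d t + 2 * a t) + (MAX t\<in>T. d t - 2 * a t)" (is "_ \<le> ?p + ?m")
proof -
  have M: "d r + 2 * a r \<le> ?p" "d r - 2 * a r \<le> ?m" if "r \<in> T" for r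
    using assms(1) that by (auto intro!: Max_ge)
  have chord: "(MAX t\<in>T. d t + a t * y) \<le> (2 + y) / 4 * ?p + (2 - y) / 4 * ?m" if "\<bar>y\<bar> \<le> 2" for y
  proof -
    have "d t + a t * y \<le> (2 + y) / 4 * ?p + (2 - y) / 4 * ?m" if t: "t \<in> T" for t
    proof -
      have "d t + a t * y = (2 + y) / 4 * (d t + 2 * a t) + (2 - y) / 4 * (d t - 2 * a t)"
        by (simp add: field_simps)
      also have "\<dots> \<le> (2 + y) / 4 * ?p + (2 - y) / 4 * ?m"
        using M[OF t] \<open>\<bar>y\<bar> \<le> 2\<close> by (intro add_mono mult_left_mono) auto
      finally show ?thesis .
    qed
    then show ?thesis using assms by (intro Max.boundedI) auto
  qed
  have "(1 + h) * (MAX t\<in>T. d t + a t * (1 - h)) + (1 - h) * (MAX t\<in>T. d t + a t * (-1 - h))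
     \<le> (1 + h) * ((2 + (1 - h)) / 4 * ?p + (2 - (1 - h)) / 4 * ?m)
      + (1 - h) * ((2 + (-1 - h)) / 4 * ?p + (2 - (-1 - h)) / 4 * ?m)"
    using assms(3) by (intro add_mono mult_left_mono chord) auto
  also have "\<dots> = ?p + ?m" by (simp add: field_simps)
  finally show ?thesis .
qed

text \<open>The product is the density of independent signs with means h i. Their centred noise
  costs at most a factor 2 against symmetric signs.\<close>

lemma signs_biased_le:
  fixes a :: "'t \<Rightarrow> 'i \<Rightarrow> real"
  assumes "finite I" "finite T" "T \<noteq> {}" and "\<And>i. i \<in> I \<Longrightarrow> \<bar>h i\<bar> \<le> 1"
  shows "(\<Sum>\<sigma>\<in>signs I. (\<Prod>i\<in>I. 1 + h i * \<sigma> i) * (MAX t\<in>T. c t + (\<Sum>i\<in>I. a t i * (\<sigma> i - h i))))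
       \<le> (\<Sum>\<sigma>\<in>signs I. MAX t\<in>T. c t + (\<Sum>i\<in>I. 2 * a t i * \<sigma> i))"
  using assms(1,4)
proof (induct arbitrary: c)
  case (insert i I)
  have pr: "(\<Prod>j\<in>I. 1 + h j * (if j = i then y else \<sigma> j)) = (\<Prod>j\<in>I. 1 + h j * \<sigma> j)" for \<sigma> y
    using insert by (intro prod.cong) auto
  have su: "(\<Sum>j\<in>I. a t j * ((if j = i then y else \<sigma> j) - h j)) = (\<Sum>j\<in>I. a t j * (\<sigma> j - h j))" for t \<sigma> y
    using insert by (intro sum.cong) auto
  define p where "p = (\<lambda>\<sigma>. \<Prod>j\<in>I. 1 + h j * \<sigma> j)"
  have p0: "p \<sigma> \<ge> 0" if "\<sigma> \<in> signs I" for \<sigma>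
    unfolding p_def
  proof (intro prod_nonneg)
    fix j assume j: "j \<in> I"
    then have "\<bar>h j * \<sigma> j\<bar> \<le> 1" using insert(4)[of j] signs_abs[OF that j] by (simp add: abs_mult)
    then show "0 \<le> 1 + h j * \<sigma> j" by (simp add: abs_le_iff)
  qed
  have "(\<Sum>\<sigma>\<in>signs (insert i I). (\<Prod>i\<in>insert i I. 1 + h i * \<sigma> i) * (MAX t\<in>T. c t + (\<Sum>i\<in>insert i I. a t i * (\<sigma> i - h i))))
     = (\<Sum>\<sigma>\<in>signs I. p \<sigma> * ((1 + h i) * (MAX t\<in>T. (c t + (\<Sum>i\<in>I. a t i * (\<sigma> i - h i))) + a t i * (1 - h i))
         + (1 - h i) * (MAX t\<in>T. (c t + (\<Sum>i\<in>I. a t i * (\<sigma> i - h i))) + a t i * (-1 - h i))))"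
    using insert by (simp add: sum_signs_insert pr su p_def) (simp add: algebra_simps)
  also have "\<dots> \<le> (\<Sum>\<sigma>\<in>signs I. p \<sigma> * ((MAX t\<in>T. (c t + (\<Sum>i\<in>I. a t i * (\<sigma> i - h i))) + 2 * a t i)
         + (MAX t\<in>T. (c t + (\<Sum>i\<in>I. a t i * (\<sigma> i - h i))) - 2 * a t i)))"
    using insert assms p0 by (intro sum_mono mult_left_mono biased_pair_le) auto
  also have "\<dots> = (\<Sum>\<sigma>\<in>signs I. p \<sigma> * (MAX t\<in>T. (c t + 2 * a t i) + (\<Sum>i\<in>I. a t i * (\<sigma> i - h i))))
         + (\<Sum>\<sigma>\<in>signs I. p \<sigma> * (MAX t\<in>T. (c t - 2 * a t i) + (\<Sum>i\<in>I. a t i * (\<sigma> i - h i))))"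
    by (simp add: sum.distrib algebra_simps)
  also have "\<dots> \<le> (\<Sum>\<sigma>\<in>signs I. MAX t\<in>T. (c t + 2 * a t i) + (\<Sum>i\<in>I. 2 * a t i * \<sigma> i))
       + (\<Sum>\<sigma>\<in>signs I. MAX t\<in>T. (c t - 2 * a t i) + (\<Sum>i\<in>I. 2 * a t i * \<sigma> i))"
    unfolding p_def using insert by (intro add_mono insert(3)) auto
  also have "\<dots> = (\<Sum>\<sigma>\<in>signs (insert i I). MAX t\<in>T. c t + (\<Sum>i\<in>insert i I. 2 * a t i * \<sigma> i))"
    using insert by (simp add: sum_signs_insert sum_upd) (simp add: algebra_simps sum.distrib)
  finally show ?case .
qed simp

section \<open>Retention and posterior samples\<close>

text \<open>The cost of one coordinate. Each value of modulus at least 1 costs at least 1, so a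
  budget bounds the number of large coordinates; near 0 the cost is the variance.\<close>

definition trunc_sq :: "real \<Rightarrow> real" where
  "trunc_sq x = min \<bar>x\<bar> (x\<^sup>2)"

lemma trunc_sq_nonneg: "0 \<le> trunc_sq x"
  by (simp add: trunc_sq_def)

lemma trunc_sq_le: "trunc_sq x \<le> \<bar>x\<bar>" "trunc_sq x \<le> x\<^sup>2"
  by (auto simp: trunc_sq_def)

lemma trunc_sq_small: "\<bar>x\<bar> \<le> 1 \<Longrightarrow> trunc_sq x = x\<^sup>2"
  using power_decreasing[of 1 2 "\<bar>x\<bar>"] by (simp add: trunc_sq_def)

lemma trunc_sq_large: "1 \<le> \<bar>x\<bar> \<Longrightarrow> trunc_sq x = \<bar>x\<bar>"
  using power_increasing[of 1 2 "\<bar>x\<bar>"] by (simp add: trunc_sq_def)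

lemma trunc_sq_minus: "trunc_sq (- x) = trunc_sq x"
  by (simp add: trunc_sq_def)

lemma trunc_sq_double: "trunc_sq (2 * x) \<le> 4 * trunc_sq x"
  by (auto simp: trunc_sq_def min_def abs_mult power_mult_distrib)

definition rad :: "'i set \<Rightarrow> 't set \<Rightarrow> ('t \<Rightarrow> 'i \<Rightarrow> real) \<Rightarrow> real" where
  "rad I T a = (\<Sum>\<sigma>\<in>signs I. MAX t\<in>T. \<Sum>i\<in>I. a t i * \<sigma> i) / 2 ^ card I"

lemma Max_add_const:
  fixes f :: "'t \<Rightarrow> real"
  assumes "finite T" "T \<noteq> {}"
  shows "(MAX t\<in>T. f t + c) = (MAX t\<in>T. f t) + c"
  using assms by (rule Max_add_commute)

lemma Max_mult_const:
  fixes f :: "'t \<Rightarrow> real"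
  assumes "finite T" "T \<noteq> {}" "c \<ge> 0"
  shows "(MAX t\<in>T. c * f t) = c * (MAX t\<in>T. f t)"
  using assms mono_Max_commute[of "\<lambda>x. c * x" "f ` T"]
  by (auto simp: mono_def image_image mult_left_mono)

lemma rad_affine:
  assumes "finite I" "finite T" "T \<noteq> {}" "q \<ge> 0"
  shows "rad I T (\<lambda>t i. q * (a t i - b i)) = q * rad I T a"
proof -
  have "(MAX t\<in>T. \<Sum>i\<in>I. q * (a t i - b i) * \<sigma> i)
      = q * (MAX t\<in>T. \<Sum>i\<in>I. a t i * \<sigma> i) + (\<Sum>i\<in>I. (- q * b i) * \<sigma> i)" for \<sigma>
  proof -
    have "(MAX t\<in>T. \<Sum>i\<in>I. q * (a t i - b i) * \<sigma> i)
       = (MAX t\<in>T. q * (\<Sum>i\<in>I. a t i * \<sigma> i) + (\<Sum>i\<in>I. (- q * b i) * \<sigma> i))"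
      by (simp add: algebra_simps sum_subtractf sum_distrib_left sum_negf)
    then show ?thesis using assms by (simp add: Max_add_const Max_mult_const)
  qed
  then show ?thesis
    using sum_signs_linear[OF assms(1), of "\<lambda>i. - q * b i"]
    by (simp add: rad_def sum.distrib flip: sum_distrib_left)
qed

lemma rad_mono_set:
  assumes "finite I" "finite T" "S \<subseteq> T" "S \<noteq> {}"
  shows "rad I S a \<le> rad I T a"
  unfolding rad_def using assms
  by (intro divide_right_mono sum_mono Max_mono) auto

text \<open>The maximum dominates half the sum of the values at s and t and of the modulus of their
  difference. The linear part averages to 0, and Khintchine's inequality bounds the rest.\<close>

lemma rad_two_points:
  assumes "finite I" "finite T" "s \<in> T" "t \<in> T"
  shows "rad I T a \<ge> 5/18 * sqrt (\<Sum>i\<in>I. (a t i - a s i)\<^sup>2)"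
proof -
  have ne: "T \<noteq> {}" using assms by auto
  have "5/9 * sqrt (\<Sum>i\<in>I. (a t i - a s i)\<^sup>2) \<le> (\<Sum>\<sigma>\<in>signs I. \<bar>\<Sum>i\<in>I. (a t i - a s i) * \<sigma> i\<bar>) / 2 ^ card I"
    by (rule khintchine[OF assms(1)])
  also have "\<dots> \<le> (\<Sum>\<sigma>\<in>signs I. 2 * (MAX t\<in>T. \<Sum>i\<in>I. a t i * \<sigma> i) - (\<Sum>i\<in>I. (a t i + a s i) * \<sigma> i)) / 2 ^ card I"
  proof (intro divide_right_mono sum_mono)
    fix \<sigma>
    have "(\<Sum>i\<in>I. a r i * \<sigma> i) \<le> (MAX t\<in>T. \<Sum>i\<in>I. a t i * \<sigma> i)" if "r \<in> T" for r
      using that assms by (intro Max_ge) auto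
    from this[OF assms(3)] this[OF assms(4)]
    show "\<bar>\<Sum>i\<in>I. (a t i - a s i) * \<sigma> i\<bar> \<le> 2 * (MAX t\<in>T. \<Sum>i\<in>I. a t i * \<sigma> i) - (\<Sum>i\<in>I. (a t i + a s i) * \<sigma> i)"
      by (simp add: algebra_simps sum_subtractf sum.distrib)
  qed simp
  also have "\<dots> = 2 * rad I T a"
    using sum_signs_linear[OF assms(1), of "\<lambda>i. a t i + a s i"]
    by (simp add: sum_subtractf rad_def flip: sum_distrib_left)
  finally show ?thesis by simp
qed

text \<open>If cell z were kept with probability \<open>p z\<close>, together with all values of
  modulus below 1, the expected weight kept would be at least the left-hand side; the heaviest cell
  does no worse. Cells have width 1/16, and \<open>c\<close> is the endpoint nearest to 0.\<close>

lemma retention_single: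
  fixes x w :: "'t \<Rightarrow> real"
  assumes "finite V" and w: "\<And>t. t \<in> V \<Longrightarrow> 0 \<le> w t"
  obtains c V' where "V' \<subseteq> V" "(\<Sum>t\<in>V. w t * exp (- 17 * trunc_sq (x t))) \<le> sum w V'"
    "\<And>t. t \<in> V' \<Longrightarrow> \<bar>x t\<bar> \<ge> 1 \<Longrightarrow> 1 \<le> \<bar>c\<bar> \<and> \<bar>c\<bar> \<le> \<bar>x t\<bar> \<and> \<bar>x t - c\<bar> \<le> 1/16"
proof (cases "\<exists>t\<in>V. \<bar>x t\<bar> \<ge> 1")
  case False
  have "(\<Sum>t\<in>V. w t * exp (- 17 * trunc_sq (x t))) \<le> sum w V"
    using w by (intro sum_mono mult_left_le) (auto simp: trunc_sq_nonneg)
  then show ?thesis using that[of V 0] False by auto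
next
  case True
  define k where "k = (\<lambda>t. nat \<lfloor>16 * \<bar>x t\<bar>\<rfloor>)"
  define cell where "cell = (\<lambda>t. (x t \<ge> 0, k t))"
  define L where "L = {t \<in> V. \<bar>x t\<bar> \<ge> 1}"
  define S where "S = {t \<in> V. \<bar>x t\<bar> < 1}"
  define Z where "Z = cell ` L"
  define g where "g = (\<lambda>z. sum w S + (\<Sum>t | t \<in> L \<and> cell t = z. w t))"
  define p where "p = (\<lambda>z::bool \<times> nat. (1/2::real) ^ Suc (snd z))"
  have VLS: "V = L \<union> S" "L \<inter> S = {}" and fin: "finite L" "finite S" "finite Z"
    using assms(1) by (auto simp: L_def S_def Z_def)
  have Z: "Z \<noteq> {}" using True by (auto simp: Z_def L_def)
  have k: "16 \<le> k t" "real (k t) \<le> 16 * \<bar>x t\<bar>" "16 * \<bar>x t\<bar> < real (k t) + 1" if "t \<in> L" for t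
  proof -
    have "16 \<le> \<lfloor>16 * \<bar>x t\<bar>\<rfloor>" using that by (simp add: L_def le_floor_iff)
    then show "16 \<le> k t" "real (k t) \<le> 16 * \<bar>x t\<bar>" "16 * \<bar>x t\<bar> < real (k t) + 1"
      unfolding k_def by linarith+
  qed
  have sum_p: "sum p Z \<le> 1"
  proof -
    define K where "K = Max (k ` L)"
    have "Z \<subseteq> UNIV \<times> {1..K}"
    proof
      fix z assume "z \<in> Z"
      then obtain t where t: "t \<in> L" "z = cell t" by (auto simp: Z_def)
      have "k t \<le> K" unfolding K_def using t fin by (intro Max_ge) auto
      then show "z \<in> UNIV \<times> {1..K}" using k(1)[OF t(1)] t by (simp add: cell_def)
    qed
    then have "sum p Z \<le> sum p (UNIV \<times> {1..K})" by (intro sum_mono2) (auto simp: p_def)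
    also have "\<dots> = (\<Sum>b\<in>(UNIV::bool set). \<Sum>j\<in>{1..K}. (1/2) ^ Suc j)"
      unfolding sum.cartesian_product by (simp add: p_def case_prod_unfold)
    also have "\<dots> = (\<Sum>j\<in>{1..K}. (1/2) ^ j)"
      by (simp add: sum_distrib_left[symmetric] sum_divide_distrib[symmetric])
    also have "\<dots> = 1 - (1/2) ^ K" by (induct K) (auto simp: field_simps)
    finally show ?thesis by (simp add: order_trans)
  qed
  define G where "G = Max (g ` Z)"
  have G: "g z \<le> G" if "z \<in> Z" for z unfolding G_def using that fin by (intro Max_ge) auto
  have "(\<Sum>t\<in>V. w t * exp (- 17 * trunc_sq (x t)))
     = (\<Sum>t\<in>L. w t * exp (- 17 * trunc_sq (x t))) + (\<Sum>t\<in>S. w t * exp (- 17 * trunc_sq (x t)))"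
    unfolding VLS(1) using fin VLS(2) by (intro sum.union_disjoint) auto
  also have "(\<Sum>t\<in>S. w t * exp (- 17 * trunc_sq (x t))) \<le> sum w S"
    using w by (intro sum_mono mult_left_le) (auto simp: trunc_sq_nonneg S_def)
  also have "(\<Sum>t\<in>L. w t * exp (- 17 * trunc_sq (x t))) \<le> (\<Sum>t\<in>L. p (cell t) * w t)"
  proof (intro sum_mono)
    fix t assume t: "t \<in> L"
    have x1: "1 \<le> \<bar>x t\<bar>" using t by (simp add: L_def)
    have "exp (- 17 * trunc_sq (x t)) = exp (- 17 * \<bar>x t\<bar>)" using x1 by (simp add: trunc_sq_large)
    \<comment> \<open>Here 17 = 16 + 1: k t is at most 16 \<bar>x t\<bar>, and \<bar>x t\<bar> \<ge>
      1 pays for the extra 1.\<close>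
    also have "\<dots> \<le> exp (- (1 + real (k t)))" using x1 k(2)[OF t] by simp
    also have "\<dots> = exp (-1) ^ Suc (k t)" by (subst exp_of_nat_mult[symmetric]) (simp add: algebra_simps)
    also have "\<dots> \<le> (1/2) ^ Suc (k t)"
      using exp_ge_add_one_self[of 1] by (intro power_mono) (auto simp: exp_minus field_simps)
    finally have "exp (- 17 * trunc_sq (x t)) \<le> p (cell t)" by (simp add: p_def cell_def)
    then show "w t * exp (- 17 * trunc_sq (x t)) \<le> p (cell t) * w t"
      using w[of t] t by (simp add: L_def mult.commute mult_left_mono)
  qed
  also have "(\<Sum>t\<in>L. p (cell t) * w t) = (\<Sum>z\<in>Z. \<Sum>t | t \<in> L \<and> cell t = z. p (cell t) * w t)"
    unfolding Z_def using fin by (intro sum.image_gen) auto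
  also have "\<dots> = (\<Sum>z\<in>Z. p z * (g z - sum w S))"
    by (intro sum.cong refl) (simp add: g_def sum_distrib_left)
  also have "\<dots> \<le> (\<Sum>z\<in>Z. p z * (G - sum w S))"
    using G by (intro sum_mono mult_left_mono) (auto simp: p_def)
  also have "\<dots> = sum p Z * (G - sum w S)" by (simp add: sum_distrib_right)
  also have "\<dots> \<le> 1 * (G - sum w S)"
  proof (intro mult_right_mono sum_p)
    obtain z where "z \<in> Z" using Z by auto
    moreover have "sum w S \<le> g z" for z
      unfolding g_def using w by (auto simp: L_def intro!: sum_nonneg)
    ultimately show "0 \<le> G - sum w S" using G by (metis diff_ge_0_iff_ge order_trans)
  qed
  finally have le: "(\<Sum>t\<in>V. w t * exp (- 17 * trunc_sq (x t))) \<le> G" by simp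
  have "G \<in> g ` Z" unfolding G_def using fin Z by (intro Max_in) auto
  then obtain z where z: "z \<in> Z" "G = g z" by auto
  define V' where "V' = S \<union> {t \<in> L. cell t = z}"
  show ?thesis
  proof (rule that[of V' "(if fst z then 1 else -1) * real (snd z) / 16"])
    show "V' \<subseteq> V" using VLS by (auto simp: V'_def)
    have "sum w V' = g z" unfolding V'_def g_def using fin VLS by (intro sum.union_disjoint) auto
    then show "(\<Sum>t\<in>V. w t * exp (- 17 * trunc_sq (x t))) \<le> sum w V'" using le z by simp
    show "1 \<le> \<bar>(if fst z then 1 else -1) * real (snd z) / 16\<bar> \<and>
        \<bar>(if fst z then 1 else -1) * real (snd z) / 16\<bar> \<le> \<bar>x t\<bar> \<and>
        \<bar>x t - (if fst z then 1 else -1) * real (snd z) / 16\<bar> \<le> 1/16" if "t \<in> V'" "\<bar>x t\<bar> \<ge> 1" for t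
    proof -
      have t: "t \<in> L" "z = cell t" using that by (auto simp: V'_def S_def L_def)
      show ?thesis using k[OF t(1)] by (auto simp: t(2) cell_def)
    qed
  qed
qed

text \<open>
  Each coordinate \<open>i\<close> keeps the small values and one randomly chosen cell of large values, the
  \<open>k\<close>-th cell having probability \<open>2 powr (-k-1)\<close>; the proof is the derandomized form.
\<close>

lemma retention:
  fixes u :: "'t \<Rightarrow> 'i \<Rightarrow> real"
  assumes "finite I" "finite V" and M: "\<And>t. t \<in> V \<Longrightarrow> (\<Sum>i\<in>I. trunc_sq (u t i)) \<le> M"
  obtains v V' where "V' \<subseteq> V" "card V' \<ge> card V * exp (- 17 * M)"
    "\<And>t i. t \<in> V' \<Longrightarrow> i \<in> I \<Longrightarrow> \<bar>u t i\<bar> \<ge> 1 \<Longrightarrow>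
       1 \<le> \<bar>v i\<bar> \<and> \<bar>v i\<bar> \<le> \<bar>u t i\<bar> \<and> \<bar>u t i - v i\<bar> \<le> 1/16"
proof -
  have "\<exists>v V'. V' \<subseteq> V \<and> (\<Sum>t\<in>V. exp (- 17 * (\<Sum>i\<in>I. trunc_sq (u t i)))) \<le> card V' \<and>
     (\<forall>t\<in>V'. \<forall>i\<in>I. \<bar>u t i\<bar> \<ge> 1 \<longrightarrow> 1 \<le> \<bar>v i\<bar> \<and> \<bar>v i\<bar> \<le> \<bar>u t i\<bar> \<and> \<bar>u t i - v i\<bar> \<le> 1/16)"
    using assms(1,2)
  proof (induct arbitrary: V)
    case empty
    then show ?case by (intro exI[of _ "\<lambda>_. 0"] exI[of _ V]) auto
  next
    case (insert j I)
    \<comment> \<open>As in the method of conditional expectations, the weight of t is the cost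
      still to be paid on the coordinates in I.\<close>
    obtain c V1 where V1: "V1 \<subseteq> V"
      "(\<Sum>t\<in>V. exp (- 17 * (\<Sum>i\<in>I. trunc_sq (u t i))) * exp (- 17 * trunc_sq (u t j)))
         \<le> (\<Sum>t\<in>V1. exp (- 17 * (\<Sum>i\<in>I. trunc_sq (u t i))))"
      "\<And>t. t \<in> V1 \<Longrightarrow> \<bar>u t j\<bar> \<ge> 1 \<Longrightarrow> 1 \<le> \<bar>c\<bar> \<and> \<bar>c\<bar> \<le> \<bar>u t j\<bar> \<and> \<bar>u t j - c\<bar> \<le> 1/16"
      by (rule retention_single[of V "\<lambda>t. exp (- 17 * (\<Sum>i\<in>I. trunc_sq (u t i)))" "\<lambda>t. u t j"])
        (use insert(4) in auto)
    have "finite V1" using V1 insert(4) finite_subset by auto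
    then obtain v V' where V': "V' \<subseteq> V1" "(\<Sum>t\<in>V1. exp (- 17 * (\<Sum>i\<in>I. trunc_sq (u t i)))) \<le> card V'"
      "\<forall>t\<in>V'. \<forall>i\<in>I. \<bar>u t i\<bar> \<ge> 1 \<longrightarrow> 1 \<le> \<bar>v i\<bar> \<and> \<bar>v i\<bar> \<le> \<bar>u t i\<bar> \<and> \<bar>u t i - v i\<bar> \<le> 1/16"
      using insert(3)[of V1] by blast
    have "(\<Sum>t\<in>V. exp (- 17 * (\<Sum>i\<in>insert j I. trunc_sq (u t i)))) \<le> card V'"
      using V1(2) V'(2) insert(1,2) by (simp add: algebra_simps flip: exp_add)
    moreover have "\<forall>t\<in>V'. \<forall>i\<in>insert j I. \<bar>u t i\<bar> \<ge> 1 \<longrightarrow> 1 \<le> \<bar>(v(j := c)) i\<bar> \<and>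
        \<bar>(v(j := c)) i\<bar> \<le> \<bar>u t i\<bar> \<and> \<bar>u t i - (v(j := c)) i\<bar> \<le> 1/16"
      using V'(1,3) V1(3) by auto
    ultimately show ?case using V'(1) V1(1) by (intro exI[of _ "v(j := c)"] exI[of _ V']) auto
  qed
  then obtain v V' where V': "V' \<subseteq> V" "(\<Sum>t\<in>V. exp (- 17 * (\<Sum>i\<in>I. trunc_sq (u t i)))) \<le> card V'"
    "\<forall>t\<in>V'. \<forall>i\<in>I. \<bar>u t i\<bar> \<ge> 1 \<longrightarrow> 1 \<le> \<bar>v i\<bar> \<and> \<bar>v i\<bar> \<le> \<bar>u t i\<bar> \<and> \<bar>u t i - v i\<bar> \<le> 1/16"
    by blast
  have "card V * exp (- 17 * M) = (\<Sum>t\<in>V. exp (- 17 * M))" by simp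
  also have "\<dots> \<le> (\<Sum>t\<in>V. exp (- 17 * (\<Sum>i\<in>I. trunc_sq (u t i))))" using M by (intro sum_mono) auto
  finally show ?thesis using V' by (intro that[of V' v]) auto
qed

text \<open>
  The joint law of a hidden parameter and an independent posterior sample of it, for a uniform
  prior on \<open>U\<close> and likelihoods \<open>\<phi>\<close> at a fixed observation (not normalized).
\<close>

definition posterior_pair :: "'t set \<Rightarrow> ('t \<Rightarrow> real) \<Rightarrow> 't \<Rightarrow> 't \<Rightarrow> real" where
  "posterior_pair U \<phi> t s = \<phi> t * \<phi> s / sum \<phi> U"

lemma posterior_pair_commute: "posterior_pair U \<phi> t s = posterior_pair U \<phi> s t"
  by (simp add: posterior_pair_def mult.commute)

lemma posterior_pair_nonneg:
  "(\<And>t. t \<in> U \<Longrightarrow> 0 \<le> \<phi> t) \<Longrightarrow> t \<in> U \<Longrightarrow> s \<in> U \<Longrightarrow> 0 \<le> posterior_pair U \<phi> t s"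
  by (simp add: posterior_pair_def sum_nonneg)

lemma sum_posterior_pair:
  assumes "finite U" "\<And>t. t \<in> U \<Longrightarrow> 0 \<le> \<phi> t" "t \<in> U"
  shows "(\<Sum>s\<in>U. posterior_pair U \<phi> t s) = \<phi> t"
proof (cases "sum \<phi> U = 0")
  case True
  \<comment> \<open>Division by 0 gives 0, which is the right value since the likelihood vanishes
    too.\<close>
  then have "\<phi> t = 0" using assms by (simp add: sum_nonneg_eq_0_iff)
  then show ?thesis by (simp add: posterior_pair_def)
next
  case False
  then show ?thesis by (simp add: posterior_pair_def flip: sum_divide_distrib sum_distrib_left)
qed

text \<open>Exchangeability of the hidden point and the sample: a score that depends on only one of
  them has the same mean for both.\<close>

lemma sum_posterior_pair_swap:
  "(\<Sum>t\<in>U. \<Sum>s\<in>U. posterior_pair U \<phi> t s * g t s) = (\<Sum>t\<in>U. \<Sum>s\<in>U. posterior_pair U \<phi> t s * g s t)"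
  by (subst sum.swap) (simp add: posterior_pair_commute)

text \<open>Bounds the chance that the sample hits the hidden point by second moments of the
  likelihoods: if \<phi> t \<le> c, the posterior weight is multiplied by at most c; otherwise
  \<phi> t is at most its square over c.\<close>

lemma posterior_pair_diag_le:
  assumes "finite U" "\<And>t. t \<in> U \<Longrightarrow> 0 \<le> \<phi> t" "c > 0"
  shows "(\<Sum>t\<in>U. posterior_pair U \<phi> t t) \<le> c + (\<Sum>t\<in>U. (\<phi> t)\<^sup>2) / c"
proof (cases "sum \<phi> U = 0")
  case True
  then show ?thesis using assms by (simp add: posterior_pair_def sum_nonneg)
next
  case False
  then have S: "sum \<phi> U > 0" using assms by (simp add: sum_nonneg order_less_le)
  have "posterior_pair U \<phi> t t \<le> c * (\<phi> t / sum \<phi> U) + (\<phi> t)\<^sup>2 / c" if t: "t \<in> U" for t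
  proof (cases "\<phi> t \<le> c")
    case True
    have "posterior_pair U \<phi> t t = \<phi> t * (\<phi> t / sum \<phi> U)" by (simp add: posterior_pair_def)
    also have "\<dots> \<le> c * (\<phi> t / sum \<phi> U)" using True S assms(2)[OF t] by (intro mult_right_mono) auto
    finally show ?thesis using assms(3) by (simp add: add_increasing2)
  next
    case False
    have "\<phi> t \<le> sum \<phi> U" using assms t by (intro member_le_sum) auto
    then have "posterior_pair U \<phi> t t \<le> \<phi> t"
      using S assms(2)[OF t] by (simp add: posterior_pair_def divide_le_eq mult_left_mono)
    also have "\<phi> t \<le> (\<phi> t)\<^sup>2 / c" using False assms(2)[OF t] assms(3)
      by (simp add: power2_eq_square le_divide_eq mult_left_mono)
    finally show ?thesis using S assms(3) assms(2)[OF t] by (simp add: add_increasing)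
  qed
  then have "(\<Sum>t\<in>U. posterior_pair U \<phi> t t) \<le> (\<Sum>t\<in>U. c * (\<phi> t / sum \<phi> U) + (\<phi> t)\<^sup>2 / c)"
    by (rule sum_mono)
  also have "\<dots> = c + (\<Sum>t\<in>U. (\<phi> t)\<^sup>2) / c"
  proof -
    have "(\<Sum>t\<in>U. c * (\<phi> t / sum \<phi> U)) = c * (sum \<phi> U / sum \<phi> U)"
      by (simp only: sum_distrib_left sum_divide_distrib)
    then show ?thesis using S by (simp add: sum.distrib sum_divide_distrib)
  qed
  finally show ?thesis .
qed

section \<open>Sudakov minoration for Rademacher averages\<close>

text \<open>The mean of the tilted sign. It saturates because a sign has mean at most 1; the factor
  1/2 below modulus 1 leaves a jump of size 1/2 that separates small values from large ones.\<close>

definition bias :: "real \<Rightarrow> real" where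
  "bias x = (if \<bar>x\<bar> < 1 then x / 2 else sgn x)"

lemma bias_bounded: "\<bar>bias x\<bar> \<le> 1"
  by (auto simp: bias_def abs_sgn_eq)

lemma bias_square_le: "(bias x)\<^sup>2 \<le> trunc_sq x"
proof (cases "\<bar>x\<bar> < 1")
  case True
  then have "(bias x)\<^sup>2 = x\<^sup>2 / 4" by (simp add: bias_def power_divide)
  also have "\<dots> \<le> x\<^sup>2" by simp
  finally show ?thesis using True by (simp add: trunc_sq_small)
next
  case False
  then have "(bias x)\<^sup>2 \<le> 1" using bias_bounded[of x] by (simp add: abs_square_le_1)
  then show ?thesis using False by (simp add: trunc_sq_large)
qed

lemma bias_mono: "x \<le> y \<Longrightarrow> bias x \<le> bias y"
  by (auto simp: bias_def sgn_if)

lemma bias_diff_mult_nonneg: "0 \<le> (x - y) * (bias x - bias y)"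
  using bias_mono[of x y] bias_mono[of y x] by (simp add: zero_le_mult_iff) linarith

text \<open>Two large values of the same sign have equal bias and give no signal; that case is
  excluded. If both values are small, \<open>bias\<close> has slope 1/2; if exactly one is, the jump
  gives a difference of at least 1/2.\<close>

lemma bias_diff_mult_ge:
  assumes "\<bar>x\<bar> < 1 \<or> \<bar>y\<bar> < 1"
  shows "(x - y) * (bias x - bias y) \<ge> trunc_sq (x - y) / 2"
proof -
  have main: "(x - y) * (bias x - bias y) \<ge> trunc_sq (x - y) / 2" if y: "\<bar>y\<bar> < 1" for x y
  proof (cases "\<bar>x\<bar> < 1")
    case True
    then have "(x - y) * (bias x - bias y) = (x - y)\<^sup>2 / 2"
      using y by (simp add: bias_def power2_eq_square flip: diff_divide_distrib)
    then show ?thesis using trunc_sq_le(2)[of "x - y"] by simp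
  next
    case False
    have "(x - y) * (bias x - bias y) \<ge> \<bar>x - y\<bar> / 2"
    proof (cases "x \<ge> 0")
      case True
      then have "x \<ge> 1" using False by simp
      then have "(x - y) * (1/2) \<le> (x - y) * (bias x - bias y)"
        using y by (intro mult_left_mono) (auto simp: bias_def)
      then show ?thesis using \<open>x \<ge> 1\<close> y by simp
    next
      case neg: False
      then have "x \<le> -1" using False by simp
      then have "(y - x) * (1/2) \<le> (y - x) * (bias y - bias x)"
        using y by (intro mult_left_mono) (auto simp: bias_def)
      then show ?thesis using \<open>x \<le> -1\<close> y by (simp add: algebra_simps)
    qed
    then show ?thesis using trunc_sq_le(1)[of "x - y"] by simp
  qed
  show ?thesis
  proof (cases "\<bar>y\<bar> < 1")
    case True then show ?thesis by (rule main)
  next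
    case False
    then have "\<bar>x\<bar> < 1" using assms by simp
    from main[OF this, of y] show ?thesis
      using trunc_sq_minus[of "x - y"] by (simp add: algebra_simps)
  qed
qed

text \<open>
  The hidden point \<open>t\<close> tilts the sign \<open>\<sigma> i\<close> to have mean \<open>bias (u t i)\<close>. A posterior sample \<open>s\<close>
  is exchangeable with \<open>t\<close>, so the signal it misses is paid for by the noise, which is at most
  the Rademacher average; and there are too many points for \<open>s = t\<close> to be likely.
\<close>

lemma rad_ge_retained:
  fixes u :: "'t \<Rightarrow> 'i \<Rightarrow> real"
  assumes fin: "finite I" "finite V" and V: "V \<noteq> {}"
    and ball: "\<And>t. t \<in> V \<Longrightarrow> (\<Sum>i\<in>I. trunc_sq (u t i)) \<le> 2 * m"
    and sep: "\<And>s t. s \<in> V \<Longrightarrow> t \<in> V \<Longrightarrow> s \<noteq> t \<Longrightarrow> (\<Sum>i\<in>I. trunc_sq (u t i - u s i)) \<ge> m"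
    and ret: "\<And>s t i. s \<in> V \<Longrightarrow> t \<in> V \<Longrightarrow> i \<in> I \<Longrightarrow> \<bar>u t i\<bar> \<ge> 1 \<Longrightarrow> \<bar>u s i\<bar> \<ge> 1 \<Longrightarrow> \<bar>u t i - u s i\<bar> \<le> 1/8"
    and card: "real (card V) \<ge> exp (16 * m)" and m: "m \<ge> 1/3"
  shows "rad I V u \<ge> m / 32"
proof -
  define h where "h = (\<lambda>t i. bias (u t i))"
  define \<phi> where "\<phi> = (\<lambda>\<sigma> t. \<Prod>i\<in>I. 1 + h t i * \<sigma> i)"
  define K where "K = (\<lambda>\<sigma> t s. posterior_pair V (\<phi> \<sigma>) t s)"
  define n where "n = (2::real) ^ card I"
  define N where "N = real (card V)"
  have n0: "n > 0" by (simp add: n_def)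
  have N0: "N > 0" using V fin by (simp add: N_def card_gt_0_iff)
  have finS: "finite (signs I)" using fin by (simp add: finite_signs)
  have \<phi>0: "0 \<le> \<phi> \<sigma> t" if "\<sigma> \<in> signs I" for \<sigma> t
    unfolding \<phi>_def
  proof (intro prod_nonneg)
    fix i assume "i \<in> I"
    then have "\<bar>h t i * \<sigma> i\<bar> \<le> 1" using bias_bounded[of "u t i"] signs_abs[OF that, of i] by (simp add: abs_mult h_def)
    then show "0 \<le> 1 + h t i * \<sigma> i" by (simp add: abs_le_iff)
  qed
  have K0: "0 \<le> K \<sigma> t s" if "\<sigma> \<in> signs I" "t \<in> V" "s \<in> V" for \<sigma> t s
    unfolding K_def using that \<phi>0 by (intro posterior_pair_nonneg) auto
  have Ksum: "(\<Sum>s\<in>V. K \<sigma> t s) = \<phi> \<sigma> t" if "\<sigma> \<in> signs I" "t \<in> V" for \<sigma> t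
    unfolding K_def using that \<phi>0 fin by (intro sum_posterior_pair) auto
  have \<phi>sum: "(\<Sum>\<sigma>\<in>signs I. \<phi> \<sigma> t) = n" for t
    unfolding \<phi>_def using sum_signs_prod[OF fin(1), of "\<lambda>i x. 1 + h t i * x"] by (simp add: n_def)
  have \<phi>sq: "(\<Sum>\<sigma>\<in>signs I. (\<phi> \<sigma> t)\<^sup>2) \<le> n * exp (2 * m)" if t: "t \<in> V" for t
  proof -
    have "(\<Sum>\<sigma>\<in>signs I. (\<phi> \<sigma> t)\<^sup>2) = (\<Prod>i\<in>I. (1 + h t i)\<^sup>2 + (1 - h t i)\<^sup>2)"
      using sum_signs_prod[OF fin(1), of "\<lambda>i x. (1 + h t i * x)\<^sup>2"]
      by (simp add: \<phi>_def prod_power_distrib)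
    also have "\<dots> = (\<Prod>i\<in>I. 2 * (1 + (h t i)\<^sup>2))"
      by (intro prod.cong) (auto simp: power2_eq_square algebra_simps)
    also have "\<dots> = n * (\<Prod>i\<in>I. 1 + (h t i)\<^sup>2)" unfolding prod.distrib by (simp add: n_def)
    also have "(\<Prod>i\<in>I. 1 + (h t i)\<^sup>2) \<le> (\<Prod>i\<in>I. exp (trunc_sq (u t i)))"
    proof (intro prod_mono conjI)
      fix i
      have "1 + (h t i)\<^sup>2 \<le> 1 + trunc_sq (u t i)" using bias_square_le by (simp add: h_def)
      also have "\<dots> \<le> exp (trunc_sq (u t i))" by (rule exp_ge_add_one_self)
      finally show "1 + (h t i)\<^sup>2 \<le> exp (trunc_sq (u t i))" .
    qed (simp add: add_increasing)
    also have "\<dots> = exp (\<Sum>i\<in>I. trunc_sq (u t i))" by (simp add: exp_sum fin)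
    also have "\<dots> \<le> exp (2 * m)" using ball[OF t] by simp
    finally show ?thesis using n0 by simp
  qed
  \<comment> \<open>The threshold c = exp (8 m) lies between the second moment exp (2 m) and the
    cardinality exp (16 m); since m \<ge> 1/3, both resulting terms are at most N exp (-2) per
    observation.\<close>
  have diag: "(\<Sum>\<sigma>\<in>signs I. \<Sum>t\<in>V. K \<sigma> t t) \<le> n * N / 2"
  proof -
    have "(\<Sum>\<sigma>\<in>signs I. \<Sum>t\<in>V. K \<sigma> t t) \<le> (\<Sum>\<sigma>\<in>signs I. exp (8 * m) + (\<Sum>t\<in>V. (\<phi> \<sigma> t)\<^sup>2) / exp (8 * m))"
      unfolding K_def using fin \<phi>0 by (intro sum_mono posterior_pair_diag_le) auto
    also have "\<dots> = n * exp (8 * m) + (\<Sum>t\<in>V. \<Sum>\<sigma>\<in>signs I. (\<phi> \<sigma> t)\<^sup>2) / exp (8 * m)"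
      by (simp add: sum.distrib card_signs fin n_def sum_divide_distrib[symmetric] sum.swap[of _ V])
    also have "\<dots> \<le> n * exp (8 * m) + (\<Sum>t\<in>V. n * exp (2 * m)) / exp (8 * m)"
      using \<phi>sq by (intro add_left_mono divide_right_mono sum_mono) auto
    also have "n * exp (8 * m) + (\<Sum>t\<in>V. n * exp (2 * m)) / exp (8 * m) = n * (exp (8 * m) + N * exp (- 6 * m))"
    proof -
      have "exp (2 * m) / exp (8 * m) = exp (- 6 * m)" by (simp flip: exp_diff)
      then show ?thesis by (simp add: N_def field_simps)
    qed
    also have "exp (8 * m) + N * exp (- 6 * m) \<le> N * exp (- 2) + N * exp (- 2)"
    proof (intro add_mono mult_left_mono)
      have "exp (8 * m) = exp (16 * m) * exp (- 8 * m)" by (simp flip: exp_add)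
      also have "\<dots> \<le> N * exp (- 2)" using card m by (intro mult_mono) (auto simp: N_def)
      finally show "exp (8 * m) \<le> N * exp (- 2)" .
      show "exp (- 6 * m) \<le> exp (- 2)" using m by simp
    qed (use N0 in simp)
    also have "\<dots> \<le> N * (1/4) + N * (1/4)"
    proof -
      have "(2::real)\<^sup>2 \<le> exp 1 ^ 2" using exp_ge_add_one_self[of 1] by (intro power_mono) auto
      then have "4 \<le> exp (2::real)" by (simp flip: exp_of_nat_mult)
      then have "exp (- 2 :: real) \<le> 1/4" by (simp add: exp_minus field_simps)
      then show ?thesis using N0 by (intro add_mono mult_left_mono) auto
    qed
    finally show ?thesis using n0 by simp
  qed
  have inner_ge: "(\<Sum>i\<in>I. (u t i - u s i) * (h t i - h s i)) \<ge> 2/5 * m" if st: "s \<in> V" "t \<in> V" "s \<noteq> t" for s t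
  proof -
    \<comment> \<open>On \<open>J\<close> the signal may vanish. It has at most 2 m elements, since
      each costs at least 1, and by \<open>ret\<close> it contributes at most 2 m / 64 to the
      separation.\<close>
    define J where "J = {i \<in> I. \<bar>u t i\<bar> \<ge> 1 \<and> \<bar>u s i\<bar> \<ge> 1}"
    have J: "J \<subseteq> I" "finite J" using fin by (auto simp: J_def)
    have "real (card J) \<le> (\<Sum>i\<in>J. trunc_sq (u t i))"
      using sum_mono[of J "\<lambda>_. 1" "\<lambda>i. trunc_sq (u t i)"] by (simp add: J_def trunc_sq_large)
    also have "\<dots> \<le> (\<Sum>i\<in>I. trunc_sq (u t i))" using J fin by (intro sum_mono2) (auto simp: trunc_sq_nonneg)
    finally have cJ: "real (card J) \<le> 2 * m" using ball[OF st(2)] by linarith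
    have "(\<Sum>i\<in>J. trunc_sq (u t i - u s i)) \<le> (\<Sum>i\<in>J. 1/64)"
    proof (intro sum_mono)
      fix i assume "i \<in> J"
      then have "\<bar>u t i - u s i\<bar> \<le> 1/8" using ret[OF st(1,2)] by (auto simp: J_def)
      then have "(u t i - u s i)\<^sup>2 \<le> (1/8)\<^sup>2" by (metis abs_ge_zero power2_abs power_mono)
      then show "trunc_sq (u t i - u s i) \<le> 1/64"
        using trunc_sq_le(2)[of "u t i - u s i"] by (simp add: power2_eq_square)
    qed
    then have smallJ: "(\<Sum>i\<in>J. trunc_sq (u t i - u s i)) \<le> m / 32" using cJ by simp
    have "m \<le> (\<Sum>i\<in>J. trunc_sq (u t i - u s i)) + (\<Sum>i\<in>I - J. trunc_sq (u t i - u s i))"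
      using sep[OF st] J fin by (simp add: sum.subset_diff add.commute)
    then have "m / 2 - m / 64 \<le> (\<Sum>i\<in>I - J. trunc_sq (u t i - u s i)) / 2" using smallJ by simp
    also have "\<dots> \<le> (\<Sum>i\<in>I - J. (u t i - u s i) * (h t i - h s i))"
      unfolding sum_divide_distrib h_def
      by (intro sum_mono bias_diff_mult_ge) (auto simp: J_def)
    also have "\<dots> \<le> (\<Sum>i\<in>I. (u t i - u s i) * (h t i - h s i))"
      using fin by (intro sum_mono2) (auto simp: h_def bias_diff_mult_nonneg)
    finally show ?thesis using m by simp
  qed
  define X where "X = (\<lambda>\<sigma> t. \<Sum>i\<in>I. u t i * \<sigma> i)"
  define D where "D = (\<lambda>t s. \<Sum>i\<in>I. (u t i - u s i) * h t i)"
  define G where "G = (\<lambda>\<sigma> t. MAX s\<in>V. \<Sum>i\<in>I. (u s i - u t i) * (\<sigma> i - h t i))"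
  have "(\<Sum>t\<in>V. \<Sum>s\<in>V. K \<sigma> t s * (X \<sigma> t - X \<sigma> s)) = 0" for \<sigma>
    using sum_posterior_pair_swap[of V "\<phi> \<sigma>" "\<lambda>t s. X \<sigma> t"]
    by (simp add: K_def right_diff_distrib sum_subtractf)
  then have "0 = (\<Sum>\<sigma>\<in>signs I. \<Sum>t\<in>V. \<Sum>s\<in>V. K \<sigma> t s * (X \<sigma> t - X \<sigma> s))" by simp
  also have "\<dots> \<ge> (\<Sum>\<sigma>\<in>signs I. \<Sum>t\<in>V. \<Sum>s\<in>V. K \<sigma> t s * (D t s - G \<sigma> t))"
  proof (intro sum_mono mult_left_mono K0)
    fix \<sigma> t s assume "t \<in> V" "s \<in> V"
    have "(\<Sum>i\<in>I. (u s i - u t i) * (\<sigma> i - h t i)) \<le> G \<sigma> t"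
      unfolding G_def using \<open>s \<in> V\<close> fin by (intro Max_ge) auto
    moreover have "(\<Sum>i\<in>I. (u s i - u t i) * (\<sigma> i - h t i)) = X \<sigma> s - X \<sigma> t + D t s"
      by (simp add: X_def D_def algebra_simps sum.distrib sum_subtractf)
    ultimately show "D t s - G \<sigma> t \<le> X \<sigma> t - X \<sigma> s" by simp
  qed auto
  finally have "(\<Sum>\<sigma>\<in>signs I. \<Sum>t\<in>V. \<Sum>s\<in>V. K \<sigma> t s * D t s)
     \<le> (\<Sum>\<sigma>\<in>signs I. \<Sum>t\<in>V. \<Sum>s\<in>V. K \<sigma> t s * G \<sigma> t)"
    by (simp add: right_diff_distrib sum_subtractf)
  also have "\<dots> = (\<Sum>\<sigma>\<in>signs I. \<Sum>t\<in>V. \<phi> \<sigma> t * G \<sigma> t)"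
    by (intro sum.cong refl) (simp add: Ksum flip: sum_distrib_right)
  also have "\<dots> = (\<Sum>t\<in>V. \<Sum>\<sigma>\<in>signs I. \<phi> \<sigma> t * G \<sigma> t)" by (rule sum.swap)
  also have "\<dots> \<le> (\<Sum>t\<in>V. 2 * n * rad I V u)"
  proof (intro sum_mono)
    fix t assume t: "t \<in> V"
    have "(\<Sum>\<sigma>\<in>signs I. \<phi> \<sigma> t * G \<sigma> t) \<le> (\<Sum>\<sigma>\<in>signs I. MAX s\<in>V. 0 + (\<Sum>i\<in>I. 2 * (u s i - u t i) * \<sigma> i))"
      unfolding \<phi>_def G_def
      using signs_biased_le[OF fin V, of "h t" "\<lambda>_. 0" "\<lambda>s i. u s i - u t i"] bias_bounded
      by (simp add: h_def)
    also have "\<dots> = n * rad I V (\<lambda>s i. 2 * (u s i - u t i))" by (simp add: rad_def n_def)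
    also have "\<dots> = 2 * n * rad I V u" by (subst rad_affine) (use fin V in auto)
    finally show "(\<Sum>\<sigma>\<in>signs I. \<phi> \<sigma> t * G \<sigma> t) \<le> 2 * n * rad I V u" .
  qed
  finally have upper: "(\<Sum>\<sigma>\<in>signs I. \<Sum>t\<in>V. \<Sum>s\<in>V. K \<sigma> t s * D t s) \<le> N * (2 * n * rad I V u)"
    by (simp add: N_def)
  have nN: "n * N = (\<Sum>\<sigma>\<in>signs I. \<Sum>t\<in>V. \<Sum>s\<in>V. K \<sigma> t s)"
  proof -
    have "(\<Sum>\<sigma>\<in>signs I. \<Sum>t\<in>V. \<Sum>s\<in>V. K \<sigma> t s) = (\<Sum>\<sigma>\<in>signs I. \<Sum>t\<in>V. \<phi> \<sigma> t)" by (simp add: Ksum)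
    also have "\<dots> = (\<Sum>t\<in>V. \<Sum>\<sigma>\<in>signs I. \<phi> \<sigma> t)" by (rule sum.swap)
    finally show ?thesis by (simp add: \<phi>sum N_def)
  qed
  \<comment> \<open>By \<open>diag\<close> at least half of the mass n N is off the diagonal, where
    D t s + D s t is the full signal; symmetrizing D is free by exchangeability.\<close>
  have "m / 5 * (n * N / 2) \<le> m / 5 * ((\<Sum>\<sigma>\<in>signs I. \<Sum>t\<in>V. \<Sum>s\<in>V. K \<sigma> t s) - (\<Sum>\<sigma>\<in>signs I. \<Sum>t\<in>V. K \<sigma> t t))"
    using diag m nN by (intro mult_left_mono) linarith+
  also have "(\<Sum>\<sigma>\<in>signs I. \<Sum>t\<in>V. \<Sum>s\<in>V. K \<sigma> t s) - (\<Sum>\<sigma>\<in>signs I. \<Sum>t\<in>V. K \<sigma> t t)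
      = (\<Sum>\<sigma>\<in>signs I. \<Sum>t\<in>V. \<Sum>s\<in>V. K \<sigma> t s * (if s = t then 0 else 1))"
    unfolding sum_subtractf[symmetric]
  proof (intro sum.cong refl)
    fix \<sigma> t assume "t \<in> V"
    then show "(\<Sum>s\<in>V. K \<sigma> t s) - K \<sigma> t t = (\<Sum>s\<in>V. K \<sigma> t s * (if s = t then 0 else 1))"
      using fin by (simp add: sum.remove[of V t] if_distrib cong: if_cong)
  qed
  also have "m / 5 * \<dots> = (\<Sum>\<sigma>\<in>signs I. \<Sum>t\<in>V. \<Sum>s\<in>V. K \<sigma> t s * (if s = t then 0 else m / 5))"
    unfolding sum_distrib_left by (intro sum.cong refl) auto
  also have "\<dots> \<le> (\<Sum>\<sigma>\<in>signs I. \<Sum>t\<in>V. \<Sum>s\<in>V. K \<sigma> t s * ((D t s + D s t) / 2))"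
  proof (intro sum_mono mult_left_mono K0)
    fix t s assume "t \<in> V" "s \<in> V"
    moreover have "D t s + D s t = (\<Sum>i\<in>I. (u t i - u s i) * (h t i - h s i))"
      by (simp add: D_def algebra_simps sum.distrib sum_subtractf)
    ultimately show "(if s = t then 0 else m / 5) \<le> (D t s + D s t) / 2"
      using inner_ge[of s t] by auto
  qed auto
  also have "\<dots> = (\<Sum>\<sigma>\<in>signs I. \<Sum>t\<in>V. \<Sum>s\<in>V. K \<sigma> t s * D t s)"
  proof (rule sum.cong[OF refl])
    fix \<sigma>
    show "(\<Sum>t\<in>V. \<Sum>s\<in>V. K \<sigma> t s * ((D t s + D s t) / 2)) = (\<Sum>t\<in>V. \<Sum>s\<in>V. K \<sigma> t s * D t s)"
      using sum_posterior_pair_swap[of V "\<phi> \<sigma>" D]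
      by (simp add: K_def add_divide_distrib distrib_left sum.distrib flip: sum_divide_distrib)
  qed
  finally have "m / 5 * (n * N / 2) \<le> N * (2 * n * rad I V u)" using upper by linarith
  then have "(n * N) * (m / 20) \<le> (n * N) * rad I V u" by (simp add: algebra_simps)
  then have "m / 20 \<le> rad I V u" using n0 N0 by (simp add: mult_le_cancel_left_pos)
  then show ?thesis using m by simp
qed

text \<open>Retention with budget 2 m loses a factor exp (34 m), whence 50 = 16 + 34. Retained large
  values lie within 1/16 of a common value, hence within 1/8 of each other.\<close>

lemma rad_ge:
  fixes u :: "'t \<Rightarrow> 'i \<Rightarrow> real"
  assumes fin: "finite I" "finite V"
    and ball: "\<And>t. t \<in> V \<Longrightarrow> (\<Sum>i\<in>I. trunc_sq (u t i)) \<le> 2 * m"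
    and sep: "\<And>s t. s \<in> V \<Longrightarrow> t \<in> V \<Longrightarrow> s \<noteq> t \<Longrightarrow> (\<Sum>i\<in>I. trunc_sq (u t i - u s i)) \<ge> m"
    and card: "real (card V) \<ge> exp (50 * m)" and m: "m \<ge> 1/3"
  shows "rad I V u \<ge> m / 32"
proof -
  obtain v V' where V': "V' \<subseteq> V" "card V' \<ge> card V * exp (- 17 * (2 * m))"
    "\<And>t i. t \<in> V' \<Longrightarrow> i \<in> I \<Longrightarrow> \<bar>u t i\<bar> \<ge> 1 \<Longrightarrow> 1 \<le> \<bar>v i\<bar> \<and> \<bar>v i\<bar> \<le> \<bar>u t i\<bar> \<and> \<bar>u t i - v i\<bar> \<le> 1/16"
    by (rule retention[OF fin, of u "2 * m"]) (use ball in auto)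
  have "exp (16 * m) = exp (50 * m) * exp (- 17 * (2 * m))" by (simp flip: exp_add)
  also have "\<dots> \<le> card V * exp (- 17 * (2 * m))" using card by (intro mult_right_mono) auto
  finally have c: "real (card V') \<ge> exp (16 * m)" using V'(2) by linarith
  then have ne: "V' \<noteq> {}" by (metis card.empty exp_gt_zero not_less of_nat_0)
  have "m / 32 \<le> rad I V' u"
  proof (rule rad_ge_retained[OF fin(1) _ ne])
    show "finite V'" using V' fin finite_subset by auto
    show "\<bar>u t i - u s i\<bar> \<le> 1/8" if "s \<in> V'" "t \<in> V'" "i \<in> I" "\<bar>u t i\<bar> \<ge> 1" "\<bar>u s i\<bar> \<ge> 1" for s t i
      using V'(3)[OF that(2,3,4)] V'(3)[OF that(1,3,5)] by linarith
    show "m \<le> (\<Sum>i\<in>I. trunc_sq (u t i - u s i))" if "s \<in> V'" "t \<in> V'" "s \<noteq> t" for s t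
      using sep[of s t] that V'(1) by blast
  qed (use V'(1) ball c m in auto)
  also have "\<dots> \<le> rad I V u" using fin V' ne by (intro rad_mono_set) auto
  finally show ?thesis .
qed

section \<open>Coverings and localization\<close>

lemma maximal_separated_subset:
  assumes "finite U"
  obtains W where "W \<subseteq> U" "\<And>s t. s \<in> W \<Longrightarrow> t \<in> W \<Longrightarrow> s \<noteq> t \<Longrightarrow> r s t"
    "\<And>t. t \<in> U \<Longrightarrow> \<exists>w\<in>W. t = w \<or> \<not> r w t \<or> \<not> r t w"
proof -
  define P where "P = {W. W \<subseteq> U \<and> (\<forall>s\<in>W. \<forall>t\<in>W. s \<noteq> t \<longrightarrow> r s t)}"
  have "finite P" "{} \<in> P" using assms by (auto simp: P_def)
  then obtain W where W: "W \<in> P" "\<And>W'. W' \<in> P \<Longrightarrow> W \<subseteq> W' \<Longrightarrow> W = W'"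
    using finite_has_maximal[of P] by (metis empty_iff)
  show ?thesis
  proof (rule that[of W])
    fix t assume t: "t \<in> U"
    show "\<exists>w\<in>W. t = w \<or> \<not> r w t \<or> \<not> r t w"
    proof (rule ccontr)
      assume "\<not> ?thesis"
      then have "insert t W \<in> P" "t \<notin> W" using W(1) t by (auto simp: P_def)
      then show False using W(2)[of "insert t W"] by auto
    qed
  qed (use W in \<open>auto simp: P_def\<close>)
qed

lemma exists_large_fiber:
  assumes "finite U" "finite W" "U \<noteq> {}" "\<And>t. t \<in> U \<Longrightarrow> \<exists>w\<in>W. r w t"
  obtains w where "w \<in> W" "real (card {t \<in> U. r w t}) * card W \<ge> card U"
proof (rule ccontr)
  note found = that
  assume "\<not> thesis"
  then have less: "real (card {t \<in> U. r w t}) * card W < card U" if "w \<in> W" for w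
    using found[OF that] by force
  have W: "W \<noteq> {}" using assms(3,4) by blast
  have "U \<subseteq> (\<Union>w\<in>W. {t \<in> U. r w t})" using assms(4) by blast
  then have "card U \<le> card (\<Union>w\<in>W. {t \<in> U. r w t})" using assms by (intro card_mono) auto
  also have "\<dots> \<le> (\<Sum>w\<in>W. card {t \<in> U. r w t})" by (rule card_UN_le[OF assms(2)])
  finally have "real (card U) \<le> (\<Sum>w\<in>W. real (card {t \<in> U. r w t}))"
    by (metis of_nat_le_iff of_nat_sum)
  then have "real (card U) * card W \<le> (\<Sum>w\<in>W. real (card {t \<in> U. r w t}) * card W)"
    by (simp add: mult_right_mono flip: sum_distrib_right)
  also have "\<dots> < (\<Sum>w\<in>W. real (card U))" using less W assms by (intro sum_strict_mono) auto
  finally show False by simp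
qed

text \<open>
  Sudakov minoration for Rademacher averages, by chaining over the level \<open>q\<close>: a ball at level
  \<open>q\<close> is covered by few balls of level \<open>2 q\<close>, and the numbers of balls multiply to
  \<open>exp (100 \<kappa> P)\<close> since the levels form a geometric progression.
\<close>

lemma rademacher_localization:
  fixes \<tau> :: "'t \<Rightarrow> 'i \<Rightarrow> real"
  assumes fin: "finite I" "finite T" and T: "T \<noteq> {}" and P: "P > 0"
    and \<kappa>: "0 < \<kappa>" and rad: "rad I T \<tau> \<le> \<kappa> / 64"
  obtains U t0 where "U \<subseteq> T" "t0 \<in> T" "card U \<ge> card T * exp (- 100 * \<kappa> * P)"
    "\<And>t. t \<in> U \<Longrightarrow> (\<Sum>i\<in>I. trunc_sq (P * (\<tau> t i - \<tau> t0 i))) \<le> \<kappa> * P"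
proof -
  define d where "d = (\<lambda>q s t. \<Sum>i\<in>I. trunc_sq (q * (\<tau> t i - \<tau> s i)))"
  define good where "good = (\<lambda>q. \<exists>U\<subseteq>T. \<exists>t0\<in>T. card U \<ge> card T * exp (- 100 * \<kappa> * q) \<and> (\<forall>t\<in>U. d q t0 t \<le> \<kappa> * q))"
  \<comment> \<open>At small q all of T is a single ball: the two-point bound makes the Euclidean
    distances at most \<kappa> / 2.\<close>
  have base: "good q" if q: "0 < q" "q \<le> 2 / \<kappa>" for q
  proof -
    obtain t0 where t0: "t0 \<in> T" using T by auto
    have "d q t0 t \<le> \<kappa> * q" if t: "t \<in> T" for t
    proof -
      define S where "S = (\<Sum>i\<in>I. (\<tau> t i - \<tau> t0 i)\<^sup>2)"
      have S0: "S \<ge> 0" by (simp add: S_def sum_nonneg)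
      have "5/18 * sqrt S \<le> \<kappa> / 64" unfolding S_def using rad_two_points[OF fin t0 t, of \<tau>] rad by linarith
      then have "sqrt S \<le> \<kappa> / 2" using \<kappa> by simp
      then have "(sqrt S)\<^sup>2 \<le> (\<kappa> / 2)\<^sup>2" using S0 by (intro power_mono) auto
      then have S1: "S \<le> \<kappa>\<^sup>2 / 4" using S0 by (simp add: power_divide)
      have "d q t0 t \<le> (\<Sum>i\<in>I. (q * (\<tau> t i - \<tau> t0 i))\<^sup>2)"
        unfolding d_def by (intro sum_mono trunc_sq_le)
      also have "\<dots> = q\<^sup>2 * S" by (simp add: S_def power_mult_distrib sum_distrib_left)
      also have "\<dots> \<le> q\<^sup>2 * (\<kappa>\<^sup>2 / 4)" using S1 by (intro mult_left_mono) auto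
      also have "\<dots> = (\<kappa> * q) * (\<kappa> * q / 4)" by (simp add: power2_eq_square)
      also have "\<dots> \<le> (\<kappa> * q) * 1" using q \<kappa> by (intro mult_left_mono) (auto simp: field_simps)
      finally show ?thesis by simp
    qed
    moreover have "card T * exp (- 100 * \<kappa> * q) \<le> card T" using q \<kappa> by (intro mult_left_le) auto
    ultimately show ?thesis unfolding good_def using t0 by auto
  qed
  have step: "good (2 * q)" if g: "good q" and q: "q \<ge> 1 / \<kappa>" for q
  proof -
    have q0: "q > 0" using q \<kappa> by (meson divide_pos_pos less_le_trans zero_less_one)
    obtain U t0 where U: "U \<subseteq> T" "t0 \<in> T" "card U \<ge> card T * exp (- 100 * \<kappa> * q)" "\<And>t. t \<in> U \<Longrightarrow> d q t0 t \<le> \<kappa> * q"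
      using g by (auto simp: good_def)
    have finU: "finite U" using U fin finite_subset by auto
    have "0 < card T * exp (- 100 * \<kappa> * q)" using T fin by (simp add: card_gt_0_iff)
    then have Une: "U \<noteq> {}" using U(3) by (metis card.empty not_less of_nat_0)
    define m where "m = \<kappa> * (2 * q)"
    have m: "m \<ge> 1/3" using q \<kappa> by (simp add: m_def field_simps)
    obtain W where W: "W \<subseteq> U" "\<And>s t. s \<in> W \<Longrightarrow> t \<in> W \<Longrightarrow> s \<noteq> t \<Longrightarrow> m < d (2 * q) s t"
      "\<And>t. t \<in> U \<Longrightarrow> \<exists>w\<in>W. t = w \<or> \<not> m < d (2 * q) w t \<or> \<not> m < d (2 * q) t w"
      using maximal_separated_subset[OF finU, of "\<lambda>s t. m < d (2 * q) s t"] by blast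
    have dsym: "d r s t = d r t s" for r s t
      unfolding d_def by (intro sum.cong refl) (metis minus_diff_eq mult_minus_right trunc_sq_minus)
    have d0: "d r s s = 0" for r s by (simp add: d_def trunc_sq_def)
    have cover: "\<exists>w\<in>W. d (2 * q) w t \<le> m" if "t \<in> U" for t
    proof -
      obtain w where w: "w \<in> W" "t = w \<or> \<not> m < d (2 * q) w t \<or> \<not> m < d (2 * q) t w"
        using W(3)[OF \<open>t \<in> U\<close>] by blast
      then have "d (2 * q) w t \<le> m" using d0[of "2 * q" w] m dsym[of "2 * q" t w] by auto
      then show ?thesis using w(1) by blast
    qed
    have finW: "finite W" using W(1) finU finite_subset by blast
    have Wne: "W \<noteq> {}" using Une cover by auto
    \<comment> \<open>A larger \<open>W\<close> would have average at least m / 32 after scaling by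
      2 q, whereas 2 q * \<kappa> / 64 = m / 64.\<close>
    have cW: "real (card W) \<le> exp (50 * m)"
    proof (rule ccontr)
      assume "\<not> ?thesis"
      then have "m / 32 \<le> rad I W (\<lambda>t i. (2 * q) * (\<tau> t i - \<tau> t0 i))"
      proof (intro rad_ge fin finW m)
        fix t assume "t \<in> W"
        then have "d q t0 t \<le> \<kappa> * q" using W U by auto
        have "(\<Sum>i\<in>I. trunc_sq (2 * q * (\<tau> t i - \<tau> t0 i))) \<le> (\<Sum>i\<in>I. 4 * trunc_sq (q * (\<tau> t i - \<tau> t0 i)))"
          using trunc_sq_double by (intro sum_mono) (metis mult.assoc)
        also have "\<dots> = 4 * d q t0 t" by (simp add: d_def sum_distrib_left)
        finally show "(\<Sum>i\<in>I. trunc_sq (2 * q * (\<tau> t i - \<tau> t0 i))) \<le> 2 * m"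
          using \<open>d q t0 t \<le> \<kappa> * q\<close> by (simp add: m_def)
      next
        fix s t assume st: "s \<in> W" "t \<in> W" "s \<noteq> t"
        have "d (2 * q) s t = (\<Sum>i\<in>I. trunc_sq (2 * q * (\<tau> t i - \<tau> t0 i) - 2 * q * (\<tau> s i - \<tau> t0 i)))"
          by (simp add: d_def algebra_simps)
        then show "m \<le> (\<Sum>i\<in>I. trunc_sq (2 * q * (\<tau> t i - \<tau> t0 i) - 2 * q * (\<tau> s i - \<tau> t0 i)))"
          using W(2)[OF st] by simp
      qed auto
      also have "\<dots> = 2 * q * rad I W \<tau>" using fin finW Wne q0 by (intro rad_affine) auto
      also have "\<dots> \<le> 2 * q * rad I T \<tau>" using fin W U Wne q0 by (intro mult_left_mono rad_mono_set) auto
      also have "\<dots> \<le> 2 * q * (\<kappa> / 64)" using rad q0 by (intro mult_left_mono) auto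
      finally show False using m by (simp add: m_def)
    qed
    obtain w where w: "w \<in> W" "real (card {t \<in> U. d (2 * q) w t \<le> m}) * card W \<ge> card U"
      by (rule exists_large_fiber[OF finU finW Une, where r = "\<lambda>w t. d (2 * q) w t \<le> m"])
        (use cover in auto)
    \<comment> \<open>The loss exp (50 m) = exp (100 \<kappa> q) is exactly the growth of the
      exponent from level q to level 2 q.\<close>
    have "card T * exp (- 100 * \<kappa> * q) \<le> real (card {t \<in> U. d (2 * q) w t \<le> m}) * exp (50 * m)"
      using U(3) w(2) mult_left_mono[OF cW, of "real (card {t \<in> U. d (2 * q) w t \<le> m})"] by linarith
    then have "card T * exp (- 100 * \<kappa> * q) * exp (- 50 * m) \<le> real (card {t \<in> U. d (2 * q) w t \<le> m}) * exp (50 * m) * exp (- 50 * m)"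
      by (intro mult_right_mono) auto
    then have "card T * exp (- 100 * \<kappa> * (2 * q)) \<le> real (card {t \<in> U. d (2 * q) w t \<le> m})"
      by (simp add: m_def mult.assoc flip: exp_add)
    then show ?thesis unfolding good_def
      using U(1,2) W(1) w(1) by (intro exI[of _ "{t \<in> U. d (2 * q) w t \<le> m}"] conjI bexI[of _ w]) (auto simp: m_def)
  qed
  have "good P"
  proof (cases "P \<le> 2 / \<kappa>")
    case True then show ?thesis using base P by simp
  next
    case False
    have all: "0 < q \<Longrightarrow> q \<le> 2 ^ Suc j / \<kappa> \<Longrightarrow> good q" for j q
    proof (induct j arbitrary: q)
      case 0 then show ?case using base by simp
    next
      case (Suc j)
      show ?case
      proof (cases "q \<le> 2 / \<kappa>")
        case True then show ?thesis using base Suc by simp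
      next
        case False
        have "good (q / 2)" using Suc by (intro Suc(1)) (auto simp: field_simps)
        then have "good (2 * (q / 2))" using False by (intro step) auto
        then show ?thesis by simp
      qed
    qed
    obtain j where "P * \<kappa> < 2 ^ j" using real_arch_pow[of 2 "P * \<kappa>"] by auto
    then have "P * \<kappa> \<le> 2 ^ Suc j" using zero_less_power[of "2::real" j] unfolding power_Suc by linarith
    then have "P \<le> 2 ^ Suc j / \<kappa>" using \<kappa> by (simp add: pos_le_divide_eq)
    then show ?thesis using all P by blast
  qed
  then show ?thesis unfolding good_def d_def using that by blast
qed

section \<open>Minimax and sequential coding\<close>

text \<open>
  The weights are read off an almost-minimizer \<open>R\<close> of \<open>\<Sum>z\<in>Z. (max 0 (f z R - v'))\<^sup>2\<close>, so that no
  compactness of \<open>C\<close> is needed.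
\<close>

lemma finite_minimax:
  fixes f :: "'z \<Rightarrow> ('c \<Rightarrow> real) \<Rightarrow> real" and C :: "('c \<Rightarrow> real) set"
  assumes Z: "finite Z" "Z \<noteq> {}"
    and conv: "\<And>R R' u. R \<in> C \<Longrightarrow> R' \<in> C \<Longrightarrow> 0 \<le> u \<Longrightarrow> u \<le> 1 \<Longrightarrow> (\<lambda>x. (1 - u) * R x + u * R' x) \<in> C"
    and aff: "\<And>z R R' u. z \<in> Z \<Longrightarrow> R \<in> C \<Longrightarrow> R' \<in> C \<Longrightarrow>
        f z (\<lambda>x. (1 - u) * R x + u * R' x) = (1 - u) * f z R + u * f z R'"
    and bnd: "\<And>z R. z \<in> Z \<Longrightarrow> R \<in> C \<Longrightarrow> \<bar>f z R\<bar> \<le> K"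
    and val: "\<And>R. R \<in> C \<Longrightarrow> \<exists>z\<in>Z. f z R \<ge> v"
    and v': "v' < v"
  obtains l where "\<And>z. z \<in> Z \<Longrightarrow> 0 \<le> l z" "sum l Z = 1" "\<And>R. R \<in> C \<Longrightarrow> (\<Sum>z\<in>Z. l z * f z R) \<ge> v'"
proof (cases "C = {}")
  case True
  obtain z0 where "z0 \<in> Z" using Z by auto
  then have "sum (\<lambda>z. if z = z0 then 1 else 0::real) Z = 1" using Z by simp
  then show ?thesis using that[of "\<lambda>z. if z = z0 then 1 else 0"] True by auto
next
  case False
  define p where "p = (\<lambda>z R. max 0 (f z R - v'))"
  define \<Phi> where "\<Phi> = (\<lambda>R. \<Sum>z\<in>Z. (p z R)\<^sup>2)"
  define m where "m = Inf (\<Phi> ` C)"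
  define K' where "K' = (\<Sum>z\<in>Z. (2 * K)\<^sup>2) + 1"
  have K'1: "K' \<ge> 1" by (simp add: K'_def sum_nonneg)
  have bdd: "bdd_below (\<Phi> ` C)" by (rule bdd_belowI[of _ 0]) (auto simp: \<Phi>_def sum_nonneg)
  have lower: "(v - v')\<^sup>2 \<le> \<Phi> R" if R: "R \<in> C" for R
  proof -
    obtain z where z: "z \<in> Z" "f z R \<ge> v" using val[OF R] by auto
    then have "(v - v')\<^sup>2 \<le> (p z R)\<^sup>2" using v' by (intro power_mono) (auto simp: p_def)
    also have "\<dots> \<le> \<Phi> R" unfolding \<Phi>_def using Z z by (intro member_le_sum) auto
    finally show ?thesis .
  qed
  have m0: "m > 0"
  proof -
    have "0 < (v - v')\<^sup>2" using v' by simp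
    also have "\<dots> \<le> m" unfolding m_def using False lower by (intro cInf_greatest) auto
    finally show ?thesis .
  qed
  \<comment> \<open>The step length from R0 towards R. It is chosen so that the quadratic term stays
    below u m, and R0 is then taken within u m / 2 of the infimum.\<close>
  define u where "u = min 1 (m / K')"
  have u: "0 < u" "u \<le> 1" "u * K' \<le> m" using m0 K'1 by (auto simp: u_def min_def field_simps)
  have "m < m + u * m / 2" using u m0 by simp
  then obtain R0 where R0: "R0 \<in> C" "\<Phi> R0 < m + u * m / 2"
    using False bdd cInf_less_iff[of "\<Phi> ` C" "m + u * m / 2"] by (auto simp: m_def[symmetric])
  \<comment> \<open>First order condition at R0: if the weights \<open>p z R0\<close> gave R a value
    of at most v', a step of length u towards R would push \<Phi> below its infimum.\<close>
  have key: "(\<Sum>z\<in>Z. p z R0 * (f z R - v')) > 0" if R: "R \<in> C" for R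
  proof -
    define R1 where "R1 = (\<lambda>x. (1 - u) * R0 x + u * R x)"
    have "R1 \<in> C" using conv[OF R0(1) R, of u] u by (simp add: R1_def)
    then have "m \<le> \<Phi> R1" unfolding m_def using bdd by (intro cInf_lower) auto
    also have "\<dots> \<le> (\<Sum>z\<in>Z. (p z R0)\<^sup>2 + 2 * u * (p z R0 * (f z R - f z R0)) + u\<^sup>2 * (2 * K)\<^sup>2)"
      unfolding \<Phi>_def
    proof (intro sum_mono)
      fix z assume z: "z \<in> Z"
      define b where "b = f z R - f z R0"
      have b: "\<bar>b\<bar> \<le> 2 * K" using bnd[OF z R] bnd[OF z R0(1)] by (auto simp: b_def)
      then have b2: "b\<^sup>2 \<le> (2 * K)\<^sup>2" by (metis abs_ge_zero power2_abs power_mono)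
      have "f z R1 = f z R0 + u * b" using aff[OF z R0(1) R, of u] by (simp add: R1_def b_def algebra_simps)
      then have "p z R1 = max 0 ((f z R0 - v') + u * b)" by (simp add: p_def algebra_simps)
      then have "p z R1 \<le> \<bar>p z R0 + u * b\<bar>" "0 \<le> p z R1" by (auto simp: p_def)
      then have "(p z R1)\<^sup>2 \<le> (p z R0 + u * b)\<^sup>2" by (metis power2_abs power_mono)
      also have "\<dots> = (p z R0)\<^sup>2 + 2 * u * (p z R0 * b) + u\<^sup>2 * b\<^sup>2"
        by (simp add: power2_eq_square algebra_simps)
      also have "\<dots> \<le> (p z R0)\<^sup>2 + 2 * u * (p z R0 * b) + u\<^sup>2 * (2 * K)\<^sup>2"
        using b2 by (intro add_left_mono mult_left_mono) auto
      finally show "(p z R1)\<^sup>2 \<le> (p z R0)\<^sup>2 + 2 * u * (p z R0 * (f z R - f z R0)) + u\<^sup>2 * (2 * K)\<^sup>2"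
        by (simp add: b_def)
    qed
    also have "\<dots> = \<Phi> R0 + 2 * u * (\<Sum>z\<in>Z. p z R0 * (f z R - f z R0)) + u\<^sup>2 * (K' - 1)"
      by (simp add: \<Phi>_def K'_def sum.distrib sum_distrib_left)
    also have "u\<^sup>2 * (K' - 1) \<le> u * m"
    proof -
      have "u * (u * (K' - 1)) \<le> u * m" using u by (intro mult_left_mono) (auto simp: algebra_simps)
      then show ?thesis by (simp add: power2_eq_square algebra_simps)
    qed
    finally have "m < m + u * m / 2 + 2 * u * (\<Sum>z\<in>Z. p z R0 * (f z R - f z R0)) + u * m"
      using R0(2) by linarith
    then have "0 < u * (2 * (\<Sum>z\<in>Z. p z R0 * (f z R - f z R0)) + 3/2 * m)"
      by (simp add: algebra_simps)
    then have A: "(\<Sum>z\<in>Z. p z R0 * (f z R - f z R0)) > - (3/4 * m)"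
      using u by (simp add: zero_less_mult_iff)
    have "p z R0 * (f z R0 - v') = (p z R0)\<^sup>2" for z by (auto simp: p_def power2_eq_square max_def)
    then have "(\<Sum>z\<in>Z. p z R0 * (f z R - v')) = (\<Sum>z\<in>Z. p z R0 * (f z R - f z R0) + (p z R0)\<^sup>2)"
      by (intro sum.cong) (auto simp: algebra_simps)
    also have "\<dots> = (\<Sum>z\<in>Z. p z R0 * (f z R - f z R0)) + \<Phi> R0"
      by (simp add: sum.distrib \<Phi>_def)
    finally have "(\<Sum>z\<in>Z. p z R0 * (f z R - v')) = (\<Sum>z\<in>Z. p z R0 * (f z R - f z R0)) + \<Phi> R0" .
    moreover have "\<Phi> R0 \<ge> m" unfolding m_def using bdd R0 by (intro cInf_lower) auto
    ultimately show ?thesis using A m0 by linarith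
  qed
  define s where "s = (\<Sum>z\<in>Z. p z R0)"
  have s0: "s > 0"
  proof (rule ccontr)
    assume "\<not> s > 0"
    moreover have "s \<ge> 0" by (auto simp: s_def p_def intro!: sum_nonneg)
    ultimately have "s = 0" by simp
    then have "\<forall>z\<in>Z. p z R0 = 0" unfolding s_def using Z by (subst (asm) sum_nonneg_eq_0_iff) (auto simp: p_def)
    then show False using key[OF R0(1)] by simp
  qed
  show ?thesis
  proof (rule that[of "\<lambda>z. p z R0 / s"])
    show "0 \<le> p z R0 / s" for z using s0 by (simp add: p_def)
    show "(\<Sum>z\<in>Z. p z R0 / s) = 1" using s0 by (simp add: s_def flip: sum_divide_distrib)
    show "v' \<le> (\<Sum>z\<in>Z. p z R0 / s * f z R)" if "R \<in> C" for R
    proof -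
      have "(\<Sum>z\<in>Z. p z R0 * (f z R - v')) = (\<Sum>z\<in>Z. p z R0 * f z R) - v' * s"
        by (simp add: s_def algebra_simps sum_subtractf sum_distrib_left)
      then have "v' * s \<le> (\<Sum>z\<in>Z. p z R0 * f z R)" using key[OF that] by simp
      then have "v' \<le> (\<Sum>z\<in>Z. p z R0 * f z R) / s" using s0 by (simp add: field_simps)
      then show ?thesis by (simp add: sum_divide_distrib)
    qed
  qed
qed

text \<open>
  If \<open>A\<close> is uniform on \<open>F\<close> and revealed one coordinate at a time, \<open>l A i\<close> is the surprise
  \<open>ln (1/p\<^sub>i)\<close> of finding \<open>i \<in> A\<close> and \<open>z A\<close> the total surprise of the coordinates outside \<open>A\<close>.
  The last inequality says that, with \<open>B\<close> as side information, \<open>A\<close> is encoded by one bit for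
  each element of \<open>B\<close>, the surprises on \<open>A - B\<close>, and \<open>z A\<close>.
\<close>

lemma sequential_code:
  assumes "finite G" "F \<subseteq> Pow G"
  obtains l :: "'i set \<Rightarrow> 'i \<Rightarrow> real" and z :: "'i set \<Rightarrow> real"
  where "\<And>A i. l A i \<ge> 0" "\<And>A. z A \<ge> 0"
    "\<And>A. A \<in> F \<Longrightarrow> (\<Sum>i\<in>A. l A i) \<le> ln (card F)"
    "(\<Sum>A\<in>F. z A) \<le> (\<Sum>A\<in>F. real (card A))"
    "\<And>B. finite B \<Longrightarrow> (\<Sum>A\<in>F. exp (- (\<Sum>i\<in>A - B. l A i) - z A)) \<le> 2 ^ card B"
proof -
  have "\<exists>(l :: 'i set \<Rightarrow> 'i \<Rightarrow> real) (z :: 'i set \<Rightarrow> real). (\<forall>A i. l A i \<ge> 0) \<and> (\<forall>A. z A \<ge> 0) \<and>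
    (\<forall>A\<in>F. (\<Sum>i\<in>A. l A i) \<le> ln (card F)) \<and>
    (\<Sum>A\<in>F. z A) \<le> (\<Sum>A\<in>F. real (card A)) \<and>
    (\<forall>B. finite B \<longrightarrow> (\<Sum>A\<in>F. exp (- (\<Sum>i\<in>A - B. l A i) - z A)) \<le> 2 ^ card B)"
    using assms
  proof (induct arbitrary: F)
    case empty
    then have "F = {} \<or> F = {{}}" by auto
    then show ?case by (intro exI[of _ "\<lambda>_ _. 0"] exI[of _ "\<lambda>_. 0"]) auto
  next
    case (insert x G)
    \<comment> \<open>The coordinate x is revealed before those in G; \<open>F0\<close> and
      \<open>F1\<close> are the two branches, and \<open>c0\<close>, \<open>c1\<close> are the
      surprises of entering them.\<close>
    define F0 where "F0 = {A \<in> F. x \<notin> A}"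
    define F1 where "F1 = {A. x \<notin> A \<and> insert x A \<in> F}"
    have finF: "finite F" using insert by (meson finite_Pow_iff finite_insert finite_subset)
    have F01: "F0 \<subseteq> Pow G" "F1 \<subseteq> Pow G" using insert by (auto simp: F0_def F1_def)
    have fin: "finite F0" "finite F1" using F01 insert(1) by (auto intro: finite_subset)
    have finA: "finite A" if "A \<in> Pow G" for A using that insert(1) by (auto intro: finite_subset)
    have "A \<in> insert x ` F1" if "A \<in> F" "x \<in> A" for A
      using that by (intro image_eqI[of _ _ "A - {x}"]) (auto simp: F1_def insert_absorb)
    then have Feq: "F = F0 \<union> insert x ` F1" by (auto simp: F0_def F1_def)
    have disj: "F0 \<inter> insert x ` F1 = {}" by (auto simp: F0_def)
    have inj: "inj_on (insert x) F1"
      by (rule inj_onI) (metis (no_types, lifting) F1_def Diff_insert_absorb mem_Collect_eq)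
    have split: "sum g F = sum g F0 + (\<Sum>A\<in>F1. g (insert x A))" for g :: "'i set \<Rightarrow> real"
      unfolding Feq using fin disj inj by (simp add: sum.union_disjoint sum.reindex)
    obtain l0 z0 where 0: "\<forall>A i. l0 A i \<ge> (0::real)" "\<forall>A. z0 A \<ge> (0::real)"
      "\<forall>A\<in>F0. (\<Sum>i\<in>A. l0 A i) \<le> ln (card F0)" "(\<Sum>A\<in>F0. z0 A) \<le> (\<Sum>A\<in>F0. real (card A))"
      "\<forall>B. finite B \<longrightarrow> (\<Sum>A\<in>F0. exp (- (\<Sum>i\<in>A - B. l0 A i) - z0 A)) \<le> 2 ^ card B"
      using insert(3)[OF F01(1)] by blast
    obtain l1 z1 where 1: "\<forall>A i. l1 A i \<ge> (0::real)" "\<forall>A. z1 A \<ge> (0::real)"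
      "\<forall>A\<in>F1. (\<Sum>i\<in>A. l1 A i) \<le> ln (card F1)" "(\<Sum>A\<in>F1. z1 A) \<le> (\<Sum>A\<in>F1. real (card A))"
      "\<forall>B. finite B \<longrightarrow> (\<Sum>A\<in>F1. exp (- (\<Sum>i\<in>A - B. l1 A i) - z1 A)) \<le> 2 ^ card B"
      using insert(3)[OF F01(2)] by blast
    define n where "n = real (card F)"
    define n0 where "n0 = real (card F0)"
    define n1 where "n1 = real (card F1)"
    have n: "n = n0 + n1" using split[of "\<lambda>_. 1"] by (simp add: n_def n0_def n1_def)
    have nn: "n0 \<ge> 0" "n1 \<ge> 0" by (auto simp: n0_def n1_def)
    \<comment> \<open>The default 0 for an empty branch keeps the surprises nonnegative.\<close>
    define c0 where "c0 = (if n0 > 0 then ln (n / n0) else 0)"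
    define c1 where "c1 = (if n1 > 0 then ln (n / n1) else 0)"
    have c: "c0 \<ge> 0" "c1 \<ge> 0" using n nn by (auto simp: c0_def c1_def)
    define l where "l = (\<lambda>A i. if x \<in> A then (if i = x then c1 else l1 (A - {x}) i) else l0 A i)"
    define z where "z = (\<lambda>A. if x \<in> A then z1 (A - {x}) else z0 A + c0)"
    have l_ins: "(\<Sum>i\<in>D. l (insert x A) i) = (\<Sum>i\<in>D. l1 A i)" if "x \<notin> A" "x \<notin> D" for A D
      using that by (intro sum.cong) (auto simp: l_def)
    have l_0: "l A = l0 A" if "x \<notin> A" for A using that by (auto simp: l_def)
    have pos0: "n0 > 0" if "A \<in> F0" for A using that fin by (auto simp: n0_def card_gt_0_iff)
    have pos1: "n1 > 0" if "A \<in> F1" for A using that fin by (auto simp: n1_def card_gt_0_iff)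
    show ?case
    proof (intro exI[of _ l] exI[of _ z] conjI allI ballI impI)
      show "0 \<le> l A i" "0 \<le> z A" for A i using 0 1 c by (auto simp: l_def z_def)
    next
      fix A assume A: "A \<in> F"
      show "(\<Sum>i\<in>A. l A i) \<le> ln (card F)"
      proof (cases "x \<in> A")
        case False
        then have A0: "A \<in> F0" using A by (simp add: F0_def)
        have "(\<Sum>i\<in>A. l A i) \<le> ln n0" using 0(3) A0 False by (simp add: l_0 n0_def)
        also have "\<dots> \<le> ln n" using pos0[OF A0] n nn by simp
        finally show ?thesis by (simp add: n_def)
      next
        case True
        define A' where "A' = A - {x}"
        have A': "A = insert x A'" "x \<notin> A'" "A' \<in> F1" using True A by (auto simp: A'_def F1_def insert_absorb)
        have "(\<Sum>i\<in>A. l A i) = c1 + (\<Sum>i\<in>A'. l1 A' i)"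
        proof -
          have "finite A'" using A'(3) F01 finA by auto
          then have "(\<Sum>i\<in>A. l A i) = l A x + (\<Sum>i\<in>A'. l A i)" using A' by simp
          moreover have "l A x = c1" using A' by (simp add: l_def)
          moreover have "(\<Sum>i\<in>A'. l A i) = (\<Sum>i\<in>A'. l1 A' i)" using A' l_ins by blast
          ultimately show ?thesis by simp
        qed
        also have "\<dots> \<le> c1 + ln n1" using 1(3) A' by (simp add: n1_def)
        also have "\<dots> = ln n" using pos1[OF A'(3)] n nn by (simp add: c1_def ln_div)
        finally show ?thesis by (simp add: n_def)
      qed
    next
      have "(\<Sum>A\<in>F. z A) = (\<Sum>A\<in>F0. z0 A + c0) + (\<Sum>A\<in>F1. z1 A)"
        unfolding split by (intro arg_cong2[of _ _ _ _ "(+)"] sum.cong) (auto simp: z_def F0_def F1_def)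
      also have "\<dots> = (\<Sum>A\<in>F0. z0 A) + n0 * c0 + (\<Sum>A\<in>F1. z1 A)"
        by (simp add: sum.distrib n0_def)
      \<comment> \<open>Since ln (n / n0) \<le> n / n0 - 1 = n1 / n0, the absence of x, summed over
        \<open>F0\<close>, costs at most one unit for each set that contains x. This is why the
        cardinalities control z.\<close>
      also have "n0 * c0 \<le> n1"
      proof (cases "n0 > 0")
        case True
        then have "c0 \<le> n / n0 - 1" using n nn by (simp add: c0_def ln_le_minus_one)
        then have "n0 * c0 \<le> n0 * (n / n0 - 1)" using True by (intro mult_left_mono) auto
        also have "\<dots> = n1" using True n by (simp add: field_simps)
        finally show ?thesis .
      qed (use nn in \<open>simp add: c0_def\<close>)
      also have "(\<Sum>A\<in>F0. z0 A) + n1 + (\<Sum>A\<in>F1. z1 A) \<le> (\<Sum>A\<in>F0. real (card A)) + n1 + (\<Sum>A\<in>F1. real (card A))"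
        using 0 1 by simp
      also have "\<dots> = (\<Sum>A\<in>F0. real (card A)) + (\<Sum>A\<in>F1. 1 + real (card A))"
        by (simp add: sum.distrib n1_def)
      also have "(\<Sum>A\<in>F1. 1 + real (card A)) = (\<Sum>A\<in>F1. real (card (insert x A)))"
        using finA F01 by (intro sum.cong) (auto simp: F1_def)
      finally show "(\<Sum>A\<in>F. z A) \<le> (\<Sum>A\<in>F. real (card A))" unfolding split by simp
    next
      fix B :: "'i set" assume B: "finite B"
      define B' where "B' = B - {x}"
      have B': "finite B'" using B by (simp add: B'_def)
      define q0 where "q0 = exp (- c0)"
      have q0: "q0 \<le> 1" "0 \<le> q0" using c by (auto simp: q0_def)
      define e0 where "e0 = (\<Sum>A\<in>F0. exp (- (\<Sum>i\<in>A - B'. l0 A i) - z0 A))"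
      define e1 where "e1 = (\<Sum>A\<in>F1. exp (- (\<Sum>i\<in>A - B'. l1 A i) - z1 A))"
      have e: "e0 \<le> 2 ^ card B'" "e1 \<le> 2 ^ card B'" using 0(5) 1(5) B' by (auto simp: e0_def e1_def)
      have e_0: "e0 = 0" if "\<not> n0 > 0" using that fin by (auto simp: n0_def e0_def)
      have e_1: "e1 = 0" if "\<not> n1 > 0" using that fin by (auto simp: n1_def e1_def)
      have E0: "(\<Sum>A\<in>F0. exp (- (\<Sum>i\<in>A - B. l A i) - z A)) = q0 * e0"
        unfolding e0_def sum_distrib_left q0_def exp_add[symmetric]
      proof (intro sum.cong refl)
        fix A assume "A \<in> F0"
        then have x: "x \<notin> A" by (simp add: F0_def)
        then have "A - B = A - B'" by (auto simp: B'_def)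
        then show "exp (- (\<Sum>i\<in>A - B. l A i) - z A) = exp (- c0 + (- (\<Sum>i\<in>A - B'. l0 A i) - z0 A))"
          using x by (simp add: l_0 z_def algebra_simps)
      qed
      have E1: "(\<Sum>A\<in>F1. exp (- (\<Sum>i\<in>insert x A - B. l (insert x A) i) - z (insert x A)))
          = (if x \<in> B then 1 else exp (- c1)) * e1"
        unfolding e1_def sum_distrib_left
      proof (intro sum.cong refl)
        fix A assume A: "A \<in> F1"
        then have x: "x \<notin> A" by (simp add: F1_def)
        have fA: "finite A" using A F01 finA by auto
        have z: "z (insert x A) = z1 A" using x by (simp add: z_def)
        show "exp (- (\<Sum>i\<in>insert x A - B. l (insert x A) i) - z (insert x A))
          = (if x \<in> B then 1 else exp (- c1)) * exp (- (\<Sum>i\<in>A - B'. l1 A i) - z1 A)"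
        proof (cases "x \<in> B")
          case True
          then have "insert x A - B = A - B'" using x by (auto simp: B'_def)
          then show ?thesis using True x by (simp add: z l_ins)
        next
          case False
          then have "insert x A - B = insert x (A - B')" "x \<notin> A - B'" using x by (auto simp: B'_def)
          moreover have "l (insert x A) x = c1" by (simp add: l_def)
          ultimately show ?thesis using False x fA by (simp add: z l_ins flip: exp_add)
        qed
      qed
      have "(\<Sum>A\<in>F. exp (- (\<Sum>i\<in>A - B. l A i) - z A)) = q0 * e0 + (if x \<in> B then 1 else exp (- c1)) * e1"
        unfolding split E0 E1 ..
      \<comment> \<open>If x is in B, presence is free and absence has a factor at most 1, so one
        bit is lost; otherwise the factors exp (- c0) = n0 / n and exp (- c1) = n1 / n add up to
        1.\<close>
      also have "\<dots> \<le> 2 ^ card B"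
      proof (cases "x \<in> B")
        case True
        then have "card B = Suc (card B')" unfolding B'_def using B by (intro card.remove) auto
        moreover have "q0 * e0 \<le> 1 * 2 ^ card B'" using q0 e by (intro mult_mono) (auto simp: e0_def sum_nonneg)
        ultimately show ?thesis using True e by simp
      next
        case False
        then have BB: "B' = B" by (simp add: B'_def)
        have "n * (q0 * e0) \<le> n0 * 2 ^ card B"
        proof (cases "n0 > 0")
          case True
          then have "n * q0 = n0" using n nn by (simp add: q0_def c0_def exp_minus)
          then have "n * (q0 * e0) = n0 * e0" by (metis mult.assoc)
          moreover have "n0 * e0 \<le> n0 * 2 ^ card B" using e nn BB by (intro mult_left_mono) auto
          ultimately show ?thesis by linarith
        qed (use e_0 nn in simp)
        moreover have "n * (exp (- c1) * e1) \<le> n1 * 2 ^ card B"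
        proof (cases "n1 > 0")
          case True
          then have "n * exp (- c1) = n1" using n nn by (simp add: c1_def exp_minus)
          then have "n * (exp (- c1) * e1) = n1 * e1" by (metis mult.assoc)
          moreover have "n1 * e1 \<le> n1 * 2 ^ card B" using e nn BB by (intro mult_left_mono) auto
          ultimately show ?thesis by linarith
        qed (use e_1 nn in simp)
        ultimately have *: "n * (q0 * e0 + exp (- c1) * e1) \<le> n * 2 ^ card B"
          using n by (simp add: algebra_simps)
        show ?thesis
        proof (cases "n > 0")
          case True then show ?thesis using * False by simp
        next
          case False2: False
          then have "e0 = 0" "e1 = 0" using e_0 e_1 n nn by auto
          then show ?thesis by simp
        qed
      qed
      finally show "(\<Sum>A\<in>F. exp (- (\<Sum>i\<in>A - B. l A i) - z A)) \<le> 2 ^ card B" .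
    qed
  qed
  then show ?thesis 
    apply (elim exE conjE)
    subgoal for l z by (rule that[of l z]) auto
    done
qed

section \<open>Unconditional log-concave laws\<close>

locale uncond_lc_law = 
  fixes d :: nat and \<mu> :: "(nat \<Rightarrow> real) measure"
  assumes law: "law_on_Rd d \<mu>" and unc: "unconditional_law d \<mu>" and lc: "log_concave_law d \<mu>"
begin

sublocale prob_space \<mu>
  using law by (simp add: law_on_Rd_def)

lemma sets_law [measurable_cong]: "sets \<mu> = sets (Rd_borel d)"
  using law by (simp add: law_on_Rd_def)

lemma space_law: "space \<mu> = Rd_space d"
  using sets_eq_imp_space_eq[OF sets_law] by (simp add: space_PiM)

lemma measurable_coord [measurable]: "i < d \<Longrightarrow> (\<lambda>x. x i) \<in> borel_measurable \<mu>"
  unfolding measurable_cong_sets[OF sets_law refl] by measurable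

lemma measurable_linear [measurable]:
  "J \<subseteq> {..<d} \<Longrightarrow> (\<lambda>x. \<Sum>i\<in>J. a i * x i) \<in> borel_measurable \<mu>"
  by (intro borel_measurable_sum borel_measurable_times borel_measurable_const measurable_coord) auto

definition flip :: "(nat \<Rightarrow> real) \<Rightarrow> (nat \<Rightarrow> real) \<Rightarrow> nat \<Rightarrow> real" where
  "flip \<sigma> x = (\<lambda>i\<in>{..<d}. \<sigma> i * x i)"

lemma flip_apply: "i < d \<Longrightarrow> flip \<sigma> x i = \<sigma> i * x i"
  by (simp add: flip_def)

lemma measurable_flip: "flip \<sigma> \<in> measurable \<mu> (Rd_borel d)"
  unfolding flip_def by (rule measurable_restrict) simp

lemma distr_flip:
  assumes "\<And>i. i < d \<Longrightarrow> \<sigma> i \<in> {-1, 1}"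
  shows "distr \<mu> (Rd_borel d) (flip \<sigma>) = \<mu>"
proof -
  define S where "S = {i. i < d \<and> \<sigma> i = -1}"
  have "flip \<sigma> = (\<lambda>x. \<lambda>i\<in>{..<d}. if i \<in> S then - x i else x i)"
    using assms by (force simp: flip_def S_def fun_eq_iff)
  moreover have "S \<subseteq> {..<d}" by (auto simp: S_def)
  ultimately show ?thesis using unc by (simp add: unconditional_law_def)
qed

lemma borel_measurable_law_iff: "f \<in> borel_measurable (Rd_borel d) \<longleftrightarrow> f \<in> borel_measurable \<mu>"
  by (simp add: measurable_cong_sets[OF sets_law refl])

lemma integral_flip:
  fixes h :: "_ \<Rightarrow> real"
  assumes "\<And>i. i < d \<Longrightarrow> \<sigma> i \<in> {-1, 1}" "h \<in> borel_measurable \<mu>"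
  shows "(\<integral>x. h (flip \<sigma> x) \<partial>\<mu>) = (\<integral>x. h x \<partial>\<mu>)"
  using integral_distr[OF measurable_flip, of h \<sigma>] assms
  by (simp add: distr_flip borel_measurable_law_iff)

lemma integrable_flip:
  fixes h :: "_ \<Rightarrow> real"
  assumes "\<And>i. i < d \<Longrightarrow> \<sigma> i \<in> {-1, 1}" "h \<in> borel_measurable \<mu>"
  shows "integrable \<mu> (\<lambda>x. h (flip \<sigma> x)) \<longleftrightarrow> integrable \<mu> h"
  using integrable_distr_eq[OF measurable_flip, of h \<sigma>] assms
  by (simp add: distr_flip borel_measurable_law_iff)

lemma prob_flip:
  assumes "\<And>i. i < d \<Longrightarrow> \<sigma> i \<in> {-1, 1}" "A \<in> sets \<mu>"
  shows "prob {x \<in> space \<mu>. flip \<sigma> x \<in> A} = prob A"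
proof -
  have "prob A = measure (distr \<mu> (Rd_borel d) (flip \<sigma>)) A" using assms by (simp add: distr_flip)
  also have "\<dots> = prob (flip \<sigma> -` A \<inter> space \<mu>)"
    using assms sets_law by (intro measure_distr measurable_flip) auto
  finally show ?thesis by (simp add: vimage_def Int_def conj_commute)
qed

section \<open>Log-concavity on intersections of half-spaces\<close>

lemma closedin_halfspace:
  "closedin (Rd_topology d) {x \<in> topspace (Rd_topology d). s \<le> Rd_inner d u x}"
proof -
  have "continuous_map (Rd_topology d) euclideanreal (Rd_inner d u)"
    unfolding Rd_inner_def
    by (intro continuous_map_sum continuous_map_real_mult) (auto intro: continuous_map_product_projection)
  from closedin_continuous_map_preimage[OF this, of "{s..}"] show ?thesis by simp
qed

lemma closedin_halfspaces:
  assumes "finite J"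
  shows "closedin (Rd_topology d) {x \<in> topspace (Rd_topology d). \<forall>j\<in>J. s j \<le> Rd_inner d (u j) x}"
  using assms
proof induct
  case (insert j J)
  have "{x \<in> topspace (Rd_topology d). \<forall>j\<in>insert j J. s j \<le> Rd_inner d (u j) x}
    = {x \<in> topspace (Rd_topology d). s j \<le> Rd_inner d (u j) x} \<inter> {x \<in> topspace (Rd_topology d). \<forall>j\<in>J. s j \<le> Rd_inner d (u j) x}"
    by auto
  then show ?case using closedin_Int[OF closedin_halfspace insert(3)] by simp
qed (use closedin_topspace[of "Rd_topology d"] in simp)

text \<open>A compact exhaustion, because log-concavity is assumed for compact sets only.\<close>

definition cube :: "nat \<Rightarrow> (nat \<Rightarrow> real) set" where
  "cube n = {..<d} \<rightarrow>\<^sub>E {- real n..real n}"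

text \<open>One family for two uses: a single half-space for the tails of a linear functional, and
  the orthants of forced coordinates.\<close>

definition halfspaces :: "'j set \<Rightarrow> ('j \<Rightarrow> nat \<Rightarrow> real) \<Rightarrow> ('j \<Rightarrow> real) \<Rightarrow> (nat \<Rightarrow> real) set" where
  "halfspaces J u s = {x \<in> space \<mu>. \<forall>j\<in>J. s j \<le> Rd_inner d (u j) x}"

lemma measurable_inner [measurable]: "Rd_inner d u \<in> borel_measurable \<mu>"
  unfolding Rd_inner_def by (rule measurable_linear) simp

lemma sets_halfspaces: "finite J \<Longrightarrow> halfspaces J u s \<in> sets \<mu>"
  unfolding halfspaces_def by measurable

lemma sets_cube: "cube n \<in> sets \<mu>"
  unfolding cube_def sets_law by (intro sets_PiM_I_finite) auto

lemma compactin_halfspaces_cube: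
  assumes "finite J"
  shows "compactin (Rd_topology d) (halfspaces J u s \<inter> cube n)"
proof -
  have "halfspaces J u s = {x \<in> topspace (Rd_topology d). \<forall>j\<in>J. s j \<le> Rd_inner d (u j) x}"
    by (auto simp: halfspaces_def space_law)
  moreover have "compactin (Rd_topology d) (cube n)"
    unfolding cube_def by (auto simp: compactin_PiE)
  ultimately show ?thesis using closed_Int_compactin[OF closedin_halfspaces[OF assms]] by simp
qed

lemma halfspaces_cube_limit:
  assumes "finite J"
  shows "(\<lambda>n. prob (halfspaces J u s \<inter> cube n)) \<longlonglongrightarrow> prob (halfspaces J u s)"
proof -
  have "incseq (\<lambda>n. halfspaces J u s \<inter> cube n)"
    unfolding incseq_def cube_def by (intro allI impI Int_mono PiE_mono) auto
  then have "(\<lambda>n. prob (halfspaces J u s \<inter> cube n)) \<longlonglongrightarrow> prob (\<Union>n. halfspaces J u s \<inter> cube n)"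
    using sets.Int[OF sets_halfspaces[OF assms] sets_cube] by (intro finite_Lim_measure_incseq) auto
  moreover have "(\<Union>n. halfspaces J u s \<inter> cube n) = halfspaces J u s"
  proof -
    have "\<exists>n. x \<in> cube n" if "x \<in> space \<mu>" for x
    proof -
      obtain n where n: "(\<Sum>i<d. \<bar>x i\<bar>) \<le> real n" using real_arch_simple by blast
      have "\<bar>x i\<bar> \<le> real n" if "i < d" for i
        using member_le_sum[of i "{..<d}" "\<lambda>i. \<bar>x i\<bar>"] n that by auto
      then show ?thesis using that by (intro exI[of _ n]) (auto simp: cube_def space_law PiE_iff abs_le_iff minus_le_iff)
    qed
    then show ?thesis by (auto simp: halfspaces_def)
  qed
  ultimately show ?thesis by simp
qed

lemma halfspaces_log_concave:
  assumes J: "finite J" and \<theta>: "0 < \<theta>" "\<theta> < 1"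
  shows "prob (halfspaces J u (\<lambda>j. \<theta> * s j + (1 - \<theta>) * s' j))
       \<ge> prob (halfspaces J u s) powr \<theta> * prob (halfspaces J u s') powr (1 - \<theta>)" (is "prob ?C \<ge> _")
proof -
  have "prob (halfspaces J u s \<inter> cube n) powr \<theta> * prob (halfspaces J u s' \<inter> cube n) powr (1 - \<theta>) \<le> prob ?C" for n
  \<comment> \<open>Empty sets are outside the assumption; the product is then 0, as a power of
    0.\<close>
  proof (cases "halfspaces J u s \<inter> cube n = {} \<or> halfspaces J u s' \<inter> cube n = {}")
    case True
    then show ?thesis using \<theta> by auto
  next
    case False
    then have "prob (halfspaces J u s \<inter> cube n) powr \<theta> * prob (halfspaces J u s' \<inter> cube n) powr (1 - \<theta>)
       \<le> prob (Rd_convex_comb d \<theta> (halfspaces J u s \<inter> cube n) (halfspaces J u s' \<inter> cube n))"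
      using lc \<theta> compactin_halfspaces_cube[OF J] by (auto simp: log_concave_law_def)
    also have "\<dots> \<le> prob ?C"
    proof (rule finite_measure_mono)
      show "Rd_convex_comb d \<theta> (halfspaces J u s \<inter> cube n) (halfspaces J u s' \<inter> cube n) \<subseteq> ?C"
      proof
        fix z assume "z \<in> Rd_convex_comb d \<theta> (halfspaces J u s \<inter> cube n) (halfspaces J u s' \<inter> cube n)"
        then obtain x y where xy: "x \<in> halfspaces J u s" "y \<in> halfspaces J u s'"
          and z: "z = (\<lambda>i\<in>{..<d}. \<theta> * x i + (1 - \<theta>) * y i)"
          by (auto simp: Rd_convex_comb_def)
        have "Rd_inner d v z = \<theta> * Rd_inner d v x + (1 - \<theta>) * Rd_inner d v y" for v
          by (simp add: Rd_inner_def z sum_distrib_left algebra_simps flip: sum.distrib)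
        then show "z \<in> ?C" using xy \<theta> z
          by (auto simp: halfspaces_def space_law intro!: add_mono mult_left_mono)
      qed
    qed (use J sets_halfspaces in auto)
    finally show ?thesis .
  qed
  moreover have "(\<lambda>n. prob (halfspaces J u s \<inter> cube n) powr \<theta> * prob (halfspaces J u s' \<inter> cube n) powr (1 - \<theta>))
     \<longlonglongrightarrow> prob (halfspaces J u s) powr \<theta> * prob (halfspaces J u s') powr (1 - \<theta>)"
    using \<theta> by (intro tendsto_mult tendsto_powr' halfspaces_cube_limit J tendsto_const) auto
  ultimately show ?thesis by (intro LIMSEQ_le_const2) auto
qed

end

section \<open>Moments of linear functionals\<close>

lemma powr_le_exp:
  fixes y p :: real
  assumes "y \<ge> 0" "p > 0"
  shows "y powr p \<le> p powr p * exp y"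
proof -
  have "y / p \<le> exp (y / p)" using exp_ge_add_one_self[of "y / p"] by linarith
  then have "(y / p) powr p \<le> exp (y / p) powr p" using assms by (intro powr_mono2) auto
  also have "\<dots> = exp y" using assms by (simp add: powr_def)
  finally have "p powr p * (y / p) powr p \<le> p powr p * exp y" by (intro mult_left_mono) auto
  then show ?thesis using assms by (simp flip: powr_mult)
qed

lemma powr_sum_le:
  fixes f :: "'i \<Rightarrow> real"
  assumes "finite I" "p > 0" "\<And>i. i \<in> I \<Longrightarrow> 0 \<le> f i"
  shows "(\<Sum>i\<in>I. f i) powr p \<le> real (card I) powr p * (\<Sum>i\<in>I. f i powr p)"
proof (cases "I = {}")
  case False
  have "Max (f ` I) \<in> f ` I" using assms False by (intro Max_in) auto
  then obtain j where j: "j \<in> I" "Max (f ` I) = f j" by auto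
  have "(\<Sum>i\<in>I. f i) \<le> (\<Sum>i\<in>I. f j)" using assms(1) j(2)[symmetric] by (intro sum_mono) simp
  then have "(\<Sum>i\<in>I. f i) powr p \<le> (real (card I) * f j) powr p"
    using assms by (intro powr_mono2) (auto intro: sum_nonneg)
  also have "\<dots> = real (card I) powr p * f j powr p" using assms(3)[OF j(1)] by (simp add: powr_mult)
  also have "\<dots> \<le> real (card I) powr p * (\<Sum>i\<in>I. f i powr p)"
    using assms j by (intro mult_left_mono member_le_sum) auto
  finally show ?thesis .
qed simp

text \<open>The constant is \<open>\<Sum>k. 3 * (3/4) ^ k\<close>, from \<open>exp 1 \<le> 3\<close>.\<close>

lemma (in prob_space) exp_moment_of_tail:
  fixes V :: "'a \<Rightarrow> real"
  assumes [measurable]: "V \<in> borel_measurable M"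
    and tail: "\<And>k::nat. prob {x \<in> space M. real k \<le> \<bar>V x\<bar>} \<le> (1/4) ^ k"
  shows "integrable M (\<lambda>x. exp \<bar>V x\<bar>)" "expectation (\<lambda>x. exp \<bar>V x\<bar>) \<le> 12"
proof -
  have pt: "ennreal (exp \<bar>V x\<bar>) \<le> (\<Sum>k. ennreal (exp (real k + 1)) * indicator {x \<in> space M. real k \<le> \<bar>V x\<bar>} x)"
    if x: "x \<in> space M" for x
  proof -
    define k where "k = nat \<lfloor>\<bar>V x\<bar>\<rfloor>"
    have k: "real k \<le> \<bar>V x\<bar>" "\<bar>V x\<bar> \<le> real k + 1" unfolding k_def by linarith+
    define f where "f = (\<lambda>k. ennreal (exp (real k + 1)) * indicator {x \<in> space M. real k \<le> \<bar>V x\<bar>} x)"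
    have "ennreal (exp \<bar>V x\<bar>) \<le> f k" using k x by (simp add: f_def ennreal_leI)
    also have "\<dots> \<le> suminf f" using sum_le_suminf[of f "{k}"] by (simp add: summableI)
    finally show ?thesis by (simp add: f_def)
  qed
  have "(\<integral>\<^sup>+x. ennreal (exp \<bar>V x\<bar>) \<partial>M)
      \<le> (\<integral>\<^sup>+x. (\<Sum>k. ennreal (exp (real k + 1)) * indicator {x \<in> space M. real k \<le> \<bar>V x\<bar>} x) \<partial>M)"
    by (intro nn_integral_mono pt)
  also have "\<dots> = (\<Sum>k. \<integral>\<^sup>+x. ennreal (exp (real k + 1)) * indicator {x \<in> space M. real k \<le> \<bar>V x\<bar>} x \<partial>M)"
    by (intro nn_integral_suminf) auto
  also have "\<dots> = (\<Sum>k. ennreal (exp (real k + 1) * prob {x \<in> space M. real k \<le> \<bar>V x\<bar>}))"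
    by (simp add: nn_integral_cmult_indicator emeasure_eq_measure ennreal_mult)
  also have "\<dots> \<le> (\<Sum>k. ennreal (3 * (3/4) ^ k))"
  proof (intro suminf_le summableI ennreal_leI)
    fix k :: nat
    have "exp (real k + 1) * prob {x \<in> space M. real k \<le> \<bar>V x\<bar>} \<le> exp (real k + 1) * (1/4) ^ k"
      using tail by (intro mult_left_mono) auto
    also have "\<dots> = exp 1 * (exp 1 * (1/4)) ^ k"
      by (simp add: exp_add power_divide exp_of_nat_mult[of k 1, simplified])
    also have "\<dots> \<le> 3 * (3 * (1/4)) ^ k"
      using exp_le by (intro mult_mono power_mono) auto
    finally show "exp (real k + 1) * prob {x \<in> space M. real k \<le> \<bar>V x\<bar>} \<le> 3 * (3/4) ^ k" by simp
  qed
  also have "\<dots> = ennreal (\<Sum>k. 3 * (3/4) ^ k)"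
    by (intro suminf_ennreal2) auto
  also have "(\<Sum>k. 3 * (3/4) ^ k) = (12::real)"
    by (subst suminf_mult) (auto simp: suminf_geometric)
  finally have le: "(\<integral>\<^sup>+x. ennreal (exp \<bar>V x\<bar>) \<partial>M) \<le> ennreal 12" .
  then have "(\<integral>\<^sup>+x. ennreal (exp \<bar>V x\<bar>) \<partial>M) < \<infinity>" by (simp add: le_less_trans)
  then show int: "integrable M (\<lambda>x. exp \<bar>V x\<bar>)" by (intro integrableI_nonneg) auto
  have "ennreal (expectation (\<lambda>x. exp \<bar>V x\<bar>)) \<le> ennreal 12"
    using le nn_integral_eq_integral[OF int] by simp
  then show "expectation (\<lambda>x. exp \<bar>V x\<bar>) \<le> 12" by (subst (asm) ennreal_le_iff) auto
qed

context uncond_lc_law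
begin

lemma inner_flip_all: "Rd_inner d u (flip (\<lambda>_. -1) x) = - Rd_inner d u x"
  by (simp add: Rd_inner_def flip_def sum_negf)

lemma flip_space: "flip \<sigma> x \<in> space \<mu>"
  by (simp add: flip_def space_law)

lemma prob_inner_symmetric:
  "prob {x \<in> space \<mu>. s \<le> - Rd_inner d u x} = prob {x \<in> space \<mu>. s \<le> Rd_inner d u x}"
proof -
  define A where "A = {x \<in> space \<mu>. s \<le> Rd_inner d u x}"
  have [measurable]: "A \<in> sets \<mu>" unfolding A_def by measurable
  have "{x \<in> space \<mu>. flip (\<lambda>_. -1) x \<in> A} = {x \<in> space \<mu>. s \<le> - Rd_inner d u x}"
    by (simp add: A_def inner_flip_all flip_space)
  moreover have "prob {x \<in> space \<mu>. flip (\<lambda>_. -1) x \<in> A} = prob A" by (rule prob_flip) auto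
  ultimately show ?thesis by (simp add: A_def)
qed

text \<open>Borell's lemma. The level s lies between 0 and k s with weight 1/k on the latter, and by
  symmetry the half-space at 0 has probability at least 1/2; log-concavity then bounds the tail at k
  s by a k-th power of the tail at s.\<close>

lemma inner_tail:
  assumes s: "s > 0" and le: "prob {x \<in> space \<mu>. s \<le> \<bar>Rd_inner d u x\<bar>} \<le> 1/4"
  shows "prob {x \<in> space \<mu>. real k \<le> \<bar>Rd_inner d u x / s\<bar>} \<le> (1/4) ^ k"
proof (cases "k = 0")
  case True
  then show ?thesis by simp
next
  case False
  define h where "h = (\<lambda>r. prob {x \<in> space \<mu>. r \<le> Rd_inner d u x})"
  have abs_eq: "prob {x \<in> space \<mu>. r \<le> \<bar>Rd_inner d u x\<bar>} = 2 * h r" if "r > 0" for r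
  proof -
    have "{x \<in> space \<mu>. r \<le> \<bar>Rd_inner d u x\<bar>} = {x \<in> space \<mu>. r \<le> Rd_inner d u x} \<union> {x \<in> space \<mu>. r \<le> - Rd_inner d u x}"
      by auto
    moreover have "prob (\<dots>) = h r + prob {x \<in> space \<mu>. r \<le> - Rd_inner d u x}"
      unfolding h_def using that by (intro finite_measure_Union) auto
    ultimately show ?thesis using prob_inner_symmetric[of r u] by (simp add: h_def)
  qed
  have h0: "h 0 \<ge> 1/2"
  proof -
    have "space \<mu> = {x \<in> space \<mu>. 0 \<le> Rd_inner d u x} \<union> {x \<in> space \<mu>. 0 \<le> - Rd_inner d u x}" by auto
    then have "1 = prob ({x \<in> space \<mu>. 0 \<le> Rd_inner d u x} \<union> {x \<in> space \<mu>. 0 \<le> - Rd_inner d u x})"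
      using prob_space by simp
    also have "\<dots> \<le> h 0 + prob {x \<in> space \<mu>. 0 \<le> - Rd_inner d u x}"
      unfolding h_def by (intro measure_Un_le) auto
    finally show ?thesis using prob_inner_symmetric[of 0 u] by (simp add: h_def)
  qed
  have hs: "h s \<le> 1/8" using abs_eq[OF s] le by simp
  have nn: "h r \<ge> 0" for r by (simp add: h_def)
  have "h (real k * s) \<le> (1/8) ^ k * 2 ^ (k - 1)"
  proof (cases "k = 1")
    case True
    then show ?thesis using hs by simp
  next
    case k1: False
    define \<theta> where "\<theta> = 1 / real k"
    have \<theta>: "0 < \<theta>" "\<theta> < 1" using False k1 by (auto simp: \<theta>_def)
    have hh: "prob (halfspaces {()} (\<lambda>_. u) (\<lambda>_. r)) = h r" for r
      by (simp add: halfspaces_def h_def)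
    have "h (real k * s) powr \<theta> * h 0 powr (1 - \<theta>) \<le> h (\<theta> * (real k * s) + (1 - \<theta>) * 0)"
      using halfspaces_log_concave[of "{()}" \<theta> "\<lambda>_. u" "\<lambda>_. real k * s" "\<lambda>_. 0"] \<theta> by (simp add: hh)
    also have "\<theta> * (real k * s) + (1 - \<theta>) * 0 = s" using False by (simp add: \<theta>_def)
    finally have "(h (real k * s) powr \<theta> * h 0 powr (1 - \<theta>)) powr real k \<le> h s powr real k"
      by (intro powr_mono2) auto
    also have "(h (real k * s) powr \<theta> * h 0 powr (1 - \<theta>)) powr real k
        = h (real k * s) powr (\<theta> * real k) * h 0 powr ((1 - \<theta>) * real k)"
      by (simp add: powr_mult powr_powr)
    also have "\<theta> * real k = 1" using False by (simp add: \<theta>_def)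
    also have "(1 - \<theta>) * real k = real (k - 1)" using False by (simp add: \<theta>_def field_simps of_nat_diff)
    also have "h 0 powr real (k - 1) = h 0 ^ (k - 1)" using h0 by (intro powr_realpow) auto
    also have "h s powr real k = h s ^ k" using nn[of s] False by (simp add: powr_realpow')
    finally have "h (real k * s) * h 0 ^ (k - 1) \<le> h s ^ k" using nn by simp
    also have "\<dots> \<le> (1/8) ^ k" using hs nn by (intro power_mono) auto
    finally have A: "h (real k * s) * h 0 ^ (k - 1) \<le> (1/8) ^ k" .
    have "h (real k * s) * (1/2) ^ (k - 1) \<le> h (real k * s) * h 0 ^ (k - 1)"
      using h0 nn by (intro mult_left_mono power_mono) auto
    then have "h (real k * s) * (1/2) ^ (k - 1) \<le> (1/8) ^ k" using A by linarith
    then have "h (real k * s) * (1/2) ^ (k - 1) * 2 ^ (k - 1) \<le> (1/8) ^ k * 2 ^ (k - 1)" by (intro mult_right_mono) auto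
    then show ?thesis by (simp add: mult.assoc flip: power_mult_distrib)
  qed
  also have "(1/8) ^ k * 2 ^ (k - 1) = (1/4) ^ k / (2::real)"
  proof -
    have "(2::real) ^ k = 2 * 2 ^ (k - 1)" using False by (cases k) auto
    moreover have "(1/8) ^ k * 2 ^ k = (1/4::real) ^ k" by (simp flip: power_mult_distrib)
    ultimately show ?thesis by simp
  qed
  finally have "2 * h (real k * s) \<le> (1/4) ^ k" by simp
  moreover have "{x \<in> space \<mu>. real k \<le> \<bar>Rd_inner d u x / s\<bar>} = {x \<in> space \<mu>. real k * s \<le> \<bar>Rd_inner d u x\<bar>}"
    using s by (simp add: pos_le_divide_eq)
  ultimately show ?thesis using abs_eq[of "real k * s"] s False by simp
qed

lemma inner_exp_moment:
  assumes "s > 0" "prob {x \<in> space \<mu>. s \<le> \<bar>Rd_inner d u x\<bar>} \<le> 1/4"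
  shows "integrable \<mu> (\<lambda>x. exp \<bar>Rd_inner d u x / s\<bar>)" "expectation (\<lambda>x. exp \<bar>Rd_inner d u x / s\<bar>) \<le> 12"
proof -
  have [measurable]: "(\<lambda>x. Rd_inner d u x / s) \<in> borel_measurable \<mu>" by measurable
  show "integrable \<mu> (\<lambda>x. exp \<bar>Rd_inner d u x / s\<bar>)" "expectation (\<lambda>x. exp \<bar>Rd_inner d u x / s\<bar>) \<le> 12"
    by (rule exp_moment_of_tail, measurable, rule inner_tail[OF assms])+
qed

text \<open>Some s has tail at most 1/4, because the tail events decrease to the empty set; the
  exponential moment at this scale bounds all others.\<close>

lemma integrable_inner_abs_powr:
  assumes p: "p > 0"
  shows "integrable \<mu> (\<lambda>x. \<bar>Rd_inner d u x\<bar> powr p)"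
proof -
  define E where "E = (\<lambda>n::nat. {x \<in> space \<mu>. real (Suc n) \<le> \<bar>Rd_inner d u x\<bar>})"
  have "(\<lambda>n. prob (E n)) \<longlonglongrightarrow> prob (\<Inter>n. E n)"
    by (intro finite_Lim_measure_decseq) (auto simp: E_def decseq_def)
  moreover have "(\<Inter>n. E n) = {}"
  proof (rule ccontr)
    assume "(\<Inter>n. E n) \<noteq> {}"
    then obtain x where "\<And>n. real (Suc n) \<le> \<bar>Rd_inner d u x\<bar>" by (auto simp: E_def)
    then show False using reals_Archimedean2[of "\<bar>Rd_inner d u x\<bar>"] by (metis lessI less_trans not_less of_nat_less_iff)
  qed
  ultimately have "(\<lambda>n. prob (E n)) \<longlonglongrightarrow> 0" by simp
  then have "eventually (\<lambda>n. prob (E n) < 1/4) sequentially" by (intro order_tendstoD) auto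
  then obtain n where n: "prob (E n) < 1/4" by (auto simp: eventually_sequentially)
  define s where "s = real (Suc n)"
  have s: "s > 0" by (simp add: s_def)
  have I: "integrable \<mu> (\<lambda>x. exp \<bar>Rd_inner d u x / s\<bar>)"
    using n s by (intro inner_exp_moment) (auto simp: s_def E_def)
  show ?thesis
  proof (rule Bochner_Integration.integrable_bound)
    show "integrable \<mu> (\<lambda>x. s powr p * (p powr p * exp \<bar>Rd_inner d u x / s\<bar>))" using I by simp
    have "\<bar>Rd_inner d u x\<bar> powr p \<le> s powr p * (p powr p * exp \<bar>Rd_inner d u x / s\<bar>)" for x
    proof -
      have "\<bar>Rd_inner d u x\<bar> powr p = s powr p * \<bar>Rd_inner d u x / s\<bar> powr p"
        using s by (simp flip: powr_mult)
      also have "\<dots> \<le> s powr p * (p powr p * exp \<bar>Rd_inner d u x / s\<bar>)"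
        using p by (intro mult_left_mono powr_le_exp) auto
      finally show ?thesis .
    qed
    then show "AE x in \<mu>. norm (\<bar>Rd_inner d u x\<bar> powr p) \<le> norm (s powr p * (p powr p * exp \<bar>Rd_inner d u x / s\<bar>))"
      by simp
  qed simp
qed

lemma integrable_inner: "integrable \<mu> (Rd_inner d u)"
proof -
  have "(\<lambda>x. \<bar>Rd_inner d u x\<bar> powr 1) = (\<lambda>x. \<bar>Rd_inner d u x\<bar>)" by auto
  then have "integrable \<mu> (\<lambda>x. \<bar>Rd_inner d u x\<bar>)" using integrable_inner_abs_powr[of 1 u] by simp
  then show ?thesis by (rule integrable_abs_cancel) simp
qed

definition unit_coeff :: "nat \<Rightarrow> real \<Rightarrow> nat \<Rightarrow> real" where
  "unit_coeff i b = (\<lambda>j. if j = i then b else 0)"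

lemma inner_unit_coeff: "i < d \<Longrightarrow> Rd_inner d (unit_coeff i b) x = b * x i"
  by (simp add: Rd_inner_def unit_coeff_def if_distrib[of "\<lambda>z. z * _"] cong: if_cong)

lemma integrable_coord [simp]: "i < d \<Longrightarrow> integrable \<mu> (\<lambda>x. x i)"
proof -
  assume "i < d"
  then have "Rd_inner d (unit_coeff i 1) = (\<lambda>x. x i)" by (simp add: fun_eq_iff inner_unit_coeff)
  then show ?thesis using integrable_inner[of "unit_coeff i 1"] by simp
qed

text \<open>Degenerate laws are allowed, so this may be 0; the coordinate then vanishes almost
  surely.\<close>

definition mean_abs :: "nat \<Rightarrow> real" where
  "mean_abs i = expectation (\<lambda>x. \<bar>x i\<bar>)"

lemma mean_abs_nonneg: "mean_abs i \<ge> 0"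
  by (simp add: mean_abs_def)

text \<open>Markov's inequality at 4 m gives the tail 1/4.\<close>

lemma exp_moment_mean:
  assumes "expectation (\<lambda>x. \<bar>Rd_inner d u x\<bar>) = m" "m > 0"
  shows "integrable \<mu> (\<lambda>x. exp \<bar>Rd_inner d u x / (4 * m)\<bar>)"
    "expectation (\<lambda>x. exp \<bar>Rd_inner d u x / (4 * m)\<bar>) \<le> 12"
proof -
  have "prob {x \<in> space \<mu>. 4 * m \<le> \<bar>Rd_inner d u x\<bar>} \<le> expectation (\<lambda>x. \<bar>Rd_inner d u x\<bar>) / (4 * m)"
    using assms integrable_inner by (intro integral_Markov_inequality_measure[where A = "{}"]) auto
  then have "prob {x \<in> space \<mu>. 4 * m \<le> \<bar>Rd_inner d u x\<bar>} \<le> 1/4" using assms by simp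
  moreover have "4 * m > 0" using assms by simp
  ultimately show "integrable \<mu> (\<lambda>x. exp \<bar>Rd_inner d u x / (4 * m)\<bar>)"
    "expectation (\<lambda>x. exp \<bar>Rd_inner d u x / (4 * m)\<bar>) \<le> 12"
    by (rule inner_exp_moment[rotated])+
qed

lemma AE_coord_zero:
  assumes "i < d" "mean_abs i = 0"
  shows "AE x in \<mu>. x i = 0"
  using assms integral_nonneg_eq_0_iff_AE[of \<mu> "\<lambda>x. \<bar>x i\<bar>"] by (simp add: mean_abs_def)

section \<open>Averaging over the signs of some coordinates\<close>

definition extend_sign :: "nat set \<Rightarrow> (nat \<Rightarrow> real) \<Rightarrow> nat \<Rightarrow> real" where
  "extend_sign D \<sigma> = (\<lambda>i. if i \<in> D then \<sigma> i else 1)"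

lemma extend_sign_mem: "\<sigma> \<in> signs D \<Longrightarrow> extend_sign D \<sigma> i \<in> {-1, 1}"
  by (auto simp: extend_sign_def PiE_iff)

text \<open>The bridge from sign averages to \<mu>: randomizing the signs on D does not change an
  integral, so pointwise inequalities between sums over \<open>signs D\<close> become inequalities
  between expectations.\<close>

lemma integral_signs_average:
  fixes h :: "_ \<Rightarrow> real"
  assumes D: "D \<subseteq> {..<d}" and h: "integrable \<mu> h"
  shows "integrable \<mu> (\<lambda>x. \<Sum>\<sigma>\<in>signs D. h (flip (extend_sign D \<sigma>) x))"
    "(\<integral>x. (\<Sum>\<sigma>\<in>signs D. h (flip (extend_sign D \<sigma>) x)) \<partial>\<mu>) = 2 ^ card D * (\<integral>x. h x \<partial>\<mu>)"
proof -
  have fin: "finite D" using D finite_subset by blast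
  have int: "integrable \<mu> (\<lambda>x. h (flip (extend_sign D \<sigma>) x))"
    and eq: "(\<integral>x. h (flip (extend_sign D \<sigma>) x) \<partial>\<mu>) = (\<integral>x. h x \<partial>\<mu>)" if "\<sigma> \<in> signs D" for \<sigma>
    using integrable_flip[of "extend_sign D \<sigma>" h] integral_flip[of "extend_sign D \<sigma>" h] extend_sign_mem[OF that] h
    by auto
  show "integrable \<mu> (\<lambda>x. \<Sum>\<sigma>\<in>signs D. h (flip (extend_sign D \<sigma>) x))" using int by simp
  have "(\<integral>x. (\<Sum>\<sigma>\<in>signs D. h (flip (extend_sign D \<sigma>) x)) \<partial>\<mu>) = (\<Sum>\<sigma>\<in>signs D. \<integral>x. h x \<partial>\<mu>)"
    using int eq by (simp add: Bochner_Integration.integral_sum)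
  then show "(\<integral>x. (\<Sum>\<sigma>\<in>signs D. h (flip (extend_sign D \<sigma>) x)) \<partial>\<mu>) = 2 ^ card D * (\<integral>x. h x \<partial>\<mu>)"
    by (simp add: card_signs fin)
qed

lemma measurable_Max_linear [measurable]:
  assumes "finite T" "J \<subseteq> {..<d}"
  shows "(\<lambda>x. MAX t\<in>T. \<Sum>i\<in>J. a t i * x i) \<in> borel_measurable \<mu>"
  using assms by (intro borel_measurable_Max measurable_linear) auto

lemma abs_Max_le_sum:
  fixes f :: "'t \<Rightarrow> real"
  assumes "finite T" "T \<noteq> {}"
  shows "\<bar>MAX t\<in>T. f t\<bar> \<le> (\<Sum>t\<in>T. \<bar>f t\<bar>)"
proof -
  have "(MAX t\<in>T. f t) \<in> f ` T" using assms by (intro Max_in) auto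
  then obtain t where "t \<in> T" "(MAX t\<in>T. f t) = f t" by auto
  then show ?thesis using member_le_sum[of t T "\<lambda>t. \<bar>f t\<bar>"] assms by simp
qed

lemma integrable_Max_linear:
  assumes "finite T" "T \<noteq> {}" "J \<subseteq> {..<d}"
  shows "integrable \<mu> (\<lambda>x. MAX t\<in>T. \<Sum>i\<in>J. a t i * x i)"
proof (rule Bochner_Integration.integrable_bound)
  show "integrable \<mu> (\<lambda>x. \<Sum>t\<in>T. \<bar>\<Sum>i\<in>J. a t i * x i\<bar>)"
    using assms by (intro Bochner_Integration.integrable_sum integrable_abs integrable_mult_right integrable_coord) auto
  show "AE x in \<mu>. norm (MAX t\<in>T. \<Sum>i\<in>J. a t i * x i) \<le> norm (\<Sum>t\<in>T. \<bar>\<Sum>i\<in>J. a t i * x i\<bar>)"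
    using abs_Max_le_sum[OF assms(1,2)] by (simp add: sum_nonneg)
qed (use assms in auto)

lemma integrable_Max_abs:
  assumes T: "finite T" "T \<noteq> {}" and J: "J \<subseteq> {..<d}"
  shows "integrable \<mu> (\<lambda>x. MAX t\<in>T. \<Sum>i\<in>J. a t i * \<bar>x i\<bar> * \<sigma> i)"
proof (rule Bochner_Integration.integrable_bound)
  show "integrable \<mu> (\<lambda>x. \<Sum>t\<in>T. \<bar>\<Sum>i\<in>J. a t i * \<bar>x i\<bar> * \<sigma> i\<bar>)"
    using J by (intro Bochner_Integration.integrable_sum integrable_abs integrable_mult_right integrable_mult_left integrable_coord) auto
  show "AE x in \<mu>. norm (MAX t\<in>T. \<Sum>i\<in>J. a t i * \<bar>x i\<bar> * \<sigma> i) \<le> norm (\<Sum>t\<in>T. \<bar>\<Sum>i\<in>J. a t i * \<bar>x i\<bar> * \<sigma> i\<bar>)"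
    using abs_Max_le_sum[OF T] by (simp add: sum_nonneg)
  show "(\<lambda>x. MAX t\<in>T. \<Sum>i\<in>J. a t i * \<bar>x i\<bar> * \<sigma> i) \<in> borel_measurable \<mu>"
    using T J by (intro borel_measurable_Max borel_measurable_sum borel_measurable_times borel_measurable_abs
        borel_measurable_const measurable_coord) auto
qed

lemma flip_extend_sum:
  assumes "J \<subseteq> D" "D \<subseteq> {..<d}"
  shows "(\<Sum>i\<in>J. a i * flip (extend_sign D \<sigma>) x i) = (\<Sum>i\<in>J. (a i * x i) * \<sigma> i)"
  using assms by (intro sum.cong refl) (auto simp: flip_apply extend_sign_def subset_iff)

text \<open>For fixed x the numbers a t i * x i are the coefficients of a sign average, to which
  \<open>signs_contraction\<close> applies.\<close>

lemma expectation_contraction: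
  assumes "finite T" "T \<noteq> {}"
    and "\<And>s t i. s \<in> T \<Longrightarrow> t \<in> T \<Longrightarrow> i < d \<Longrightarrow> \<bar>b t i - b s i\<bar> \<le> \<bar>a t i - a s i\<bar>"
  shows "expectation (\<lambda>x. MAX t\<in>T. \<Sum>i<d. b t i * x i) \<le> expectation (\<lambda>x. MAX t\<in>T. \<Sum>i<d. a t i * x i)"
proof -
  note IM = integrable_Max_linear[OF assms(1,2) order_refl]
  have "2 ^ card {..<d} * expectation (\<lambda>x. MAX t\<in>T. \<Sum>i<d. b t i * x i)
     = expectation (\<lambda>x. \<Sum>\<sigma>\<in>signs {..<d}. MAX t\<in>T. \<Sum>i<d. b t i * flip (extend_sign {..<d} \<sigma>) x i)"
    by (intro integral_signs_average(2)[symmetric] IM) auto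
  also have "\<dots> \<le> expectation (\<lambda>x. \<Sum>\<sigma>\<in>signs {..<d}. MAX t\<in>T. \<Sum>i<d. a t i * flip (extend_sign {..<d} \<sigma>) x i)"
  proof (rule integral_mono)
    fix x
    show "(\<Sum>\<sigma>\<in>signs {..<d}. MAX t\<in>T. \<Sum>i<d. b t i * flip (extend_sign {..<d} \<sigma>) x i)
      \<le> (\<Sum>\<sigma>\<in>signs {..<d}. MAX t\<in>T. \<Sum>i<d. a t i * flip (extend_sign {..<d} \<sigma>) x i)"
      using signs_contraction[of "{..<d}" T "\<lambda>t i. b t i * x i" "\<lambda>t i. a t i * x i" "\<lambda>_. 0"] assms
      by (simp add: flip_extend_sum abs_mult mult_right_mono flip: left_diff_distrib)
  qed (intro integral_signs_average(1) IM order_refl)+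
  also have "\<dots> = 2 ^ card {..<d} * expectation (\<lambda>x. MAX t\<in>T. \<Sum>i<d. a t i * x i)"
    by (intro integral_signs_average(2) IM) auto
  finally show ?thesis by simp
qed

text \<open>Jensen's inequality for the magnitudes, conditionally on the signs.\<close>

lemma rad_le_expectation:
  assumes T: "finite T" "T \<noteq> {}"
  shows "rad {..<d} T (\<lambda>t i. a t i * mean_abs i) \<le> expectation (\<lambda>x. MAX t\<in>T. \<Sum>i<d. a t i * x i)"
proof -
  have int: "integrable \<mu> (\<lambda>x. MAX t\<in>T. \<Sum>i<d. a t i * \<bar>x i\<bar> * \<sigma> i)" for \<sigma>
    by (rule integrable_Max_abs[OF T order_refl])
  have "2 ^ card {..<d} * rad {..<d} T (\<lambda>t i. a t i * mean_abs i)
     = (\<Sum>\<sigma>\<in>signs {..<d}. MAX t\<in>T. \<Sum>i<d. a t i * mean_abs i * \<sigma> i)"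
    by (simp add: rad_def)
  also have "\<dots> \<le> (\<Sum>\<sigma>\<in>signs {..<d}. expectation (\<lambda>x. MAX t\<in>T. \<Sum>i<d. a t i * \<bar>x i\<bar> * \<sigma> i))"
  proof (intro sum_mono Max.boundedI)
    fix \<sigma> y assume "y \<in> (\<lambda>t. \<Sum>i<d. a t i * mean_abs i * \<sigma> i) ` T"
    then obtain t where t: "t \<in> T" "y = (\<Sum>i<d. a t i * mean_abs i * \<sigma> i)" by auto
    have "y = expectation (\<lambda>x. \<Sum>i<d. a t i * \<bar>x i\<bar> * \<sigma> i)"
      unfolding t(2) mean_abs_def by (subst Bochner_Integration.integral_sum) auto
    also have "\<dots> \<le> expectation (\<lambda>x. MAX t\<in>T. \<Sum>i<d. a t i * \<bar>x i\<bar> * \<sigma> i)"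
    proof (rule integral_mono)
      show "integrable \<mu> (\<lambda>x. \<Sum>i<d. a t i * \<bar>x i\<bar> * \<sigma> i)" by (intro Bochner_Integration.integrable_sum) auto
    qed (use t T int in \<open>auto intro!: Max_ge\<close>)
    finally show "y \<le> expectation (\<lambda>x. MAX t\<in>T. \<Sum>i<d. a t i * \<bar>x i\<bar> * \<sigma> i)" .
  qed (use T in auto)
  also have "\<dots> = expectation (\<lambda>x. \<Sum>\<sigma>\<in>signs {..<d}. MAX t\<in>T. \<Sum>i<d. a t i * \<bar>x i\<bar> * \<sigma> i)"
    using int by (simp add: Bochner_Integration.integral_sum)
  also have "\<dots> \<le> expectation (\<lambda>x. \<Sum>\<sigma>\<in>signs {..<d}. MAX t\<in>T. \<Sum>i<d. a t i * flip (extend_sign {..<d} \<sigma>) x i)"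
  proof (rule integral_mono)
    fix x
    show "(\<Sum>\<sigma>\<in>signs {..<d}. MAX t\<in>T. \<Sum>i<d. a t i * \<bar>x i\<bar> * \<sigma> i)
      \<le> (\<Sum>\<sigma>\<in>signs {..<d}. MAX t\<in>T. \<Sum>i<d. a t i * flip (extend_sign {..<d} \<sigma>) x i)"
      using signs_contraction[of "{..<d}" T "\<lambda>t i. a t i * \<bar>x i\<bar>" "\<lambda>t i. a t i * x i" "\<lambda>_. 0"] T
      by (simp add: flip_extend_sum abs_mult flip: left_diff_distrib)
  qed (use int in \<open>auto intro!: integral_signs_average(1) integrable_Max_linear T\<close>)
  also have "\<dots> = 2 ^ card {..<d} * expectation (\<lambda>x. MAX t\<in>T. \<Sum>i<d. a t i * x i)"
    by (intro integral_signs_average(2) integrable_Max_linear T) auto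
  finally show ?thesis by simp
qed

section \<open>Shifted orthants\<close>

lemma integrable_indicator_event: "A \<in> sets \<mu> \<Longrightarrow> integrable \<mu> (indicat_real A)"
  by (simp add: integrable_indicator_iff emeasure_eq_measure)

definition orthant :: "nat set \<Rightarrow> (nat \<Rightarrow> real) \<Rightarrow> (nat \<Rightarrow> real) \<Rightarrow> (nat \<Rightarrow> real) set" where
  "orthant A b z = {x \<in> space \<mu>. \<forall>i\<in>A. z i \<le> b i * x i}"

lemma orthant_eq_halfspaces:
  "A \<subseteq> {..<d} \<Longrightarrow> orthant A b z = halfspaces A (\<lambda>i. unit_coeff i (b i)) z"
  by (auto simp: orthant_def halfspaces_def inner_unit_coeff subset_iff)

lemma sets_orthant: "A \<subseteq> {..<d} \<Longrightarrow> orthant A b z \<in> sets \<mu>"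
  by (simp add: orthant_eq_halfspaces sets_halfspaces finite_subset)

lemma sets_abs_ge:
  assumes "A \<subseteq> {..<d}"
  shows "{x \<in> space \<mu>. \<forall>i\<in>A. z i \<le> \<bar>b i * x i\<bar>} \<in> sets \<mu>"
proof (rule sets.sets_Collect_finite_All)
  fix i assume "i \<in> A"
  then have [measurable]: "(\<lambda>x. x i) \<in> borel_measurable \<mu>" using assms by (intro measurable_coord) auto
  show "{x \<in> space \<mu>. z i \<le> \<bar>b i * x i\<bar>} \<in> sets \<mu>" by measurable
qed (use assms finite_subset in auto)

lemma orthant_log_concave:
  assumes "A \<subseteq> {..<d}" "0 < \<theta>" "\<theta> < 1"
  shows "prob (orthant A b (\<lambda>i. \<theta> * z i + (1 - \<theta>) * z' i))
      \<ge> prob (orthant A b z) powr \<theta> * prob (orthant A b z') powr (1 - \<theta>)"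
  using assms finite_subset[OF assms(1)] by (simp add: orthant_eq_halfspaces halfspaces_log_concave)

lemma sum_signs_indicator_orthant:
  assumes "A \<subseteq> {..<d}" "x \<in> space \<mu>"
  shows "(\<Sum>\<sigma>\<in>signs A. indicator (orthant A b z) (flip (extend_sign A \<sigma>) x))
    = (\<Prod>i\<in>A. (if z i \<le> b i * x i then 1 else 0) + (if z i \<le> - (b i * x i) then 1 else 0 :: real))"
proof -
  have fin: "finite A" using assms finite_subset by blast
  have "indicator (orthant A b z) (flip (extend_sign A \<sigma>) x) = (\<Prod>i\<in>A. if z i \<le> b i * x i * \<sigma> i then 1 else 0 :: real)" for \<sigma>
  proof -
    have "flip (extend_sign A \<sigma>) x \<in> orthant A b z \<longleftrightarrow> (\<forall>i\<in>A. z i \<le> b i * x i * \<sigma> i)"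
      using assms by (auto simp: orthant_def flip_space flip_apply extend_sign_def subset_iff algebra_simps)
    then show ?thesis using fin by (auto simp: indicator_def prod_zero_iff)
  qed
  then show ?thesis using sum_signs_prod[OF fin, of "\<lambda>i s. if z i \<le> b i * x i * s then 1 else 0"] by simp
qed

text \<open>The magnitude event is covered by the sign images of the orthant, one for each element
  of \<open>signs A\<close>, all of the same probability. For positive levels the images are
  disjoint, which gives the equality; in general they may overlap, and the inequality
  remains.\<close>

lemma
  assumes A: "A \<subseteq> {..<d}"
  shows prob_abs_le_orthant: "prob {x \<in> space \<mu>. \<forall>i\<in>A. z i \<le> \<bar>b i * x i\<bar>} \<le> 2 ^ card A * prob (orthant A b z)"
    and expectation_orthant_even:
      "\<lbrakk>\<And>i. i \<in> A \<Longrightarrow> z i > 0; integrable \<mu> (g :: _ \<Rightarrow> real); \<And>\<sigma> x. \<sigma> \<in> signs A \<Longrightarrow> x \<in> space \<mu> \<Longrightarrow> g (flip (extend_sign A \<sigma>) x) = g x\<rbrakk>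
       \<Longrightarrow> expectation (\<lambda>x. indicator {x \<in> space \<mu>. \<forall>i\<in>A. z i \<le> \<bar>b i * x i\<bar>} x * g x)
         = 2 ^ card A * expectation (\<lambda>x. indicator (orthant A b z) x * g x)"
proof -
  have fin: "finite A" using A finite_subset by blast
  let ?E = "{x \<in> space \<mu>. \<forall>i\<in>A. z i \<le> \<bar>b i * x i\<bar>}"
  have mA [measurable]: "?E \<in> sets \<mu>" by (rule sets_abs_ge[OF A])
  have [measurable]: "orthant A b z \<in> sets \<mu>" using A by (rule sets_orthant)
  have "prob ?E = expectation (indicator ?E)" by simp
  also have "\<dots> \<le> expectation (\<lambda>x. \<Sum>\<sigma>\<in>signs A. indicator (orthant A b z) (flip (extend_sign A \<sigma>) x))"
  proof (rule integral_mono)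
    fix x assume x: "x \<in> space \<mu>"
    show "indicator ?E x \<le> (\<Sum>\<sigma>\<in>signs A. indicator (orthant A b z) (flip (extend_sign A \<sigma>) x) :: real)"
    proof (cases "x \<in> ?E")
      case True
      have "(1::real) = (\<Prod>i\<in>A. 1)" by simp
      also have "\<dots> \<le> (\<Prod>i\<in>A. (if z i \<le> b i * x i then 1 else 0) + (if z i \<le> - (b i * x i) then 1 else 0 :: real))"
        using True by (intro prod_mono) (auto simp: abs_if split: if_splits)
      finally show ?thesis using True sum_signs_indicator_orthant[OF A x, of b z] by simp
    qed (simp add: sum_nonneg)
  qed (auto intro!: integral_signs_average(1) A integrable_indicator_event)
  also have "\<dots> = 2 ^ card A * expectation (indicator (orthant A b z))"
    by (intro integral_signs_average(2) A integrable_indicator_event) auto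
  finally show "prob ?E \<le> 2 ^ card A * prob (orthant A b z)" by simp
  assume z: "\<And>i. i \<in> A \<Longrightarrow> z i > 0" and g: "integrable \<mu> (g :: _ \<Rightarrow> real)"
    and even: "\<And>\<sigma> x. \<sigma> \<in> signs A \<Longrightarrow> x \<in> space \<mu> \<Longrightarrow> g (flip (extend_sign A \<sigma>) x) = g x"
  have "expectation (\<lambda>x. indicator ?E x * g x)
    = expectation (\<lambda>x. \<Sum>\<sigma>\<in>signs A. indicator (orthant A b z) (flip (extend_sign A \<sigma>) x) * g (flip (extend_sign A \<sigma>) x))"
  proof (rule Bochner_Integration.integral_cong[OF refl])
    fix x assume x: "x \<in> space \<mu>"
    have "(\<Sum>\<sigma>\<in>signs A. indicator (orthant A b z) (flip (extend_sign A \<sigma>) x) * g (flip (extend_sign A \<sigma>) x))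
       = (\<Prod>i\<in>A. (if z i \<le> b i * x i then 1 else 0) + (if z i \<le> - (b i * x i) then 1 else 0 :: real)) * g x"
      using even x sum_signs_indicator_orthant[OF A x, of b z] by (simp flip: sum_distrib_right)
    also have "(\<Prod>i\<in>A. (if z i \<le> b i * x i then 1 else 0) + (if z i \<le> - (b i * x i) then 1 else 0 :: real))
       = (\<Prod>i\<in>A. if z i \<le> \<bar>b i * x i\<bar> then 1 else 0)"
      using z by (intro prod.cong refl) (fastforce simp: abs_if)
    also have "\<dots> = indicator ?E x" using fin x by (auto simp: indicator_def prod_zero_iff)
    finally show "indicator ?E x * g x = (\<Sum>\<sigma>\<in>signs A. indicator (orthant A b z) (flip (extend_sign A \<sigma>) x) * g (flip (extend_sign A \<sigma>) x))"
      by simp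
  qed
  also have "\<dots> = 2 ^ card A * expectation (\<lambda>x. indicator (orthant A b z) x * g x)"
    using g by (intro integral_signs_average(2)[of A "\<lambda>x. indicator (orthant A b z) x * g x"] A)
      (auto intro: integrable_real_mult_indicator simp: mult.commute)
  finally show "expectation (\<lambda>x. indicator ?E x * g x) = 2 ^ card A * expectation (\<lambda>x. indicator (orthant A b z) x * g x)" .
qed

end

section \<open>Negative association\<close>

locale na_law = uncond_lc_law +
  assumes na: "negatively_associated \<mu> d (\<lambda>x i. \<bar>x i\<bar>)"
begin

lemma na_test:
  assumes "I \<subseteq> {..<d}" "J \<subseteq> {..<d}" "I \<inter> J = {}" "NA_test_function I f" "NA_test_function J g"
  shows "expectation (\<lambda>x. f (\<lambda>i\<in>I. \<bar>x i\<bar>) * g (\<lambda>i\<in>J. \<bar>x i\<bar>))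
     \<le> expectation (\<lambda>x. f (\<lambda>i\<in>I. \<bar>x i\<bar>)) * expectation (\<lambda>x. g (\<lambda>i\<in>J. \<bar>x i\<bar>))"
  using na assms by (simp add: negatively_associated_def restrict_def)

text \<open>Negative association is applied to one coordinate against the others, inductively. Test
  functions must be monotone on all reals, hence the composition with max 0.\<close>

lemma na_prod_le:
  fixes f :: "nat \<Rightarrow> real \<Rightarrow> real"
  assumes "finite I" "I \<subseteq> {..<d}"
    and meas [measurable]: "\<And>i. f i \<in> borel_measurable borel"
    and mono: "\<And>i r s. 0 \<le> r \<Longrightarrow> r \<le> s \<Longrightarrow> f i r \<le> f i s"
    and bnd: "\<And>i r. i < d \<Longrightarrow> 0 \<le> f i r \<and> f i r \<le> C"
  shows "expectation (\<lambda>x. \<Prod>i\<in>I. f i \<bar>x i\<bar>) \<le> (\<Prod>i\<in>I. expectation (\<lambda>x. f i \<bar>x i\<bar>))"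
  using assms(1,2)
proof induct
  case empty
  then show ?case by (simp add: prob_space)
next
  case (insert j I)
  define h where "h = (\<lambda>i r. f i (max 0 r))"
  have hm: "h i r \<le> h i s" if "r \<le> s" for i r s using that by (auto simp: h_def intro!: mono)
  have hb: "0 \<le> h i r" "h i r \<le> C" if "i < d" for i r using bnd that by (auto simp: h_def)
  have [measurable]: "h i \<in> borel_measurable borel" for i unfolding h_def by measurable
  have test: "NA_test_function K (\<lambda>z. \<Prod>i\<in>K. h i (z i))" if "K \<subseteq> {..<d}" for K
    unfolding NA_test_function_def
  proof (intro conjI ballI impI exI[of _ "C ^ card K"])
    show "(\<lambda>z. \<Prod>i\<in>K. h i (z i)) \<in> borel_measurable (Pi\<^sub>M K (\<lambda>_. borel))"
      by (rule borel_measurable_prod) measurable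
    show "\<bar>\<Prod>i\<in>K. h i (z i)\<bar> \<le> C ^ card K" for z
      using prod_mono[of K "\<lambda>i. h i (z i)" "\<lambda>_. C"] hb \<open>K \<subseteq> {..<d}\<close> by (simp add: prod_nonneg subset_iff)
    show "(\<Prod>i\<in>K. h i (x i)) \<le> (\<Prod>i\<in>K. h i (y i))" if "\<forall>i\<in>K. x i \<le> y i" for x y
      using that hb hm \<open>K \<subseteq> {..<d}\<close> by (intro prod_mono) auto
  qed
  have "expectation (\<lambda>x. \<Prod>i\<in>insert j I. f i \<bar>x i\<bar>)
     = expectation (\<lambda>x. (\<Prod>i\<in>{j}. h i ((\<lambda>i\<in>{j}. \<bar>x i\<bar>) i)) * (\<Prod>i\<in>I. h i ((\<lambda>i\<in>I. \<bar>x i\<bar>) i)))"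
    using insert by (simp add: h_def)
  also have "\<dots> \<le> expectation (\<lambda>x. \<Prod>i\<in>{j}. h i ((\<lambda>i\<in>{j}. \<bar>x i\<bar>) i)) * expectation (\<lambda>x. \<Prod>i\<in>I. h i ((\<lambda>i\<in>I. \<bar>x i\<bar>) i))"
    using insert by (intro na_test test) auto
  also have "\<dots> = expectation (\<lambda>x. f j \<bar>x j\<bar>) * expectation (\<lambda>x. \<Prod>i\<in>I. f i \<bar>x i\<bar>)"
    by (simp add: h_def)
  also have "\<dots> \<le> expectation (\<lambda>x. f j \<bar>x j\<bar>) * (\<Prod>i\<in>I. expectation (\<lambda>x. f i \<bar>x i\<bar>))"
    using insert bnd by (intro mult_left_mono insert(3) integral_nonneg_AE) auto
  finally show ?case using insert by simp
qed

text \<open>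
  Negative association enters here: forcing the coordinates in \<open>D\<close> to be large makes the
  magnitudes of the other coordinates stochastically smaller.
\<close>

lemma orthant_noise_le:
  fixes a :: "'t \<Rightarrow> nat \<Rightarrow> real"
  assumes D: "D \<subseteq> {..<d}" and y: "\<And>i. i \<in> D \<Longrightarrow> y i > 0" and T: "finite T" "T \<noteq> {}"
  defines "J \<equiv> {..<d} - D"
  shows "expectation (\<lambda>x. indicator (orthant D b y) x * (MAX t\<in>T. \<Sum>i\<in>J. a t i * x i))
    \<le> prob (orthant D b y) * expectation (\<lambda>x. MAX t\<in>T. \<Sum>i<d. a t i * x i)"
proof -
  have fin: "finite D" "finite J" using D finite_subset by (auto simp: J_def)
  have J: "J \<subseteq> {..<d}" by (auto simp: J_def)
  let ?F = "orthant D b y"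
  let ?E = "{x \<in> space \<mu>. \<forall>i\<in>D. y i \<le> \<bar>b i * x i\<bar>}"
  have F [measurable]: "?F \<in> sets \<mu>" by (rule sets_orthant[OF D])
  define M where "M = (\<lambda>x. MAX t\<in>T. \<Sum>i\<in>J. a t i * x i)"
  have intM: "integrable \<mu> M" unfolding M_def by (rule integrable_Max_linear[OF T J])
  define n where "n = (2::real) ^ card J"
  have n0: "n > 0" by (simp add: n_def)
  \<comment> \<open>The maximum with the signs on J averaged out, as a function of the magnitudes.
    By contraction it is nondecreasing, so its truncations are test functions.\<close>
  define G where "G = (\<lambda>z. (\<Sum>\<tau>\<in>signs J. MAX t\<in>T. \<Sum>i\<in>J. a t i * max 0 (z i) * \<tau> i) / n)"
  define g where "g = (\<lambda>x. G (\<lambda>i\<in>J. \<bar>x i\<bar>))"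
  have g_eq: "g x = (\<Sum>\<tau>\<in>signs J. MAX t\<in>T. \<Sum>i\<in>J. a t i * \<bar>x i\<bar> * \<tau> i) / n" for x
    by (simp add: g_def G_def max_def)
  have intg: "integrable \<mu> g"
    unfolding g_eq[abs_def] by (intro Bochner_Integration.integrable_divide Bochner_Integration.integrable_sum integrable_Max_abs[OF T J])
  have G0: "0 \<le> G z" for z
  proof -
    obtain t0 where t0: "t0 \<in> T" using T by auto
    have "0 = (\<Sum>\<tau>\<in>signs J. \<Sum>i\<in>J. a t0 i * max 0 (z i) * \<tau> i)" by (rule sum_signs_linear[OF fin(2), symmetric])
    also have "\<dots> \<le> (\<Sum>\<tau>\<in>signs J. MAX t\<in>T. \<Sum>i\<in>J. a t i * max 0 (z i) * \<tau> i)"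
      using t0 T by (intro sum_mono Max_ge) auto
    finally show ?thesis using n0 by (simp add: G_def)
  qed
  have Gmono: "G w \<le> G z" if "\<forall>i\<in>J. w i \<le> z i" for w z
  proof -
    have "(\<Sum>\<tau>\<in>signs J. MAX t\<in>T. 0 + (\<Sum>i\<in>J. a t i * max 0 (w i) * \<tau> i)) \<le> (\<Sum>\<tau>\<in>signs J. MAX t\<in>T. 0 + (\<Sum>i\<in>J. a t i * max 0 (z i) * \<tau> i))"
      using that by (intro signs_contraction fin T) (auto simp: abs_mult mult_left_mono simp flip: left_diff_distrib)
    then show ?thesis using n0 by (simp add: G_def divide_right_mono)
  qed
  have Gmeas: "G \<in> borel_measurable (Pi\<^sub>M J (\<lambda>_. borel))"
    unfolding G_def using T fin
    by (intro borel_measurable_divide borel_measurable_const borel_measurable_sum borel_measurable_Max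
        borel_measurable_times borel_measurable_max measurable_component_singleton) auto
  have F_J: "indicator ?F (flip (extend_sign J \<tau>) x) = (indicator ?F x :: real)" if "x \<in> space \<mu>" for \<tau> x
    using that D by (auto simp: orthant_def J_def flip_space flip_apply extend_sign_def subset_iff indicator_def)
  have M_J: "M (flip (extend_sign J \<tau>) x) = (MAX t\<in>T. \<Sum>i\<in>J. a t i * x i * \<tau> i)" for \<tau> x
    unfolding M_def using J by (simp add: flip_extend_sum)
  have absM: "(\<Sum>\<tau>\<in>signs J. MAX t\<in>T. 0 + (\<Sum>i\<in>J. a t i * x i * \<tau> i)) = n * g x" for x
    unfolding g_eq
  proof (rule antisym)
    have "(\<Sum>\<tau>\<in>signs J. MAX t\<in>T. 0 + (\<Sum>i\<in>J. a t i * x i * \<tau> i)) \<le> (\<Sum>\<tau>\<in>signs J. MAX t\<in>T. 0 + (\<Sum>i\<in>J. a t i * \<bar>x i\<bar> * \<tau> i))"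
      by (intro signs_contraction fin T) (auto simp: abs_mult simp flip: left_diff_distrib)
    then show "(\<Sum>\<tau>\<in>signs J. MAX t\<in>T. 0 + (\<Sum>i\<in>J. a t i * x i * \<tau> i)) \<le> n * ((\<Sum>\<tau>\<in>signs J. MAX t\<in>T. \<Sum>i\<in>J. a t i * \<bar>x i\<bar> * \<tau> i) / n)"
      using n0 by simp
    have "(\<Sum>\<tau>\<in>signs J. MAX t\<in>T. 0 + (\<Sum>i\<in>J. a t i * \<bar>x i\<bar> * \<tau> i)) \<le> (\<Sum>\<tau>\<in>signs J. MAX t\<in>T. 0 + (\<Sum>i\<in>J. a t i * x i * \<tau> i))"
      by (intro signs_contraction fin T) (auto simp: abs_mult simp flip: left_diff_distrib)
    then show "n * ((\<Sum>\<tau>\<in>signs J. MAX t\<in>T. \<Sum>i\<in>J. a t i * \<bar>x i\<bar> * \<tau> i) / n) \<le> (\<Sum>\<tau>\<in>signs J. MAX t\<in>T. 0 + (\<Sum>i\<in>J. a t i * x i * \<tau> i))"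
      using n0 by simp
  qed
  have intFM: "integrable \<mu> (\<lambda>x. indicator ?F x * M x)" and intFg: "integrable \<mu> (\<lambda>x. indicator ?F x * g x)"
    using intM intg by (auto intro: integrable_real_mult_indicator simp: mult.commute)
  have "n * expectation (\<lambda>x. indicator ?F x * M x)
    = expectation (\<lambda>x. \<Sum>\<tau>\<in>signs J. indicator ?F (flip (extend_sign J \<tau>) x) * M (flip (extend_sign J \<tau>) x))"
    unfolding n_def by (rule integral_signs_average(2)[OF J intFM, symmetric])
  also have "\<dots> = expectation (\<lambda>x. n * (indicator ?F x * g x))"
    using absM by (intro Bochner_Integration.integral_cong refl)
      (simp add: F_J M_J algebra_simps flip: sum_distrib_left)
  finally have FM: "expectation (\<lambda>x. indicator ?F x * M x) = expectation (\<lambda>x. indicator ?F x * g x)" using n0 by simp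
  have "n * expectation M = expectation (\<lambda>x. \<Sum>\<tau>\<in>signs J. M (flip (extend_sign J \<tau>) x))"
    unfolding n_def by (rule integral_signs_average(2)[OF J intM, symmetric])
  also have "\<dots> = expectation (\<lambda>x. n * g x)"
    using absM by (intro Bochner_Integration.integral_cong refl) (simp add: M_J)
  finally have Eg: "expectation g = expectation M" using n0 by simp
  have EM: "expectation M \<le> expectation (\<lambda>x. MAX t\<in>T. \<Sum>i<d. a t i * x i)"
  proof -
    \<comment> \<open>Deleting the coordinates in D is a contraction of the coefficients.\<close>
    have M_eq: "M = (\<lambda>x. MAX t\<in>T. \<Sum>i<d. (if i \<in> J then a t i else 0) * x i)"
    proof
      fix x
      have "(\<Sum>i\<in>J. a t i * x i) = (\<Sum>i<d. (if i \<in> J then a t i else 0) * x i)" for t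
        using J by (intro sum.mono_neutral_cong_left) auto
      then show "M x = (MAX t\<in>T. \<Sum>i<d. (if i \<in> J then a t i else 0) * x i)" by (simp add: M_def)
    qed
    show ?thesis unfolding M_eq by (intro expectation_contraction T) auto
  qed
  have even: "g (flip (extend_sign D \<sigma>) x) = g x" for \<sigma> x
  proof -
    have "(\<lambda>i\<in>J. \<bar>flip (extend_sign D \<sigma>) x i\<bar>) = (\<lambda>i\<in>J. \<bar>x i\<bar>)"
      using J by (intro restrict_ext) (auto simp: J_def flip_apply extend_sign_def)
    then show ?thesis by (simp add: g_def)
  qed
  have E_sets [measurable]: "?E \<in> sets \<mu>"
    by (rule sets_abs_ge[OF D])
  have E_F: "prob ?E = 2 ^ card D * prob ?F"
    using expectation_orthant_even[OF D, of y "\<lambda>_. 1" b] y by simp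
  \<comment> \<open>Test functions are bounded, so g is cut at k; dominated convergence removes the
    cut.\<close>
  have trunc: "expectation (\<lambda>x. indicator ?E x * min (real k) (g x)) \<le> prob ?E * expectation g" for k
  proof -
    define f where "f = (\<lambda>z. if \<forall>i\<in>D. y i \<le> \<bar>b i\<bar> * z i then 1 else 0 :: real)"
    have "NA_test_function D f"
      unfolding NA_test_function_def
    proof (intro conjI ballI impI exI[of _ 1])
      show "f \<in> borel_measurable (Pi\<^sub>M D (\<lambda>_. borel))"
      proof -
        have "(\<lambda>z. \<Prod>i\<in>D. if y i \<le> \<bar>b i\<bar> * z i then 1 else 0 :: real) \<in> borel_measurable (Pi\<^sub>M D (\<lambda>_. borel))"
          by (intro borel_measurable_prod) measurable
        also have "(\<lambda>z. \<Prod>i\<in>D. if y i \<le> \<bar>b i\<bar> * z i then 1 else 0 :: real) = f"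
          using fin by (auto simp: f_def fun_eq_iff prod_zero_iff)
        finally show ?thesis .
      qed
      fix w z :: "nat \<Rightarrow> real" assume "\<forall>i\<in>D. w i \<le> z i"
      then have "\<bar>b i\<bar> * w i \<le> \<bar>b i\<bar> * z i" if "i \<in> D" for i using that by (intro mult_left_mono) auto
      then show "f w \<le> f z" by (force simp: f_def intro: order_trans)
    qed (simp add: f_def)
    moreover have "NA_test_function J (\<lambda>z. min (real k) (G z))"
      unfolding NA_test_function_def
    proof (intro conjI ballI impI exI[of _ "real k"])
      show "(\<lambda>z. min (real k) (G z)) \<in> borel_measurable (Pi\<^sub>M J (\<lambda>_. borel))" using Gmeas by measurable
      show "\<bar>min (real k) (G z)\<bar> \<le> real k" for z using G0[of z] by simp
      show "min (real k) (G w) \<le> min (real k) (G z)" if "\<forall>i\<in>J. w i \<le> z i" for w z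
        using Gmono[OF that] by simp
    qed
    ultimately have "expectation (\<lambda>x. f (\<lambda>i\<in>D. \<bar>x i\<bar>) * min (real k) (G (\<lambda>i\<in>J. \<bar>x i\<bar>)))
       \<le> expectation (\<lambda>x. f (\<lambda>i\<in>D. \<bar>x i\<bar>)) * expectation (\<lambda>x. min (real k) (G (\<lambda>i\<in>J. \<bar>x i\<bar>)))"
      using D J by (intro na_test) (auto simp: J_def)
    also have "expectation (\<lambda>x. f (\<lambda>i\<in>D. \<bar>x i\<bar>)) = expectation (indicator ?E)"
      by (intro Bochner_Integration.integral_cong refl) (auto simp: f_def abs_mult indicator_def)
    also have "\<dots> = prob ?E" by simp
    also have "expectation (\<lambda>x. f (\<lambda>i\<in>D. \<bar>x i\<bar>) * min (real k) (G (\<lambda>i\<in>J. \<bar>x i\<bar>))) = expectation (\<lambda>x. indicator ?E x * min (real k) (g x))"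
      by (intro Bochner_Integration.integral_cong refl) (auto simp: f_def g_def abs_mult indicator_def)
    also have "prob ?E * expectation (\<lambda>x. min (real k) (G (\<lambda>i\<in>J. \<bar>x i\<bar>))) \<le> prob ?E * expectation g"
    proof (intro mult_left_mono integral_mono intg)
      show "integrable \<mu> (\<lambda>x. min (real k) (G (\<lambda>i\<in>J. \<bar>x i\<bar>)))"
        using intg by (auto simp: g_def[symmetric])
    qed (auto simp: g_def)
    finally show ?thesis .
  qed
  have "(\<lambda>k. expectation (\<lambda>x. indicator ?E x * min (real k) (g x))) \<longlonglongrightarrow> expectation (\<lambda>x. indicator ?E x * g x)"
  proof (rule integral_dominated_convergence[where w = g])
    show "AE x in \<mu>. (\<lambda>k. indicator ?E x * min (real k) (g x)) \<longlonglongrightarrow> indicator ?E x * g x"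
    proof (rule AE_I2)
      fix x
      obtain k0 where k0: "g x \<le> real k0" using real_arch_simple by blast
      have "\<forall>\<^sub>F k in sequentially. indicator ?E x * g x = indicator ?E x * min (real k) (g x)"
        using k0 by (intro eventually_sequentiallyI[of k0]) (auto simp: min_def)
      then show "(\<lambda>k. indicator ?E x * min (real k) (g x)) \<longlonglongrightarrow> indicator ?E x * g x"
        by (rule Lim_transform_eventually[OF tendsto_const])
    qed
    show "AE x in \<mu>. norm (indicator ?E x * min (real k) (g x)) \<le> g x" for k
      using G0 by (intro AE_I2) (auto simp: g_def indicator_def)
    have [measurable]: "g \<in> borel_measurable \<mu>" using intg by simp
    show "(\<lambda>x. indicator ?E x * g x) \<in> borel_measurable \<mu>" by measurable
    show "(\<lambda>x. indicator ?E x * min (real k) (g x)) \<in> borel_measurable \<mu>" for k by measurable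
  qed (rule intg)
  then have "expectation (\<lambda>x. indicator ?E x * g x) \<le> prob ?E * expectation g"
    using trunc by (intro LIMSEQ_le_const2) auto
  then have "2 ^ card D * expectation (\<lambda>x. indicator ?F x * g x) \<le> 2 ^ card D * prob ?F * expectation g"
    using expectation_orthant_even[OF D, of y g b] y intg even E_F by simp
  then have "expectation (\<lambda>x. indicator ?F x * g x) \<le> prob ?F * expectation g" by simp
  also have "\<dots> \<le> prob ?F * expectation (\<lambda>x. MAX t\<in>T. \<Sum>i<d. a t i * x i)"
    using Eg EM by (intro mult_left_mono) auto
  finally show ?thesis using FM by (simp add: M_def)
qed

end

section \<open>Likely cells under a large moment\<close>

text \<open>A crude form of the binomial count of compositions: fixing one entry leaves a geometric
  sum. The pigeonhole needs only a bound that is exponential in m + card D.\<close>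

lemma card_sum_le:
  assumes "finite D"
  shows "finite {k \<in> PiE D (\<lambda>_. UNIV :: nat set). sum k D = m} \<and>
    card {k \<in> PiE D (\<lambda>_. UNIV :: nat set). sum k D = m} \<le> 2 ^ (m + card D)"
  using assms
proof (induct arbitrary: m)
  case empty
  have "{k \<in> PiE {} (\<lambda>_. UNIV :: nat set). sum k {} = m} = (if m = 0 then {\<lambda>_. undefined} else {})"
    by auto
  then show ?case by (cases "m = 0") simp_all
next
  case (insert j D)
  define K where "K = (\<lambda>m. {k \<in> PiE D (\<lambda>_. UNIV :: nat set). sum k D = m})"
  have K: "finite (K m)" "card (K m) \<le> 2 ^ (m + card D)" for m using insert(3) by (auto simp: K_def)
  have sub: "{k \<in> PiE (insert j D) (\<lambda>_. UNIV :: nat set). sum k (insert j D) = m} \<subseteq> (\<Union>l\<le>m. (\<lambda>k. k(j := l)) ` K (m - l))"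
  proof
    fix k assume k: "k \<in> {k \<in> PiE (insert j D) (\<lambda>_. UNIV :: nat set). sum k (insert j D) = m}"
    define k' where "k' = k(j := undefined)"
    have "sum k' D = sum k D" using insert by (intro sum.cong) (auto simp: k'_def)
    then have "k' \<in> K (m - k j)" using k insert by (auto simp: K_def k'_def PiE_iff extensional_def)
    moreover have "k = k'(j := k j)" by (simp add: k'_def)
    moreover have "k j \<le> m" using k insert by auto
    ultimately show "k \<in> (\<Union>l\<le>m. (\<lambda>k. k(j := l)) ` K (m - l))" by blast
  qed
  have fin: "finite (\<Union>l\<le>m. (\<lambda>k. k(j := l)) ` K (m - l))" using K by auto
  have "card (\<Union>l\<le>m. (\<lambda>k. k(j := l)) ` K (m - l)) \<le> (\<Sum>l\<le>m. card ((\<lambda>k. k(j := l)) ` K (m - l)))"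
    by (rule card_UN_le) simp
  also have "\<dots> \<le> (\<Sum>l\<le>m. 2 ^ (m - l + card D))"
    by (intro sum_mono order_trans[OF card_image_le[OF K(1)] K(2)])
  also have "\<dots> = (\<Sum>l\<le>m. 2 ^ (l + card D))"
    by (rule sum.reindex_bij_witness[of _ "\<lambda>l. m - l" "\<lambda>l. m - l"]) auto
  also have "\<dots> = (\<Sum>l\<le>m. 2 ^ l) * 2 ^ card D" by (simp add: power_add sum_distrib_right)
  also have "(\<Sum>l\<le>m. 2 ^ l) \<le> (2 ^ Suc m :: nat)" by (induct m) auto
  finally have "card (\<Union>l\<le>m. (\<lambda>k. k(j := l)) ` K (m - l)) \<le> 2 ^ (m + card (insert j D))"
    using insert by (simp add: power_add)
  then show ?case using sub fin by (meson card_mono finite_subset order_trans)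
qed

text \<open>
  Pigeonhole over unit cells: there are at most \<open>2 ^ (m + card D)\<close> cells at level \<open>m\<close>, so a
  large moment forces some cell to have probability exponential in its level.
\<close>

lemma (in prob_space) exists_likely_cell:
  fixes Y :: "'i \<Rightarrow> 'a \<Rightarrow> real"
  assumes D: "finite D" and meas [measurable]: "\<And>i. i \<in> D \<Longrightarrow> Y i \<in> borel_measurable M"
    and Y0: "\<And>i x. i \<in> D \<Longrightarrow> 0 \<le> Y i x" and P: "P \<ge> 1" "real (card D) \<le> P"
    and moment: "expectation (\<lambda>x. (\<Sum>i\<in>D. Y i x) powr P) \<ge> (4 * P) powr P"
  obtains k :: "'i \<Rightarrow> nat" where "real (sum k D) \<ge> P"
    "prob {x \<in> space M. \<forall>i\<in>D. real (k i) \<le> Y i x} \<ge> exp (- 5 * real (sum k D))"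
proof (rule ccontr)
  note found = that
  assume "\<not> thesis"
  then have no: "prob {x \<in> space M. \<forall>i\<in>D. real (k i) \<le> Y i x} \<le> exp (- 5 * real (sum k D))"
    if "real (sum k D) \<ge> P" for k
    using found[OF that] by force
  define w where "w = (\<lambda>x. \<Sum>i\<in>D. nat \<lfloor>Y i x\<rfloor>)"
  define E where "E = (\<lambda>m. {x \<in> space M. w x = m})"
  define c where "c = (\<lambda>m::nat. (real m + card D) powr P)"
  have wm [measurable]: "w \<in> measurable M (count_space UNIV)" unfolding w_def by measurable
  have [measurable]: "E m \<in> sets M" for m unfolding E_def by measurable
  have pt: "ennreal ((\<Sum>i\<in>D. Y i x) powr P) \<le> (\<Sum>m. ennreal (c m) * indicator (E m) x)" if x: "x \<in> space M" for x
  proof -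
    define f where "f = (\<lambda>m. ennreal (c m) * indicator (E m) x)"
    have "(\<Sum>i\<in>D. Y i x) \<le> (\<Sum>i\<in>D. real (nat \<lfloor>Y i x\<rfloor>) + 1)"
    proof (intro sum_mono)
      fix i assume "i \<in> D"
      then show "Y i x \<le> real (nat \<lfloor>Y i x\<rfloor>) + 1" using Y0[of i x] by linarith
    qed
    also have "\<dots> = real (w x) + card D" by (simp add: w_def sum.distrib)
    finally have "(\<Sum>i\<in>D. Y i x) powr P \<le> c (w x)"
      unfolding c_def using P Y0 by (intro powr_mono2) (auto intro: sum_nonneg)
    then have "ennreal ((\<Sum>i\<in>D. Y i x) powr P) \<le> f (w x)" using x by (simp add: f_def E_def ennreal_leI)
    also have "\<dots> \<le> suminf f" using sum_le_suminf[of f "{w x}"] by (simp add: summableI)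
    finally show ?thesis by (simp add: f_def)
  qed
  have probE: "prob (E m) \<le> 2 ^ (m + card D) * exp (- 5 * real m)" if m: "real m \<ge> P" for m
  proof -
    define K where "K = {k \<in> PiE D (\<lambda>_. UNIV :: nat set). sum k D = m}"
    define H where "H = (\<lambda>k::'i \<Rightarrow> nat. {x \<in> space M. \<forall>i\<in>D. real (k i) \<le> Y i x})"
    have K: "finite K" "card K \<le> 2 ^ (m + card D)" using card_sum_le[OF D, of m] by (auto simp: K_def)
    have Hs: "H k \<in> sets M" for k
      unfolding H_def by (intro sets.sets_Collect_finite_All D) measurable
    have "E m \<subseteq> (\<Union>k\<in>K. H k)"
    proof
      fix x assume x: "x \<in> E m"
      define k where "k = (\<lambda>i\<in>D. nat \<lfloor>Y i x\<rfloor>)"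
      have "k \<in> K" using x by (auto simp: k_def K_def E_def w_def)
      moreover have "x \<in> H k" using x Y0 by (auto simp: H_def k_def E_def)
      ultimately show "x \<in> (\<Union>k\<in>K. H k)" by auto
    qed
    then have "prob (E m) \<le> prob (\<Union>k\<in>K. H k)" using K Hs by (intro finite_measure_mono) auto
    also have "\<dots> \<le> (\<Sum>k\<in>K. prob (H k))" using K Hs by (intro measure_UNION_le) auto
    also have "\<dots> \<le> (\<Sum>k\<in>K. exp (- 5 * real m))"
    proof (intro sum_mono)
      fix k assume "k \<in> K"
      then have "sum k D = m" by (simp add: K_def)
      then show "prob (H k) \<le> exp (- 5 * real m)" using no[of k] m unfolding H_def by simp
    qed
    also have "\<dots> = real (card K) * exp (- 5 * real m)" by simp
    also have "\<dots> \<le> 2 ^ (m + card D) * exp (- 5 * real m)"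
    proof -
      have "real (card K) \<le> real (2 ^ (m + card D))" using K(2) by (subst of_nat_le_iff)
      then show ?thesis by (intro mult_right_mono) auto
    qed
    finally show ?thesis .
  qed
  \<comment> \<open>Below P the trivial bound suffices. From P on, the power costs exp (2 m) and the
    number of cells exp (2 m), which exp (- 5 m) beats with exp (- m) to spare.\<close>
  have level: "c m * prob (E m) \<le> (2 * P) powr P * prob (E m) + P powr P * exp (- real m)" for m
  proof (cases "real m < P")
    case True
    then have "c m \<le> (2 * P) powr P" unfolding c_def using P by (intro powr_mono2) auto
    then have "c m * prob (E m) \<le> (2 * P) powr P * prob (E m)" by (intro mult_right_mono) auto
    then show ?thesis by (simp add: add_increasing2)
  next
    case False
    have "c m \<le> (2 * real m) powr P" unfolding c_def using P False by (intro powr_mono2) auto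
    also have "\<dots> \<le> P powr P * exp (2 * real m)" using P by (intro powr_le_exp) auto
    finally have c: "c m \<le> P powr P * exp (2 * real m)" .
    have "(2::real) ^ (m + card D) \<le> 2 ^ (2 * m)"
      using P False by (intro power_increasing) auto
    also have "\<dots> \<le> exp 1 ^ (2 * m)" using exp_ge_add_one_self[of 1] by (intro power_mono) auto
    also have "\<dots> = exp (2 * real m)" by (simp flip: exp_of_nat_mult)
    finally have "2 ^ (m + card D) * exp (- 5 * real m) \<le> exp (2 * real m) * exp (- 5 * real m)" by simp
    also have "\<dots> = exp (- 3 * real m)" by (simp flip: exp_add)
    finally have pE: "prob (E m) \<le> exp (- 3 * real m)" using probE[of m] False by linarith
    have "c m * prob (E m) \<le> (P powr P * exp (2 * real m)) * exp (- 3 * real m)"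
      using c pE by (intro mult_mono) (auto simp: c_def)
    also have "\<dots> = P powr P * exp (- real m)" by (simp add: mult.assoc flip: exp_add)
    finally show ?thesis by (simp add: add_increasing)
  qed
  have sumE: "(\<Sum>m. ennreal (prob (E m))) \<le> 1"
  proof -
    have "(\<Sum>m. emeasure M (E m)) = emeasure M (\<Union>m. E m)"
      by (intro suminf_emeasure) (auto simp: disjoint_family_on_def E_def)
    also have "\<dots> \<le> 1" by (rule measure_le_1)
    finally show ?thesis by (simp add: emeasure_eq_measure)
  qed
  have geo: "(\<Sum>m. exp (- real m)) = 1 / (1 - exp (-1 :: real))" "summable (\<lambda>m. exp (- real m))"
  proof -
    have e: "(\<lambda>m. exp (- real m)) = (\<lambda>m. exp (-1) ^ m)" by (simp flip: exp_of_nat_mult)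
    show "(\<Sum>m. exp (- real m)) = 1 / (1 - exp (-1 :: real))" "summable (\<lambda>m. exp (- real m))"
      unfolding e by (auto simp: suminf_geometric)
  qed
  have geo2: "1 / (1 - exp (-1 :: real)) < 2"
  proof -
    have "exp (-1 :: real) < 1/2"
      using exp_lower_Taylor_quadratic[of 1] by (simp add: exp_minus field_simps)
    then show ?thesis by (simp add: field_simps)
  qed
  have "(\<integral>\<^sup>+x. ennreal ((\<Sum>i\<in>D. Y i x) powr P) \<partial>M) \<le> (\<integral>\<^sup>+x. (\<Sum>m. ennreal (c m) * indicator (E m) x) \<partial>M)"
    by (intro nn_integral_mono pt)
  also have "\<dots> = (\<Sum>m. \<integral>\<^sup>+x. ennreal (c m) * indicator (E m) x \<partial>M)"
    by (intro nn_integral_suminf) auto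
  also have "\<dots> = (\<Sum>m. ennreal (c m * prob (E m)))"
    by (simp add: nn_integral_cmult_indicator emeasure_eq_measure ennreal_mult c_def)
  also have "\<dots> \<le> (\<Sum>m. ennreal ((2 * P) powr P) * ennreal (prob (E m)) + ennreal (P powr P * exp (- real m)))"
  proof (intro suminf_le summableI)
    fix m
    have "ennreal (c m * prob (E m)) \<le> ennreal ((2 * P) powr P * prob (E m) + P powr P * exp (- real m))"
      using level by (intro ennreal_leI)
    then show "ennreal (c m * prob (E m)) \<le> ennreal ((2 * P) powr P) * ennreal (prob (E m)) + ennreal (P powr P * exp (- real m))"
      by (simp add: ennreal_mult ennreal_plus)
  qed
  also have "\<dots> = ennreal ((2 * P) powr P) * (\<Sum>m. ennreal (prob (E m))) + (\<Sum>m. ennreal (P powr P * exp (- real m)))"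
    by (simp add: suminf_add summableI flip: ennreal_suminf_cmult)
  also have "\<dots> \<le> ennreal ((2 * P) powr P) * 1 + ennreal (P powr P * (1 / (1 - exp (-1))))"
  proof (intro add_mono mult_left_mono sumE)
    have "(\<Sum>m. ennreal (P powr P * exp (- real m))) = ennreal (\<Sum>m. P powr P * exp (- real m))"
      using geo by (intro suminf_ennreal2) (auto intro: summable_mult)
    then show "(\<Sum>m. ennreal (P powr P * exp (- real m))) \<le> ennreal (P powr P * (1 / (1 - exp (-1))))"
      using geo by (simp add: suminf_mult)
  qed simp
  also have "\<dots> = ennreal ((2 * P) powr P + P powr P * (1 / (1 - exp (-1))))"
    by (simp add: ennreal_plus)
  finally have le: "(\<integral>\<^sup>+x. ennreal ((\<Sum>i\<in>D. Y i x) powr P) \<partial>M) \<le> ennreal ((2 * P) powr P + P powr P * (1 / (1 - exp (-1))))" .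
  then have int: "integrable M (\<lambda>x. (\<Sum>i\<in>D. Y i x) powr P)"
  proof (intro integrableI_nonneg)
    have [measurable]: "(\<lambda>x. \<Sum>i\<in>D. Y i x) \<in> borel_measurable M" by (intro borel_measurable_sum meas)
    show "(\<lambda>x. (\<Sum>i\<in>D. Y i x) powr P) \<in> borel_measurable M" by measurable
  qed (auto simp: le_less_trans)
  have "expectation (\<lambda>x. (\<Sum>i\<in>D. Y i x) powr P) \<le> (2 * P) powr P + P powr P * (1 / (1 - exp (-1)))"
  proof -
    have "ennreal (expectation (\<lambda>x. (\<Sum>i\<in>D. Y i x) powr P)) = (\<integral>\<^sup>+x. ennreal ((\<Sum>i\<in>D. Y i x) powr P) \<partial>M)"
      by (rule nn_integral_eq_integral[OF int, symmetric]) simp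
    then have "ennreal (expectation (\<lambda>x. (\<Sum>i\<in>D. Y i x) powr P)) \<le> ennreal ((2 * P) powr P + P powr P * (1 / (1 - exp (-1))))"
      using le by (simp only:)
    moreover have "0 \<le> (2 * P) powr P + P powr P * (1 / (1 - exp (-1)))" by (intro add_nonneg_nonneg mult_nonneg_nonneg) auto
    ultimately show ?thesis by (subst (asm) ennreal_le_iff)
  qed
  \<comment> \<open>The levels below P give (2 P) powr P and the others less than twice P powr P; P
    \<ge> 1 lets powers of 2 absorb the constants, up to (4 P) powr P.\<close>
  also have "\<dots> < (2 * P) powr P + P powr P * 2"
    using geo2 P by (intro add_strict_left_mono mult_strict_left_mono) auto
  also have "P powr P * 2 \<le> P powr P * 2 powr P" using P powr_mono[of 1 P 2] by (intro mult_left_mono) auto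
  also have "\<dots> = (2 * P) powr P" using P by (simp add: powr_mult)
  also have "(2 * P) powr P + (2 * P) powr P = (2 * P) powr P * 2" by simp
  also have "\<dots> \<le> (2 * P) powr P * 2 powr P" using P powr_mono[of 1 P 2] by (intro mult_left_mono) auto
  also have "\<dots> = (4 * P) powr P" using P by (simp flip: powr_mult)
  finally show False using moment by simp
qed

section \<open>Exponential moments under negative association\<close>

text \<open>With w = x / 2, cosh x - 1 is half the square of exp w - exp (- w), which is at most 2 w
  exp w for w \<ge> 0. Having no linear term, the bound integrates to an estimate that is quadratic
  in the coefficients.\<close>

lemma cosh_le_one_plus:
  fixes x :: real
  shows "cosh x \<le> 1 + x\<^sup>2 * exp \<bar>x\<bar> / 2"
proof -
  have pos: "cosh x \<le> 1 + x\<^sup>2 * exp x / 2" if "x \<ge> 0" for x :: real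
  proof -
    define w where "w = x / 2"
    have w: "w \<ge> 0" "x = 2 * w" using that by (auto simp: w_def)
    have "exp w - exp (- w) = exp w * (1 - exp (- 2 * w))" by (simp add: algebra_simps flip: exp_add)
    also have "\<dots> \<le> exp w * (2 * w)" using exp_ge_add_one_self[of "- 2 * w"] by (intro mult_left_mono) auto
    also have "\<dots> = 2 * w * exp w" by simp
    finally have "exp w - exp (- w) \<le> 2 * w * exp w" .
    then have "(exp w - exp (- w))\<^sup>2 \<le> (2 * w * exp w)\<^sup>2" using w by (intro power_mono) auto
    moreover have "exp (2 * w) = (exp w)\<^sup>2" "exp (- (2 * w)) = (exp (- w))\<^sup>2" "exp w * exp (- w) = 1"
      by (simp_all add: power2_eq_square flip: exp_add)
    ultimately show ?thesis
      unfolding w(2) cosh_def by (simp add: power2_eq_square algebra_simps)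
  qed
  show ?thesis using pos[of "\<bar>x\<bar>"] by simp
qed

context na_law
begin

text \<open>
  For coefficients \<open>c\<close>, the exponential moment factorizes over the coordinates: the signs turn
  it into a product of hyperbolic cosines, increasing in the magnitudes, so that negative
  association applies (after truncation).
\<close>

lemma exp_linear_moment:
  assumes c: "\<And>i. i < d \<Longrightarrow> mean_abs i \<noteq> 0 \<Longrightarrow> \<bar>c i\<bar> * mean_abs i \<le> 1/8"
    and c0: "\<And>i. i < d \<Longrightarrow> mean_abs i = 0 \<Longrightarrow> c i = 0"
  shows "integrable \<mu> (\<lambda>x. exp (\<Sum>i<d. c i * x i))"
    "expectation (\<lambda>x. exp (\<Sum>i<d. c i * x i)) \<le> exp (768 * (\<Sum>i<d. (c i * mean_abs i)\<^sup>2))"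
proof -
  \<comment> \<open>Truncation at k makes the factors bounded, as \<open>na_prod_le\<close>
    requires.\<close>
  define f where "f = (\<lambda>k i r. cosh (c i * min (max 0 r) (real k)))"
  have meas_f [measurable]: "f k i \<in> borel_measurable borel" for k i
    unfolding f_def cosh_def by measurable
  have f_mono: "f k i r \<le> f k i s" if "0 \<le> r" "r \<le> s" for k i r s
  proof -
    have "cosh (\<bar>c i\<bar> * min (max 0 r) (real k)) \<le> cosh (\<bar>c i\<bar> * min (max 0 s) (real k))"
      using that by (subst cosh_real_nonneg_le_iff) (auto intro!: mult_left_mono)
    moreover have "cosh (\<bar>c i\<bar> * y) = cosh (c i * y)" for y
      by (cases "c i \<ge> 0") (auto simp: abs_if)
    ultimately show ?thesis by (simp add: f_def)
  qed
  have one_cosh: "1 \<le> cosh (y::real)" for y by (rule cosh_real_ge_1)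
  have f_one: "E i \<le> 1 + 768 * (c i * mean_abs i)\<^sup>2"
    if i: "i < d" and E: "E = (\<lambda>i. expectation (\<lambda>x. f k i \<bar>x i\<bar>))" for i k E
  proof (cases "mean_abs i = 0")
    case True
    then show ?thesis using c0[OF i] by (simp add: E f_def prob_space)
  next
    case False
    define m where "m = mean_abs i"
    have m: "m > 0" using False mean_abs_nonneg[of i] by (simp add: m_def)
    have coord: "Rd_inner d (unit_coeff i 1) = (\<lambda>x. x i)" using i by (simp add: fun_eq_iff inner_unit_coeff)
    have "expectation (\<lambda>x. \<bar>Rd_inner d (unit_coeff i 1) x\<bar>) = m" unfolding coord m_def mean_abs_def ..
    then have I: "integrable \<mu> (\<lambda>x. exp \<bar>x i / (4 * m)\<bar>)" and E12: "expectation (\<lambda>x. exp \<bar>x i / (4 * m)\<bar>) \<le> 12"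
      using exp_moment_mean[of "unit_coeff i 1" m] m unfolding coord by auto
    \<comment> \<open>Half of the exponent \<bar>x\<bar> / (4 m) absorbs exp \<bar>s * y\<bar> and
      the other half the square, as y^2 / 2 \<le> exp y. With the exponential moment 12 this gives
      768 = 64 * 12.\<close>
    have pt: "f k i \<bar>x\<bar> \<le> 1 + 64 * (c i * m)\<^sup>2 * exp \<bar>x / (4 * m)\<bar>" for x
    proof -
      define z where "z = min \<bar>x\<bar> (real k)"
      have z: "0 \<le> z" "z \<le> \<bar>x\<bar>" by (auto simp: z_def)
      define y where "y = z / (8 * m)"
      have y: "0 \<le> y" "2 * y \<le> \<bar>x / (4 * m)\<bar>" using z m by (auto simp: y_def field_simps)
      define s where "s = 8 * (c i * m)"
      have s: "\<bar>s\<bar> \<le> 1" using c[OF i False] m by (simp add: s_def m_def abs_mult)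
      have "f k i \<bar>x\<bar> = cosh (s * y)" using m by (simp add: f_def z_def s_def y_def max_def)
      also have "\<dots> \<le> 1 + (s * y)\<^sup>2 * exp \<bar>s * y\<bar> / 2" by (rule cosh_le_one_plus)
      also have "\<bar>s * y\<bar> \<le> y" using s y by (simp add: abs_mult mult_left_le_one_le)
      then have "(s * y)\<^sup>2 * exp \<bar>s * y\<bar> / 2 \<le> (s * y)\<^sup>2 * exp y / 2" by (simp add: mult_left_mono)
      also have "\<dots> = s\<^sup>2 * (y\<^sup>2 / 2 * exp y)" by (simp add: power_mult_distrib)
      also have "\<dots> \<le> s\<^sup>2 * (exp y * exp y)"
        using exp_lower_Taylor_quadratic[OF y(1)] y by (intro mult_left_mono mult_right_mono) auto
      also have "exp y * exp y \<le> exp \<bar>x / (4 * m)\<bar>" using y by (simp flip: exp_add)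
      finally have "f k i \<bar>x\<bar> \<le> 1 + s\<^sup>2 * exp \<bar>x / (4 * m)\<bar>" by (simp add: mult_left_mono)
      then show ?thesis by (simp add: s_def power_mult_distrib)
    qed
    have "E i \<le> expectation (\<lambda>x. 1 + 64 * (c i * m)\<^sup>2 * exp \<bar>x i / (4 * m)\<bar>)"
      unfolding E
    proof (rule integral_mono)
      have [measurable]: "(\<lambda>x. x i) \<in> borel_measurable \<mu>" by (rule measurable_coord[OF i])
      show "integrable \<mu> (\<lambda>x. f k i \<bar>x i\<bar>)"
      proof (rule integrable_const_bound[where B = "cosh (c i * real k)"])
        show "AE x in \<mu>. norm (f k i \<bar>x i\<bar>) \<le> cosh (c i * real k)"
        proof (rule AE_I2)
          fix x :: "nat \<Rightarrow> real"
          have "f k i \<bar>x i\<bar> \<le> f k i (max \<bar>x i\<bar> (real k))" by (intro f_mono) auto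
          then show "norm (f k i \<bar>x i\<bar>) \<le> cosh (c i * real k)"
            using one_cosh[of "c i * min (max 0 \<bar>x i\<bar>) (real k)"] by (auto simp: f_def max_def split: if_splits)
        qed
      qed measurable
      show "integrable \<mu> (\<lambda>x. 1 + 64 * (c i * m)\<^sup>2 * exp \<bar>x i / (4 * m)\<bar>)" using I by simp
    qed (rule pt)
    also have "\<dots> = 1 + 64 * (c i * m)\<^sup>2 * expectation (\<lambda>x. exp \<bar>x i / (4 * m)\<bar>)"
      using I by (simp add: prob_space)
    also have "\<dots> \<le> 1 + 64 * (c i * m)\<^sup>2 * 12" using E12 by (intro add_left_mono mult_left_mono) auto
    finally show ?thesis by (simp add: m_def)
  qed
  have trunc: "expectation (\<lambda>x. \<Prod>i<d. f k i \<bar>x i\<bar>) \<le> exp (768 * (\<Sum>i<d. (c i * mean_abs i)\<^sup>2))" for k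
  proof -
    have "expectation (\<lambda>x. \<Prod>i<d. f k i \<bar>x i\<bar>) \<le> (\<Prod>i<d. expectation (\<lambda>x. f k i \<bar>x i\<bar>))"
    proof (rule na_prod_le)
      fix i r assume i: "i < d"
      have "f k i r \<le> f k i (max r (real k))"
        using f_mono[of "max 0 r" "max r (real k)" k i] by (auto simp: f_def max_def split: if_splits)
      also have "\<dots> = cosh (c i * real k)" by (simp add: f_def max_def)
      also have "\<dots> \<le> (\<Sum>i<d. cosh (c i * real k))" using i by (intro member_le_sum) auto
      finally show "0 \<le> f k i r \<and> f k i r \<le> (\<Sum>i<d. cosh (c i * real k))" by (simp add: f_def)
    qed (auto intro: f_mono)
    also have "\<dots> \<le> (\<Prod>i<d. exp (768 * (c i * mean_abs i)\<^sup>2))"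
    proof (intro prod_mono conjI)
      fix i assume "i \<in> {..<d}"
      then have "expectation (\<lambda>x. f k i \<bar>x i\<bar>) \<le> 1 + 768 * (c i * mean_abs i)\<^sup>2" using f_one by simp
      also have "\<dots> \<le> exp (768 * (c i * mean_abs i)\<^sup>2)" by (rule exp_ge_add_one_self)
      finally show "expectation (\<lambda>x. f k i \<bar>x i\<bar>) \<le> exp (768 * (c i * mean_abs i)\<^sup>2)" .
      show "0 \<le> expectation (\<lambda>x. f k i \<bar>x i\<bar>)" by (auto simp: f_def intro!: integral_nonneg_AE)
    qed
    also have "\<dots> = exp (768 * (\<Sum>i<d. (c i * mean_abs i)\<^sup>2))" by (simp add: sum_distrib_left flip: exp_sum)
    finally show ?thesis .
  qed
  define B where "B = exp (768 * (\<Sum>i<d. (c i * mean_abs i)\<^sup>2))"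
  define F where "F = (\<lambda>x::nat \<Rightarrow> real. \<Prod>i<d. cosh (c i * x i))"
  have F0: "0 \<le> F x" for x by (simp add: F_def prod_nonneg)
  have [measurable]: "F \<in> borel_measurable \<mu>"
    unfolding F_def cosh_def by (intro borel_measurable_prod) (auto intro!: measurable_coord borel_measurable_times)
  define Fk where "Fk = (\<lambda>k x. \<Prod>i<d. f k i \<bar>x i\<bar>)"
  have [measurable]: "Fk k \<in> borel_measurable \<mu>" for k
    unfolding Fk_def by (intro borel_measurable_prod measurable_compose[OF _ meas_f] borel_measurable_abs measurable_coord) auto
  have Fk0: "0 \<le> Fk k x" for k x by (auto simp: Fk_def f_def intro!: prod_nonneg)
  have intFk: "integrable \<mu> (Fk k)" for k
  proof (rule integrable_const_bound[where B = "\<Prod>i<d. cosh (c i * real k)"])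
    show "AE x in \<mu>. norm (Fk k x) \<le> (\<Prod>i<d. cosh (c i * real k))"
    proof (rule AE_I2)
      fix x
      have "f k i \<bar>x i\<bar> \<le> cosh (c i * real k)" for i
        using f_mono[of "\<bar>x i\<bar>" "max \<bar>x i\<bar> (real k)" k i] by (auto simp: f_def max_def split: if_splits)
      then show "norm (Fk k x) \<le> (\<Prod>i<d. cosh (c i * real k))"
        unfolding Fk_def by (auto simp: abs_prod intro!: prod_mono) (auto simp: f_def)
    qed
  qed simp
  have "(\<integral>\<^sup>+x. ennreal (F x) \<partial>\<mu>) \<le> (\<integral>\<^sup>+x. (SUP k. ennreal (Fk k x)) \<partial>\<mu>)"
  proof (rule nn_integral_mono)
    fix x
    obtain k where k: "(\<Sum>i<d. \<bar>x i\<bar>) \<le> real k" using real_arch_simple by blast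
    have "f k i \<bar>x i\<bar> = cosh (c i * x i)" if "i < d" for i
    proof -
      have "\<bar>x i\<bar> \<le> real k" using k member_le_sum[of i "{..<d}" "\<lambda>i. \<bar>x i\<bar>"] that by auto
      then have "f k i \<bar>x i\<bar> = cosh (c i * \<bar>x i\<bar>)" by (simp add: f_def)
      then show ?thesis by (cases "x i \<ge> 0") auto
    qed
    then have "F x = Fk k x" by (simp add: F_def Fk_def)
    then show "ennreal (F x) \<le> (SUP k. ennreal (Fk k x))" by (auto intro: SUP_upper2)
  qed
  also have "\<dots> = (SUP k. \<integral>\<^sup>+x. ennreal (Fk k x) \<partial>\<mu>)"
  proof (rule nn_integral_monotone_convergence_SUP)
    show "incseq (\<lambda>k x. ennreal (Fk k x))"
    proof (intro incseq_SucI le_funI ennreal_leI)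
      fix k x
      have "cosh (\<bar>c i\<bar> * min (max 0 \<bar>x i\<bar>) (real k)) \<le> cosh (\<bar>c i\<bar> * min (max 0 \<bar>x i\<bar>) (real (Suc k)))" for i
        by (subst cosh_real_nonneg_le_iff) (auto intro!: mult_left_mono)
      moreover have "cosh (\<bar>c i\<bar> * y) = cosh (c i * y)" for i y
        by (cases "c i \<ge> 0") (auto simp: abs_if)
      ultimately show "Fk k x \<le> Fk (Suc k) x"
        unfolding Fk_def f_def by (intro prod_mono) auto
    qed
  qed simp
  also have "\<dots> \<le> ennreal B"
  proof (rule SUP_least)
    fix k
    have "(\<integral>\<^sup>+x. ennreal (Fk k x) \<partial>\<mu>) = ennreal (expectation (Fk k))"
      using Fk0 by (intro nn_integral_eq_integral intFk) auto
    also have "\<dots> \<le> ennreal B" using trunc by (intro ennreal_leI) (auto simp: B_def Fk_def)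
    finally show "(\<integral>\<^sup>+x. ennreal (Fk k x) \<partial>\<mu>) \<le> ennreal B" .
  qed
  finally have le: "(\<integral>\<^sup>+x. ennreal (F x) \<partial>\<mu>) \<le> ennreal B" .
  then have intF: "integrable \<mu> F"
    using F0 by (intro integrableI_nonneg) (auto simp: le_less_trans)
  have "ennreal (expectation F) \<le> ennreal B"
    using le nn_integral_eq_integral[OF intF] F0 by simp
  then have EF: "expectation F \<le> B" by (simp add: B_def ennreal_le_iff)
  define h where "h = (\<lambda>x::nat \<Rightarrow> real. exp (\<Sum>i<d. c i * x i))"
  have h_avg: "(\<Sum>\<sigma>\<in>signs {..<d}. exp (\<Sum>i<d. c i * x i * \<sigma> i)) = 2 ^ d * F x" for x
  proof -
    have "(\<Sum>\<sigma>\<in>signs {..<d}. exp (\<Sum>i<d. c i * x i * \<sigma> i)) = (\<Sum>\<sigma>\<in>signs {..<d}. \<Prod>i<d. exp (c i * x i * \<sigma> i))"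
      by (simp add: exp_sum)
    also have "\<dots> = (\<Prod>i<d. exp (c i * x i) + exp (- (c i * x i)))"
      using sum_signs_prod[of "{..<d}" "\<lambda>i s. exp (c i * x i * s)"] by simp
    also have "\<dots> = (\<Prod>i<d. 2 * cosh (c i * x i))"
      by (intro prod.cong refl) (simp add: cosh_def field_simps)
    finally show ?thesis by (simp only: prod.distrib F_def) simp
  qed
  \<comment> \<open>The exponential is the term of the sign sum with all signs equal to 1, so it has
    an integrable majorant.\<close>
  have h_le: "h x \<le> 2 ^ d * F x" for x
  proof -
    have "(\<lambda>i\<in>{..<d}. 1) \<in> signs {..<d}" by (subst restrict_PiE_iff) simp
    from member_le_sum[OF this, of "\<lambda>\<sigma>. exp (\<Sum>i<d. c i * x i * \<sigma> i)"]
    have "exp (\<Sum>i<d. c i * x i * (\<lambda>i\<in>{..<d}. 1) i) \<le> (\<Sum>\<sigma>\<in>signs {..<d}. exp (\<Sum>i<d. c i * x i * \<sigma> i))"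
      by (simp add: finite_signs)
    then show ?thesis by (simp add: h_avg h_def)
  qed
  have "(\<lambda>x. \<Sum>i<d. c i * x i) \<in> borel_measurable \<mu>" by (rule measurable_linear) simp
  then have [measurable]: "h \<in> borel_measurable \<mu>" unfolding h_def by measurable
  have inth: "integrable \<mu> h"
  proof (rule Bochner_Integration.integrable_bound)
    show "integrable \<mu> (\<lambda>x. 2 ^ d * F x)" using intF by simp
    show "AE x in \<mu>. norm (h x) \<le> norm (2 ^ d * F x)"
      using h_le F0 by (intro AE_I2) (auto simp: h_def)
  qed simp
  have "2 ^ card {..<d} * expectation h = expectation (\<lambda>x. \<Sum>\<sigma>\<in>signs {..<d}. h (flip (extend_sign {..<d} \<sigma>) x))"
    by (rule integral_signs_average(2)[OF order_refl inth, symmetric])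
  also have "\<dots> = expectation (\<lambda>x. 2 ^ d * F x)"
    by (simp add: h_def flip_extend_sum h_avg)
  finally have "expectation h = expectation F" by simp
  then show "integrable \<mu> (\<lambda>x. exp (\<Sum>i<d. c i * x i))"
    "expectation (\<lambda>x. exp (\<Sum>i<d. c i * x i)) \<le> exp (768 * (\<Sum>i<d. (c i * mean_abs i)\<^sup>2))"
    using inth EF by (simp_all add: h_def B_def)
qed

lemma moment_linear_le:
  assumes c: "\<And>i. i < d \<Longrightarrow> mean_abs i \<noteq> 0 \<Longrightarrow> \<bar>c i\<bar> * mean_abs i \<le> 1/8"
    and c0: "\<And>i. i < d \<Longrightarrow> mean_abs i = 0 \<Longrightarrow> c i = 0" and P: "P > 0"
  shows "expectation (\<lambda>x. \<bar>Rd_inner d c x\<bar> powr P) \<le> P powr P * (2 * exp (768 * (\<Sum>i<d. (c i * mean_abs i)\<^sup>2)))"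
proof -
  define B where "B = exp (768 * (\<Sum>i<d. (c i * mean_abs i)\<^sup>2))"
  have p: "integrable \<mu> (\<lambda>x. exp (Rd_inner d c x))" "expectation (\<lambda>x. exp (Rd_inner d c x)) \<le> B"
    using exp_linear_moment[of c] c c0 by (auto simp: Rd_inner_def B_def)
  have m: "integrable \<mu> (\<lambda>x. exp (- Rd_inner d c x))" "expectation (\<lambda>x. exp (- Rd_inner d c x)) \<le> B"
    using exp_linear_moment[of "\<lambda>i. - c i"] c c0 by (auto simp: Rd_inner_def B_def sum_negf)
  have "expectation (\<lambda>x. \<bar>Rd_inner d c x\<bar> powr P) \<le> expectation (\<lambda>x. P powr P * (exp (Rd_inner d c x) + exp (- Rd_inner d c x)))"
  proof (rule integral_mono)
    show "integrable \<mu> (\<lambda>x. \<bar>Rd_inner d c x\<bar> powr P)" by (rule integrable_inner_abs_powr[OF P])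
    show "integrable \<mu> (\<lambda>x. P powr P * (exp (Rd_inner d c x) + exp (- Rd_inner d c x)))" using p m by simp
    fix x
    have "\<bar>Rd_inner d c x\<bar> powr P \<le> P powr P * exp \<bar>Rd_inner d c x\<bar>" using P by (intro powr_le_exp) auto
    also have "exp \<bar>Rd_inner d c x\<bar> \<le> exp (Rd_inner d c x) + exp (- Rd_inner d c x)" by (simp add: abs_if)
    finally show "\<bar>Rd_inner d c x\<bar> powr P \<le> P powr P * (exp (Rd_inner d c x) + exp (- Rd_inner d c x))"
      by (simp add: mult_left_mono)
  qed
  also have "\<dots> = P powr P * (expectation (\<lambda>x. exp (Rd_inner d c x)) + expectation (\<lambda>x. exp (- Rd_inner d c x)))"
    using p m by simp
  also have "\<dots> \<le> P powr P * (B + B)" using p m by (intro mult_left_mono add_mono) auto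
  finally show ?thesis by (simp add: B_def)
qed

end

section \<open>Feasible levels\<close>

context uncond_lc_law
begin

text \<open>Log-concavity between the levels z and 0; the orthant at level 0 has probability at
  least 1 / 2 ^ card A by unconditionality.\<close>

lemma orthant_scale:
  assumes A: "A \<subseteq> {..<d}" and t: "0 < t" "t \<le> 1"
  shows "prob (orthant A b (\<lambda>i. t * z i)) \<ge> prob (orthant A b z) powr t * (1 / 2 ^ card A) powr (1 - t)"
proof (cases "t = 1")
  case True
  then show ?thesis by simp
next
  case False
  have "1 \<le> 2 ^ card A * prob (orthant A b (\<lambda>_. 0))"
    using prob_abs_le_orthant[OF A, of "\<lambda>_. 0" b] by (simp add: prob_space)
  then have "(1 / 2 ^ card A) powr (1 - t) \<le> prob (orthant A b (\<lambda>_. 0)) powr (1 - t)"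
    using t by (intro powr_mono2) (auto simp: field_simps)
  then have "prob (orthant A b z) powr t * (1 / 2 ^ card A) powr (1 - t)
     \<le> prob (orthant A b z) powr t * prob (orthant A b (\<lambda>_. 0)) powr (1 - t)"
    by (intro mult_left_mono) auto
  also have "\<dots> \<le> prob (orthant A b (\<lambda>i. t * z i + (1 - t) * 0))"
    using False t by (intro orthant_log_concave A) auto
  finally show ?thesis by simp
qed

text \<open>Superlevel sets of a log-concave function are convex. This keeps the mixture of levels
  produced by the minimax argument feasible.\<close>

lemma orthant_convex_comb:
  assumes A: "A \<subseteq> {..<d}" and "finite Z" "sum l Z = 1" "\<And>z. z \<in> Z \<Longrightarrow> 0 \<le> l z"
    and q: "\<And>z. z \<in> Z \<Longrightarrow> prob (orthant A b (w z)) \<ge> q" "q > 0"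
  shows "prob (orthant A b (\<lambda>i. \<Sum>z\<in>Z. l z * w z i)) \<ge> q"
  using assms(2-5)
proof (induct Z arbitrary: l)
  case (insert y Z)
  have r: "sum l Z = 1 - l y" "0 \<le> l y" "l y \<le> 1"
    using insert sum_nonneg[of Z l] by auto
  consider "l y = 0" | "l y = 1" | "0 < l y" "l y < 1" using r by linarith
  then show ?case
  proof cases
    case 1
    then show ?thesis using insert r by simp
  next
    case 2
    then have "\<forall>z\<in>Z. l z = 0" using insert r by (auto simp: sum_nonneg_eq_0_iff)
    then show ?thesis using 2 insert by simp
  next
    case 3
    define w' where "w' = (\<lambda>i. \<Sum>z\<in>Z. (l z / (1 - l y)) * w z i)"
    have "prob (orthant A b w') \<ge> q"
      unfolding w'_def using insert(1,2,5,6) r 3 by (intro insert(3)) (auto simp flip: sum_divide_distrib)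
    then have "q powr l y * q powr (1 - l y) \<le> prob (orthant A b (w y)) powr l y * prob (orthant A b w') powr (1 - l y)"
      using q(2) 3 insert(6)[of y] by (intro mult_mono powr_mono2) auto
    also have "\<dots> \<le> prob (orthant A b (\<lambda>i. l y * w y i + (1 - l y) * w' i))"
      using 3 by (intro orthant_log_concave A) auto
    also have "(\<lambda>i. l y * w y i + (1 - l y) * w' i) = (\<lambda>i. \<Sum>z\<in>insert y Z. l z * w z i)"
      using insert(1,2) 3 by (auto simp: w'_def sum_distrib_left fun_eq_iff intro!: sum.cong)
    also have "q powr l y * q powr (1 - l y) = q" using q(2) by (simp flip: powr_add)
    finally show ?thesis .
  qed
qed simp

text \<open>
  The cell found by the pigeonhole may lie far out; by log-concavity it can be pulled back to
  level \<open>\<epsilon> P\<close> at the price of a probability \<open>exp (- 5 \<epsilon> P)\<close>.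
\<close>

lemma exists_level_vector:
  fixes P \<alpha> \<epsilon> :: real
  assumes A: "A \<subseteq> {..<d}" and D: "D \<subseteq> A" and P: "P \<ge> 1" and card: "real (card A) \<le> P"
    and \<alpha>: "\<alpha> > 0" and \<epsilon>: "0 < \<epsilon>" "\<epsilon> \<le> 1"
    and moment: "expectation (\<lambda>x. (\<Sum>i\<in>D. \<bar>b i * x i\<bar>) powr P) \<ge> (4 * \<alpha> * P) powr P"
  obtains z where "\<And>i. 0 \<le> z i" "\<And>i. i \<notin> D \<Longrightarrow> z i = 0" "sum z D = \<epsilon> * \<alpha> * P"
    "prob (orthant A b z) \<ge> exp (- (card A + 5 * \<epsilon> * P))"
proof -
  have fin: "finite A" "finite D" using A D finite_subset by (auto intro: finite_subset)
  have cD: "real (card D) \<le> P" using card card_mono[OF fin(1) D] by linarith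
  have meas: "(\<lambda>x. \<bar>b i * x i\<bar> / \<alpha>) \<in> borel_measurable \<mu>" if "i \<in> D" for i
    using that A D by (intro borel_measurable_divide borel_measurable_abs borel_measurable_times measurable_coord) auto
  have "expectation (\<lambda>x. (\<Sum>i\<in>D. \<bar>b i * x i\<bar> / \<alpha>) powr P) = expectation (\<lambda>x. (\<Sum>i\<in>D. \<bar>b i * x i\<bar>) powr P) / \<alpha> powr P"
    using \<alpha> by (simp add: powr_divide sum_nonneg flip: sum_divide_distrib)
  also have "\<dots> \<ge> (4 * \<alpha> * P) powr P / \<alpha> powr P" using moment by (intro divide_right_mono) auto
  also have "(4 * \<alpha> * P) powr P / \<alpha> powr P = (4 * P) powr P" using \<alpha> P by (simp flip: powr_divide)
  finally have mom: "expectation (\<lambda>x. (\<Sum>i\<in>D. \<bar>b i * x i\<bar> / \<alpha>) powr P) \<ge> (4 * P) powr P" .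
  obtain k :: "nat \<Rightarrow> nat" where k: "real (sum k D) \<ge> P"
    "prob {x \<in> space \<mu>. \<forall>i\<in>D. real (k i) \<le> \<bar>b i * x i\<bar> / \<alpha>} \<ge> exp (- 5 * real (sum k D))"
    by (rule exists_likely_cell[OF fin(2) meas _ P cD mom]) (use \<alpha> in auto)
  define m where "m = real (sum k D)"
  have m: "m \<ge> P" "m > 0" using k P by (auto simp: m_def)
  \<comment> \<open>Levels are 0 on A - D, so that the orthant over all of A can be used; passing
    from magnitudes to signs costs a factor 2 ^ card A.\<close>
  define w where "w = (\<lambda>i. if i \<in> D then \<alpha> * real (k i) else 0)"
  have "exp (- 5 * m) \<le> prob {x \<in> space \<mu>. \<forall>i\<in>D. real (k i) \<le> \<bar>b i * x i\<bar> / \<alpha>}" using k by (simp add: m_def)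
  also have "{x \<in> space \<mu>. \<forall>i\<in>D. real (k i) \<le> \<bar>b i * x i\<bar> / \<alpha>} = {x \<in> space \<mu>. \<forall>i\<in>A. w i \<le> \<bar>b i * x i\<bar>}"
    using \<alpha> D by (auto simp: w_def field_simps)
  also have "prob \<dots> \<le> 2 ^ card A * prob (orthant A b w)" by (rule prob_abs_le_orthant[OF A])
  finally have pw: "prob (orthant A b w) \<ge> exp (- 5 * m) / 2 ^ card A" by (simp add: field_simps)
  define t where "t = \<epsilon> * P / m"
  have "\<epsilon> * P \<le> 1 * m" using \<epsilon> m P by (intro mult_mono) auto
  then have t: "0 < t" "t \<le> 1" using \<epsilon> m P by (auto simp: t_def)
  show ?thesis
  proof (rule that[of "\<lambda>i. t * w i"])
    show "0 \<le> t * w i" for i using t \<alpha> by (simp add: w_def)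
    show "t * w i = 0" if "i \<notin> D" for i using that by (simp add: w_def)
    have "(\<Sum>i\<in>D. t * w i) = t * \<alpha> * m" by (simp add: w_def m_def sum_distrib_left mult.assoc)
    also have "\<dots> = \<epsilon> * \<alpha> * P" using m by (simp add: t_def)
    finally show "(\<Sum>i\<in>D. t * w i) = \<epsilon> * \<alpha> * P" .
    have "exp (- (card A + 5 * \<epsilon> * P)) = exp (- real (card A)) * exp (- 5 * \<epsilon> * P)" by (simp flip: exp_add)
    also have "\<dots> \<le> (1 / 2 ^ card A) * exp (- 5 * \<epsilon> * P)"
    proof (rule mult_right_mono)
      have "(2::real) ^ card A \<le> exp 1 ^ card A" using exp_ge_add_one_self[of 1] by (intro power_mono) auto
      also have "\<dots> = exp (real (card A))" by (simp flip: exp_of_nat_mult)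
      finally show "exp (- real (card A)) \<le> 1 / 2 ^ card A" by (simp add: exp_minus field_simps)
    qed simp
    also have "\<dots> = (exp (- 5 * m) / 2 ^ card A) powr t * (1 / 2 ^ card A) powr (1 - t)"
    proof -
      have "(exp (- 5 * m) / 2 ^ card A) powr t = exp (- 5 * \<epsilon> * P) * (1 / 2 ^ card A) powr t"
        using m by (simp add: powr_divide exp_powr_real t_def)
      moreover have "(1 / 2 ^ card A) powr t * (1 / 2 ^ card A) powr (1 - t) = (1 / 2 ^ card A :: real)"
        by (simp flip: powr_add)
      ultimately show ?thesis by (simp add: mult.assoc)
    qed
    also have "\<dots> \<le> prob (orthant A b w) powr t * (1 / 2 ^ card A) powr (1 - t)"
      using pw t by (intro mult_right_mono powr_mono2) auto
    also have "\<dots> \<le> prob (orthant A b (\<lambda>i. t * w i))" by (rule orthant_scale[OF A t])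
    finally show "prob (orthant A b (\<lambda>i. t * w i)) \<ge> exp (- (card A + 5 * \<epsilon> * P))" .
  qed
qed

end

section \<open>Replica laws\<close>

text \<open>
  Joint laws \<open>R\<close> of a uniform hidden point and a posterior sample, when each likelihood is at
  most \<open>1 / w\<close> times the reference law: a list decoder with lists of length \<open>L\<close> succeeds with
  probability at most \<open>L / (real (card U) * w)\<close>.
\<close>

definition replica_laws :: "'t set \<Rightarrow> real \<Rightarrow> ('t \<times> 't \<Rightarrow> real) set" where
  "replica_laws U w = {R. (\<forall>t\<in>U. \<forall>s\<in>U. 0 \<le> R (t, s)) \<and>
     (\<forall>t\<in>U. (\<Sum>s\<in>U. R (t, s)) = 1 / card U) \<and>
     (\<forall>\<Gamma> L. (\<forall>s\<in>U. \<Gamma> s \<subseteq> U \<and> real (card (\<Gamma> s)) \<le> L) \<longrightarrow> (\<Sum>s\<in>U. \<Sum>t\<in>\<Gamma> s. R (t, s)) \<le> L / (real (card U) * w))}"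

lemma replica_laws_convex:
  assumes "R \<in> replica_laws U w" "R' \<in> replica_laws U w" "0 \<le> u" "u \<le> 1"
  shows "(\<lambda>x. (1 - u) * R x + u * R' x) \<in> replica_laws U w"
  unfolding replica_laws_def
proof (intro CollectI conjI ballI allI impI)
  show "0 \<le> (1 - u) * R (t, s) + u * R' (t, s)" if "t \<in> U" "s \<in> U" for t s
    using assms that by (auto simp: replica_laws_def)
  show "(\<Sum>s\<in>U. (1 - u) * R (t, s) + u * R' (t, s)) = 1 / card U" if "t \<in> U" for t
    using assms that by (simp add: replica_laws_def sum.distrib flip: sum_distrib_left) (simp add: algebra_simps flip: add_divide_distrib)
  show "(\<Sum>s\<in>U. \<Sum>t\<in>\<Gamma> s. (1 - u) * R (t, s) + u * R' (t, s)) \<le> L / (real (card U) * w)"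
    if "\<forall>s\<in>U. \<Gamma> s \<subseteq> U \<and> real (card (\<Gamma> s)) \<le> L" for \<Gamma> L
  proof -
    have "(\<Sum>s\<in>U. \<Sum>t\<in>\<Gamma> s. (1 - u) * R (t, s) + u * R' (t, s))
      = (1 - u) * (\<Sum>s\<in>U. \<Sum>t\<in>\<Gamma> s. R (t, s)) + u * (\<Sum>s\<in>U. \<Sum>t\<in>\<Gamma> s. R' (t, s))"
      by (simp add: sum.distrib sum_distrib_left)
    also have "\<dots> \<le> (1 - u) * (L / (real (card U) * w)) + u * (L / (real (card U) * w))"
      using assms that by (intro add_mono mult_left_mono) (auto simp: replica_laws_def)
    also have "\<dots> = L / (real (card U) * w)" by algebra
    finally show ?thesis .
  qed
qed

text \<open>
  Every replica law misses a substantial part of the forced levels. Let \<open>Lo t\<close> be the elements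
  of \<open>A t\<close> that the replica misses with probability at least 1/8. If the remaining sets
  \<open>A t - Lo t\<close> determine \<open>t\<close>, then the replica allows to decode \<open>t\<close> with short lists, which is
  impossible; so \<open>Lo t\<close> is often significant.
\<close>

lemma replica_payoff:
  fixes A :: "'t \<Rightarrow> 'i set" and \<zeta> :: "'t \<Rightarrow> 'i set \<Rightarrow> 'i \<Rightarrow> real"
  assumes U: "finite U" "U \<noteq> {}" and fin: "\<And>t. t \<in> U \<Longrightarrow> finite (A t)"
    and card_A: "\<And>t. t \<in> U \<Longrightarrow> real (card (A t)) \<le> \<kappa> * P"
    and sep: "\<And>s t. s \<in> U \<Longrightarrow> t \<in> U \<Longrightarrow> s \<noteq> t \<Longrightarrow> big (A t - A s) \<or> big (A s - A t)"
    and mono: "\<And>t D E. t \<in> U \<Longrightarrow> D \<subseteq> E \<Longrightarrow> E \<subseteq> A t \<Longrightarrow> big D \<Longrightarrow> big E"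
    and \<zeta>: "\<And>t D i. t \<in> U \<Longrightarrow> D \<subseteq> A t \<Longrightarrow> big D \<Longrightarrow> 0 \<le> \<zeta> t D i"
      "\<And>t D. t \<in> U \<Longrightarrow> D \<subseteq> A t \<Longrightarrow> big D \<Longrightarrow> (\<Sum>i\<in>D. \<zeta> t D i) = v"
      "\<And>t D i. t \<in> U \<Longrightarrow> D \<subseteq> A t \<Longrightarrow> big D \<Longrightarrow> i \<notin> D \<Longrightarrow> \<zeta> t D i = 0"
    and v: "v > 0" and card_U: "real (card U) \<ge> exp (P / 2)"
    and w: "w = exp (- q * P)" and q: "5 * \<kappa> + q \<le> 1/8" and \<kappa>: "0 \<le> \<kappa>" and P: "P \<ge> 6"
    and R: "R \<in> replica_laws U w"
  shows "\<exists>D. (\<forall>t\<in>U. D t \<subseteq> A t) \<and>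
    (\<Sum>t\<in>U. \<Sum>s\<in>U. R (t, s) * (\<Sum>i\<in>A t - A s. if big (D t) then \<zeta> t (D t) i else 0)) \<ge> v / 32"
proof -
  define N where "N = real (card U)"
  have N0: "N > 0" using U by (simp add: N_def card_gt_0_iff)
  have R0: "0 \<le> R (t, s)" if "t \<in> U" "s \<in> U" for t s using R that by (simp add: replica_laws_def)
  have Rsum: "(\<Sum>s\<in>U. R (t, s)) = 1 / N" if "t \<in> U" for t using R that by (simp add: replica_laws_def N_def)
  define miss where "miss = (\<lambda>t i. \<Sum>s\<in>U. R (t, s) * (if i \<in> A s then 0 else 1))"
  \<comment> \<open>The first marginal of R is 1 / N, so the threshold means a conditional miss
    probability of 1/8.\<close>
  define Lo where "Lo = (\<lambda>t. {i \<in> A t. miss t i \<ge> 1 / (8 * N)})"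
  have Lo_sub: "Lo t \<subseteq> A t" for t by (auto simp: Lo_def)
  have swap: "(\<Sum>s\<in>U. R (t, s) * (\<Sum>i\<in>E - A s. g i)) = (\<Sum>i\<in>E. g i * miss t i)" if "finite E" for t E and g :: "'i \<Rightarrow> real"
  proof -
    have "(\<Sum>i\<in>E - A s. g i) = (\<Sum>i\<in>E. g i * (if i \<in> A s then 0 else 1))" for s
      using that by (intro sum.mono_neutral_cong_left) auto
    then have "(\<Sum>s\<in>U. R (t, s) * (\<Sum>i\<in>E - A s. g i)) = (\<Sum>s\<in>U. \<Sum>i\<in>E. R (t, s) * (g i * (if i \<in> A s then 0 else 1)))"
      by (simp add: sum_distrib_left)
    also have "\<dots> = (\<Sum>i\<in>E. \<Sum>s\<in>U. R (t, s) * (g i * (if i \<in> A s then 0 else 1)))" by (rule sum.swap)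
    finally show ?thesis by (simp add: miss_def sum_distrib_left mult.left_commute)
  qed
  define Bad where "Bad = {t \<in> U. big (Lo t)}"
  define Good where "Good = U - Bad"
  have finG: "finite Good" "finite Bad" using U by (auto simp: Good_def Bad_def)
  have payoff: "(\<Sum>t\<in>U. \<Sum>s\<in>U. R (t, s) * (\<Sum>i\<in>A t - A s. if big (Lo t) then \<zeta> t (Lo t) i else 0)) \<ge> real (card Bad) * (v / (8 * N))"
  proof -
    have "real (card Bad) * (v / (8 * N)) = (\<Sum>t\<in>Bad. v / (8 * N))" by simp
    also have "\<dots> \<le> (\<Sum>t\<in>Bad. \<Sum>s\<in>U. R (t, s) * (\<Sum>i\<in>A t - A s. if big (Lo t) then \<zeta> t (Lo t) i else 0))"
    proof (intro sum_mono)
      fix t assume "t \<in> Bad"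
      then have t: "t \<in> U" "big (Lo t)" by (auto simp: Bad_def)
      have "v / (8 * N) = (\<Sum>i\<in>Lo t. \<zeta> t (Lo t) i * (1 / (8 * N)))"
        using \<zeta>(2)[OF t(1) Lo_sub t(2)] by (simp flip: sum_divide_distrib)
      also have "\<dots> \<le> (\<Sum>i\<in>Lo t. \<zeta> t (Lo t) i * miss t i)"
        using \<zeta>(1)[OF t(1) Lo_sub t(2)] by (intro sum_mono mult_left_mono) (auto simp: Lo_def)
      also have "\<dots> = (\<Sum>i\<in>A t. \<zeta> t (Lo t) i * miss t i)"
        using \<zeta>(3)[OF t(1) Lo_sub t(2)] fin[OF t(1)] Lo_sub by (intro sum.mono_neutral_left) auto
      also have "\<dots> = (\<Sum>s\<in>U. R (t, s) * (\<Sum>i\<in>A t - A s. \<zeta> t (Lo t) i))" using fin[OF t(1)] by (simp add: swap)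
      finally show "v / (8 * N) \<le> (\<Sum>s\<in>U. R (t, s) * (\<Sum>i\<in>A t - A s. if big (Lo t) then \<zeta> t (Lo t) i else 0))"
        using t(2) by simp
    qed
    also have "\<dots> \<le> (\<Sum>t\<in>U. \<Sum>s\<in>U. R (t, s) * (\<Sum>i\<in>A t - A s. if big (Lo t) then \<zeta> t (Lo t) i else 0))"
      using U \<zeta>(1)[OF _ Lo_sub] R0 by (intro sum_mono2) (auto simp: Bad_def intro!: sum_nonneg mult_nonneg_nonneg)
    finally show ?thesis .
  qed
  have "real (card Bad) \<ge> N / 4"
  proof (rule ccontr)
    assume "\<not> ?thesis"
    then have few: "real (card Bad) < N / 4" by simp
    have "card Good + card Bad = card U"
    proof -
      have "Good \<union> Bad = U" "Good \<inter> Bad = {}" by (auto simp: Good_def Bad_def)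
      then show ?thesis using finG by (metis card_Un_disjoint)
    qed
    then have many: "real (card Good) \<ge> 3/4 * N" using few by (simp add: N_def)
    then have "card Good > 0" using N0 by (metis less_le_trans mult_pos_pos of_nat_0_less_iff zero_less_divide_iff zero_less_numeral)
    define H where "H = (\<lambda>t. A t - Lo t)"
    \<comment> \<open>An element of A t - A s cannot lie in H t = H s, which is a subset of A s; so
      it lies in \<open>Lo t\<close>, and separation makes t or s bad.\<close>
    have inj: "inj_on H Good"
    proof (rule inj_onI, rule ccontr)
      fix s t assume st: "s \<in> Good" "t \<in> Good" "H s = H t" "s \<noteq> t"
      then have "A t - A s \<subseteq> Lo t" "A s - A t \<subseteq> Lo s" by (auto simp: H_def Lo_def)
      moreover have "s \<in> U" "t \<in> U" using st by (auto simp: Good_def)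
      ultimately have "big (Lo t) \<or> big (Lo s)" using sep[of s t] st(4) mono[OF _ _ Lo_sub] by blast
      then show False using st by (auto simp: Good_def Bad_def)
    qed
    define F where "F = H ` Good"
    have cF: "card F = card Good" using inj by (simp add: F_def card_image)
    have sumF: "(\<Sum>B\<in>F. g B) = (\<Sum>t\<in>Good. g (H t))" for g :: "'i set \<Rightarrow> real"
      unfolding F_def using inj by (simp add: sum.reindex)
    have GU: "t \<in> U" if "t \<in> Good" for t using that by (simp add: Good_def)
    have finH: "finite (H t)" if "t \<in> Good" for t using fin[OF GU[OF that]] by (simp add: H_def)
    obtain l :: "'i set \<Rightarrow> 'i \<Rightarrow> real" and z :: "'i set \<Rightarrow> real"
      where l: "\<And>B i. l B i \<ge> 0" and z: "\<And>B. z B \<ge> 0"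
        and l_sum: "\<And>B. B \<in> F \<Longrightarrow> (\<Sum>i\<in>B. l B i) \<le> ln (card F)"
        and z_sum: "(\<Sum>B\<in>F. z B) \<le> (\<Sum>B\<in>F. real (card B))"
        and code: "\<And>B. finite B \<Longrightarrow> (\<Sum>A\<in>F. exp (- (\<Sum>i\<in>A - B. l A i) - z A)) \<le> 2 ^ card B"
      by (rule sequential_code[of "\<Union>t\<in>U. A t" F]) (use U fin in \<open>auto simp: F_def H_def Good_def\<close>)
    \<comment> \<open>The code length of H t when A s is known. Elements of H t are missed with
      conditional probability below 1/8, so the surprises contribute at most ln N / 8 on average,
      and z at most \<kappa> P.\<close>
    define X where "X = (\<lambda>t s. (\<Sum>i\<in>H t - A s. l (H t) i) + z (H t))"
    have X0: "0 \<le> X t s" for t s using l z by (auto simp: X_def intro!: add_nonneg_nonneg sum_nonneg)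
    define E0 where "E0 = ln N / 8 + \<kappa> * P"
    have lnN: "ln N \<ge> P / 2" using card_U N0 ln_le_cancel_iff[of "exp (P / 2)" N] by (simp add: N_def)
    have E0: "E0 > 0" using lnN \<kappa> P by (simp add: E0_def add_pos_nonneg)
    have meanX: "(\<Sum>t\<in>Good. \<Sum>s\<in>U. R (t, s) * X t s) \<le> E0"
    proof -
      have "(\<Sum>s\<in>U. R (t, s) * X t s) \<le> (ln N / 8 + z (H t)) / N" if t: "t \<in> Good" for t
      proof -
        have "(\<Sum>s\<in>U. R (t, s) * X t s) = (\<Sum>s\<in>U. R (t, s) * (\<Sum>i\<in>H t - A s. l (H t) i)) + z (H t) / N"
          using Rsum[OF GU[OF t]] by (simp add: X_def distrib_left sum.distrib flip: sum_distrib_right)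
        also have "(\<Sum>s\<in>U. R (t, s) * (\<Sum>i\<in>H t - A s. l (H t) i)) = (\<Sum>i\<in>H t. l (H t) i * miss t i)"
          by (rule swap[OF finH[OF t]])
        also have "(\<Sum>i\<in>H t. l (H t) i * miss t i) \<le> (\<Sum>i\<in>H t. l (H t) i * (1 / (8 * N)))"
          using l by (intro sum_mono mult_left_mono) (auto simp: H_def Lo_def)
        also have "\<dots> = (\<Sum>i\<in>H t. l (H t) i) / (8 * N)" by (simp flip: sum_divide_distrib)
        also have "\<dots> \<le> ln N / (8 * N)"
        proof -
          have "(\<Sum>i\<in>H t. l (H t) i) \<le> ln (card F)" using t by (intro l_sum) (simp add: F_def)
          also have "\<dots> \<le> ln N"
          proof -
            have "card Good \<le> card U" using U by (intro card_mono) (auto simp: Good_def)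
            then show ?thesis using \<open>card Good > 0\<close> by (simp add: cF N_def)
          qed
          finally show ?thesis using N0 by (simp add: divide_right_mono)
        qed
        finally show ?thesis by (simp add: add_divide_distrib)
      qed
      then have "(\<Sum>t\<in>Good. \<Sum>s\<in>U. R (t, s) * X t s) \<le> (\<Sum>t\<in>Good. (ln N / 8 + z (H t)) / N)" by (rule sum_mono)
      also have "\<dots> = (real (card Good) * (ln N / 8) + (\<Sum>B\<in>F. z B)) / N"
        by (simp add: sumF sum.distrib flip: sum_divide_distrib)
      also have "\<dots> \<le> (real (card Good) * (ln N / 8) + real (card Good) * (\<kappa> * P)) / N"
      proof -
        have "(\<Sum>B\<in>F. z B) \<le> (\<Sum>t\<in>Good. real (card (H t)))" using z_sum by (simp add: sumF)
        also have "\<dots> \<le> (\<Sum>t\<in>Good. \<kappa> * P)"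
        proof (intro sum_mono)
          fix t assume t: "t \<in> Good"
          have "card (H t) \<le> card (A t)" using fin[OF GU[OF t]] by (intro card_mono) (auto simp: H_def)
          then show "real (card (H t)) \<le> \<kappa> * P" using card_A[OF GU[OF t]] by simp
        qed
        finally show ?thesis using N0 by (simp add: divide_right_mono)
      qed
      also have "\<dots> = real (card Good) / N * E0" by (simp add: E0_def algebra_simps add_divide_distrib)
      also have "\<dots> \<le> 1 * E0"
      proof (intro mult_right_mono)
        have "card Good \<le> card U" using U by (intro card_mono) (auto simp: Good_def)
        then show "real (card Good) / N \<le> 1" using N0 by (simp add: N_def)
      qed (use E0 in simp)
      finally show ?thesis by simp
    qed
    \<comment> \<open>By Markov's inequality at 4 E0, decoding fails with mass at most 1/4, while
      \<open>code\<close> bounds the length of the list.\<close>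
    define \<Gamma> where "\<Gamma> = (\<lambda>s. {t \<in> Good. X t s \<le> 4 * E0})"
    define L where "L = exp (4 * E0 + \<kappa> * P)"
    have list: "real (card (\<Gamma> s)) \<le> L" if s: "s \<in> U" for s
    proof -
      have "real (card (\<Gamma> s)) * exp (- 4 * E0) = (\<Sum>t\<in>\<Gamma> s. exp (- 4 * E0))" by simp
      also have "\<dots> \<le> (\<Sum>t\<in>\<Gamma> s. exp (- X t s))" by (intro sum_mono) (auto simp: \<Gamma>_def)
      also have "\<dots> \<le> (\<Sum>t\<in>Good. exp (- X t s))" using finG by (intro sum_mono2) (auto simp: \<Gamma>_def)
      also have "\<dots> = (\<Sum>B\<in>F. exp (- (\<Sum>i\<in>B - A s. l B i) - z B))" by (simp add: sumF X_def)
      also have "\<dots> \<le> 2 ^ card (A s)" by (rule code[OF fin[OF s]])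
      also have "\<dots> \<le> exp 1 ^ card (A s)" using exp_ge_add_one_self[of 1] by (intro power_mono) auto
      also have "\<dots> = exp (real (card (A s)))" by (simp flip: exp_of_nat_mult)
      also have "\<dots> \<le> exp (\<kappa> * P)" using card_A[OF s] by simp
      finally have "real (card (\<Gamma> s)) * exp (- 4 * E0) * exp (4 * E0) \<le> exp (\<kappa> * P) * exp (4 * E0)"
        by (intro mult_right_mono) auto
      then show ?thesis by (simp add: L_def mult.assoc add.commute flip: exp_add)
    qed
    have "(\<Sum>t\<in>Good. \<Sum>s\<in>U. R (t, s)) = real (card Good) / N" using Rsum GU by simp
    also have "\<dots> \<ge> 3/4" using many N0 by (simp add: field_simps)
    finally have "3/4 \<le> (\<Sum>t\<in>Good. \<Sum>s\<in>U. R (t, s))" .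
    also have "\<dots> \<le> (\<Sum>t\<in>Good. \<Sum>s\<in>U. R (t, s) * (if X t s \<le> 4 * E0 then 1 else 0) + R (t, s) * X t s / (4 * E0))"
    proof (intro sum_mono)
      fix t s assume t: "t \<in> Good" and s: "s \<in> U"
      show "R (t, s) \<le> R (t, s) * (if X t s \<le> 4 * E0 then 1 else 0) + R (t, s) * X t s / (4 * E0)"
      proof (cases "X t s \<le> 4 * E0")
        case True
        then show ?thesis using R0[OF GU[OF t] s] X0[of t s] E0 by simp
      next
        case False
        then have "1 \<le> X t s / (4 * E0)" using E0 by simp
        then have "R (t, s) * 1 \<le> R (t, s) * (X t s / (4 * E0))" using R0[OF GU[OF t] s] by (intro mult_left_mono) auto
        then show ?thesis using False by simp
      qed
    qed
    also have "\<dots> = (\<Sum>t\<in>Good. \<Sum>s\<in>U. R (t, s) * (if X t s \<le> 4 * E0 then 1 else 0)) + (\<Sum>t\<in>Good. \<Sum>s\<in>U. R (t, s) * X t s) / (4 * E0)"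
      by (simp add: sum.distrib sum_divide_distrib)
    finally have decoded: "3/4 \<le> (\<Sum>t\<in>Good. \<Sum>s\<in>U. R (t, s) * (if X t s \<le> 4 * E0 then 1 else 0)) + (\<Sum>t\<in>Good. \<Sum>s\<in>U. R (t, s) * X t s) / (4 * E0)" .
    have "(\<Sum>t\<in>Good. \<Sum>s\<in>U. R (t, s) * (if X t s \<le> 4 * E0 then 1 else 0)) = (\<Sum>s\<in>U. \<Sum>t\<in>\<Gamma> s. R (t, s))"
      using finG by (subst sum.swap) (auto simp: \<Gamma>_def sum.inter_filter intro!: sum.cong)
    also have "\<dots> \<le> L / (N * w)"
    proof -
      have "\<forall>s\<in>U. \<Gamma> s \<subseteq> U \<and> real (card (\<Gamma> s)) \<le> L" using list by (auto simp: \<Gamma>_def GU)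
      then show ?thesis using R by (auto simp: replica_laws_def N_def)
    qed
    finally have "(\<Sum>t\<in>Good. \<Sum>s\<in>U. R (t, s) * (if X t s \<le> 4 * E0 then 1 else 0)) \<le> L / (N * w)" .
    moreover have "(\<Sum>t\<in>Good. \<Sum>s\<in>U. R (t, s) * X t s) / (4 * E0) \<le> E0 / (4 * E0)"
      using meanX E0 by (intro divide_right_mono) auto
    moreover have "E0 / (4 * E0) = 1/4" using E0 by simp
    ultimately have "1/2 \<le> L / (N * w)" using decoded by linarith
    also have "L / (N * w) = exp (4 * E0 + \<kappa> * P + q * P - ln N)"
      using N0 by (simp add: L_def w exp_diff exp_add exp_minus field_simps)
    \<comment> \<open>Here 4 E0 = ln N / 2 + 4 \<kappa> P; the remaining half of ln N is at least P
      / 4 and beats (5 \<kappa> + q) P, which is at most P / 8.\<close>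
    also have "\<dots> \<le> exp (- P / 8)"
    proof -
      have "5 * \<kappa> * P + q * P \<le> P / 8" using mult_right_mono[OF q, of P] P by (simp add: algebra_simps)
      then show ?thesis using lnN by (simp add: E0_def algebra_simps)
    qed
    also have "\<dots> \<le> exp (- 3/4)" using P by simp
    also have "\<dots> < 1/2"
    proof -
      have "2 < exp (3/4 :: real)" using exp_lower_Taylor_quadratic[of "3/4"] by (simp add: power2_eq_square)
      then show ?thesis by (simp add: exp_minus field_simps)
    qed
    finally show False by simp
  qed
  then have "real (card Bad) * (v / (8 * N)) \<ge> N / 4 * (v / (8 * N))" using v N0 by (intro mult_right_mono) auto
  moreover have "N / 4 * (v / (8 * N)) = v / 32" using N0 by simp
  ultimately have "v / 32 \<le> (\<Sum>t\<in>U. \<Sum>s\<in>U. R (t, s) * (\<Sum>i\<in>A t - A s. if big (Lo t) then \<zeta> t (Lo t) i else 0))"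
    using payoff by linarith
  then show ?thesis using Lo_sub by blast
qed

section \<open>Posterior samples under forced levels\<close>

context na_law
begin

text \<open>Reflecting the unforced coordinate i preserves both \<mu> and the orthant.\<close>

lemma expectation_orthant_coord:
  assumes "D \<subseteq> {..<d}" "i < d" "i \<notin> D"
  shows "expectation (\<lambda>x. indicator (orthant D b y) x * x i) = 0"
proof -
  define \<sigma> where "\<sigma> = (\<lambda>j. if j = i then -1 else 1 :: real)"
  have [measurable]: "orthant D b y \<in> sets \<mu>" "(\<lambda>x. x i) \<in> borel_measurable \<mu>"
    using assms by (auto intro: sets_orthant measurable_coord)
  have "expectation (\<lambda>x. indicator (orthant D b y) x * x i)
      = expectation (\<lambda>x. indicator (orthant D b y) (flip \<sigma> x) * flip \<sigma> x i)"
    by (rule integral_flip[symmetric]) (auto simp: \<sigma>_def)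
  also have "\<dots> = expectation (\<lambda>x. - (indicator (orthant D b y) x * x i))"
  proof (rule Bochner_Integration.integral_cong[OF refl])
    fix x assume x: "x \<in> space \<mu>"
    have "flip \<sigma> x j = x j" if "j \<in> D" for j using that assms by (auto simp: flip_apply \<sigma>_def)
    then have "flip \<sigma> x \<in> orthant D b y \<longleftrightarrow> x \<in> orthant D b y" using x by (simp add: orthant_def flip_space)
    moreover have "flip \<sigma> x i = - x i" using assms by (simp add: flip_apply \<sigma>_def)
    ultimately show "indicator (orthant D b y) (flip \<sigma> x) * flip \<sigma> x i = - (indicator (orthant D b y) x * x i)"
      by (simp add: indicator_def)
  qed
  finally show ?thesis by simp
qed

text \<open>
  The hidden point \<open>t\<close> forces \<open>b i * x i \<ge> y t i\<close> on the set \<open>D t\<close> where \<open>y t\<close> is positive. By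
  exchangeability a posterior sample \<open>s\<close> has the same expected score as \<open>t\<close>; hence the forced
  part of the score that it misses is compensated by noise outside \<open>D t\<close>.
\<close>

lemma exists_replica_law:
  fixes A :: "'t \<Rightarrow> nat set"
  assumes U: "finite U" "U \<noteq> {}" and A: "\<And>t. t \<in> U \<Longrightarrow> A t \<subseteq> {..<d}"
    and y: "\<And>t i. 0 \<le> y t i" "\<And>t i. t \<in> U \<Longrightarrow> i \<notin> A t \<Longrightarrow> y t i = 0"
    and w: "w > 0" "\<And>t. t \<in> U \<Longrightarrow> prob (orthant (A t) b (y t)) \<ge> w"
  shows "\<exists>R\<in>replica_laws U w.
    (\<Sum>t\<in>U. \<Sum>s\<in>U. R (t, s) * (\<Sum>i\<in>A t - A s. y t i)) \<le> expectation (\<lambda>x. MAX t\<in>U. \<Sum>i\<in>A t. b i * x i)"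
proof -
  define N where "N = real (card U)"
  have N0: "N > 0" using U by (simp add: N_def card_gt_0_iff)
  \<comment> \<open>Coordinates of level 0 are left unforced, since \<open>orthant_noise_le\<close>
    needs positive levels.\<close>
  define D where "D = (\<lambda>t. {i \<in> A t. y t i > 0})"
  have D: "D t \<subseteq> {..<d}" "D t \<subseteq> A t" if "t \<in> U" for t using A[OF that] by (auto simp: D_def)
  define F where "F = (\<lambda>t. orthant (D t) b (y t))"
  have Fs [measurable]: "F t \<in> sets \<mu>" if "t \<in> U" for t unfolding F_def by (rule sets_orthant[OF D(1)[OF that]])
  have pF: "prob (F t) \<ge> w" if "t \<in> U" for t
  proof -
    have "orthant (A t) b (y t) \<subseteq> F t" by (auto simp: F_def orthant_def D_def)
    then have "prob (orthant (A t) b (y t)) \<le> prob (F t)" by (rule finite_measure_mono[OF _ Fs[OF that]])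
    then show ?thesis using w(2)[OF that] by linarith
  qed
  \<comment> \<open>The density with respect to \<mu> of the observation when t is hidden. The list
    condition rests on its bound 1 / w.\<close>
  define \<phi> where "\<phi> = (\<lambda>x t. indicator (F t) x / prob (F t))"
  have \<phi>0: "0 \<le> \<phi> x t" for x t by (simp add: \<phi>_def)
  have \<phi>w: "\<phi> x t \<le> 1 / w" if "t \<in> U" for x t
    using pF[OF that] w(1) by (auto simp: \<phi>_def indicator_def intro!: divide_left_mono mult_pos_pos)
  have \<phi>m [measurable]: "(\<lambda>x. \<phi> x t) \<in> borel_measurable \<mu>" if "t \<in> U" for t
    unfolding \<phi>_def using Fs[OF that] by measurable
  define K where "K = (\<lambda>x t s. posterior_pair U (\<phi> x) t s)"
  have K0: "0 \<le> K x t s" if "t \<in> U" "s \<in> U" for x t s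
    unfolding K_def using that \<phi>0 by (intro posterior_pair_nonneg) auto
  have Ksum: "(\<Sum>s\<in>U. K x t s) = \<phi> x t" if "t \<in> U" for x t
    unfolding K_def using that \<phi>0 U by (intro sum_posterior_pair) auto
  have K_le: "K x t s \<le> \<phi> x t" if "t \<in> U" "s \<in> U" for x t s
    using member_le_sum[of s U "\<lambda>s. K x t s"] that U K0 Ksum by auto
  have Km [measurable]: "(\<lambda>x. K x t s) \<in> borel_measurable \<mu>" if "t \<in> U" "s \<in> U" for t s
    unfolding K_def posterior_pair_def using that \<phi>m
    by (intro borel_measurable_divide borel_measurable_times borel_measurable_sum) auto
  have Kint: "integrable \<mu> (\<lambda>x. K x t s)" if "t \<in> U" "s \<in> U" for t s
    using that Km K0 order_trans[OF K_le \<phi>w] by (intro integrable_const_bound[where B = "1 / w"]) auto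
  have \<phi>int: "integrable \<mu> (\<lambda>x. \<phi> x t)" if "t \<in> U" for t
    using that \<phi>m \<phi>0 \<phi>w by (intro integrable_const_bound[where B = "1 / w"]) auto
  have E\<phi>: "expectation (\<lambda>x. \<phi> x t) = 1" if "t \<in> U" for t
    using pF[OF that] w(1) Fs[OF that] by (simp add: \<phi>_def)
  define R where "R = (\<lambda>(t, s). expectation (\<lambda>x. K x t s) / N)"
  have "R \<in> replica_laws U w"
    unfolding replica_laws_def
  proof (intro CollectI conjI ballI allI impI)
    show "0 \<le> R (t, s)" if "t \<in> U" "s \<in> U" for t s
      using that K0 N0 by (auto simp: R_def intro!: divide_nonneg_pos integral_nonneg_AE)
    show "(\<Sum>s\<in>U. R (t, s)) = 1 / real (card U)" if t: "t \<in> U" for t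
    proof -
      have "(\<Sum>s\<in>U. expectation (\<lambda>x. K x t s)) = expectation (\<lambda>x. \<Sum>s\<in>U. K x t s)"
        using t Kint by (simp add: Bochner_Integration.integral_sum)
      then show ?thesis using t E\<phi> by (simp add: R_def Ksum N_def flip: sum_divide_distrib)
    qed
    fix \<Gamma> L assume \<Gamma>: "\<forall>s\<in>U. \<Gamma> s \<subseteq> U \<and> real (card (\<Gamma> s)) \<le> L"
    then have fin\<Gamma>: "finite (\<Gamma> s)" if "s \<in> U" for s using that U finite_subset by blast
    have L0: "0 \<le> L" using \<Gamma> U by (metis all_not_in_conv of_nat_0_le_iff order_trans)
    have "(\<Sum>s\<in>U. \<Sum>t\<in>\<Gamma> s. R (t, s)) = expectation (\<lambda>x. \<Sum>s\<in>U. \<Sum>t\<in>\<Gamma> s. K x t s) / N"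
    proof -
      have "expectation (\<lambda>x. \<Sum>s\<in>U. \<Sum>t\<in>\<Gamma> s. K x t s) = (\<Sum>s\<in>U. expectation (\<lambda>x. \<Sum>t\<in>\<Gamma> s. K x t s))"
        using \<Gamma> Kint by (intro Bochner_Integration.integral_sum Bochner_Integration.integrable_sum) blast
      also have "\<dots> = (\<Sum>s\<in>U. \<Sum>t\<in>\<Gamma> s. expectation (\<lambda>x. K x t s))"
        using \<Gamma> Kint by (intro sum.cong refl Bochner_Integration.integral_sum) blast
      finally show ?thesis by (simp add: R_def sum_divide_distrib)
    qed
    also have "\<dots> \<le> expectation (\<lambda>x. L / w) / N"
    proof (intro divide_right_mono integral_mono)
      show "integrable \<mu> (\<lambda>x. \<Sum>s\<in>U. \<Sum>t\<in>\<Gamma> s. K x t s)"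
        using \<Gamma> Kint by (intro Bochner_Integration.integrable_sum) blast
      fix x
      \<comment> \<open>Given the sample s, each of the at most L points in its list counts at most
        1 / w, and the sampling weights \<phi> x s / Q add up to at most 1.\<close>
      define Q where "Q = sum (\<phi> x) U"
      have Q0: "0 \<le> Q" using \<phi>0 by (simp add: Q_def sum_nonneg)
      have "(\<Sum>t\<in>\<Gamma> s. K x t s) \<le> L / w * (\<phi> x s / Q)" if s: "s \<in> U" for s
      proof -
        have "(\<Sum>t\<in>\<Gamma> s. K x t s) \<le> (\<Sum>t\<in>\<Gamma> s. 1 / w * (\<phi> x s / Q))"
        proof (intro sum_mono)
          fix t assume "t \<in> \<Gamma> s"
          then have t: "t \<in> U" using \<Gamma> s by auto
          have "K x t s = \<phi> x t * (\<phi> x s / Q)" by (simp add: K_def posterior_pair_def Q_def)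
          also have "\<dots> \<le> 1 / w * (\<phi> x s / Q)" using \<phi>w[OF t] \<phi>0 Q0 by (intro mult_right_mono) auto
          finally show "K x t s \<le> 1 / w * (\<phi> x s / Q)" .
        qed
        also have "\<dots> = real (card (\<Gamma> s)) * (1 / w * (\<phi> x s / Q))" by simp
        also have "\<dots> \<le> L * (1 / w * (\<phi> x s / Q))" using \<Gamma> s w(1) \<phi>0 Q0 by (intro mult_right_mono) auto
        finally show ?thesis by simp
      qed
      then have "(\<Sum>s\<in>U. \<Sum>t\<in>\<Gamma> s. K x t s) \<le> (\<Sum>s\<in>U. L / w * (\<phi> x s / Q))" by (rule sum_mono)
      also have "\<dots> = L / w * (Q / Q)" by (simp only: Q_def sum_distrib_left sum_divide_distrib)
      also have "\<dots> \<le> L / w * 1" using L0 w(1) by (intro mult_left_mono) auto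
      finally show "(\<Sum>s\<in>U. \<Sum>t\<in>\<Gamma> s. K x t s) \<le> L / w" by simp
    qed (use N0 in auto)
    also have "\<dots> = L / (real (card U) * w)" by (simp add: prob_space N_def)
    finally show "(\<Sum>s\<in>U. \<Sum>t\<in>\<Gamma> s. R (t, s)) \<le> L / (real (card U) * w)" .
  qed
  moreover have "(\<Sum>t\<in>U. \<Sum>s\<in>U. R (t, s) * (\<Sum>i\<in>A t - A s. y t i)) \<le> expectation (\<lambda>x. MAX t\<in>U. \<Sum>i\<in>A t. b i * x i)"
  proof -
    define a where "a = (\<lambda>t i. if i \<in> A t then b i else 0)"
    define J where "J = (\<lambda>t. {..<d} - D t)"
    define X where "X = (\<lambda>t x. \<Sum>i<d. a t i * x i)"
    define XJ where "XJ = (\<lambda>t x. \<Sum>i\<in>J t. a t i * x i)"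
    define G where "G = (\<lambda>t x. MAX s\<in>U. \<Sum>i\<in>J t. a s i * x i)"
    define Y where "Y = (\<lambda>t s. \<Sum>i\<in>A t - A s. y t i)"
    define S where "S = expectation (\<lambda>x. MAX t\<in>U. \<Sum>i\<in>A t. b i * x i)"
    have X_eq: "X t x = (\<Sum>i\<in>A t. b i * x i)" if "t \<in> U" for t x
      unfolding X_def a_def using A[OF that] by (intro sum.mono_neutral_cong_right) auto
    have SX: "S = expectation (\<lambda>x. MAX t\<in>U. \<Sum>i<d. a t i * x i)"
      unfolding S_def using X_eq by (intro Bochner_Integration.integral_cong refl arg_cong[where f = Max] image_cong) (auto simp: X_def)
    have pt: "(\<Sum>t\<in>U. \<Sum>s\<in>U. K x t s * Y t s) \<le> (\<Sum>t\<in>U. \<phi> x t * (G t x - XJ t x))" for x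
    proof -
      have "(\<Sum>t\<in>U. \<Sum>s\<in>U. K x t s * Y t s) \<le> (\<Sum>t\<in>U. \<Sum>s\<in>U. K x t s * (X t x - X s x + (G t x - XJ t x)))"
      proof (intro sum_mono)
        fix t s assume t: "t \<in> U" and s: "s \<in> U"
        show "K x t s * Y t s \<le> K x t s * (X t x - X s x + (G t x - XJ t x))"
        proof (cases "x \<in> F t")
          case False
          then have "K x t s = 0" by (simp add: K_def posterior_pair_def \<phi>_def)
          then show ?thesis by simp
        next
          case True
          have split: "(\<Sum>i<d. c i * x i) = (\<Sum>i\<in>D t. c i * x i) + (\<Sum>i\<in>J t. c i * x i)" for c
            unfolding J_def using D(1)[OF t] by (subst sum.subset_diff[of "D t"]) auto
          have "Y t s = (\<Sum>i\<in>D t - A s. y t i)"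
            unfolding Y_def
          proof (rule sum.mono_neutral_right)
            show "finite (A t - A s)" using A[OF t] finite_subset by blast
            show "\<forall>i\<in>A t - A s - (D t - A s). y t i = 0" using y(1) by (auto simp: D_def not_less intro: antisym)
          qed (auto simp: D_def)
          also have "\<dots> \<le> (\<Sum>i\<in>D t - A s. b i * x i)"
            using True by (intro sum_mono) (auto simp: F_def orthant_def)
          \<comment> \<open>All points use the same coefficients b, so on D t the scores of t and s
            differ only in the coordinates outside A s.\<close>
          also have "\<dots> = (\<Sum>i\<in>D t. (a t i - a s i) * x i)"
            using D(2)[OF t] finite_subset[OF D(1)[OF t]] by (intro sum.mono_neutral_cong_left) (auto simp: a_def)
          also have "\<dots> = (X t x - X s x) + ((\<Sum>i\<in>J t. a s i * x i) - XJ t x)"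
            unfolding X_def XJ_def split by (simp add: left_diff_distrib sum_subtractf)
          also have "(\<Sum>i\<in>J t. a s i * x i) \<le> G t x"
            unfolding G_def using s U by (intro Max_ge) auto
          finally show ?thesis using K0[OF t s] by (intro mult_left_mono) auto
        qed
      qed
      also have "\<dots> = (\<Sum>t\<in>U. \<Sum>s\<in>U. K x t s * (X t x - X s x)) + (\<Sum>t\<in>U. \<Sum>s\<in>U. K x t s * (G t x - XJ t x))"
        by (simp add: distrib_left sum.distrib)
      also have "(\<Sum>t\<in>U. \<Sum>s\<in>U. K x t s * (X t x - X s x)) = 0"
        using sum_posterior_pair_swap[of U "\<phi> x" "\<lambda>t s. X t x"]
        by (simp add: K_def right_diff_distrib sum_subtractf)
      also have "(\<Sum>t\<in>U. \<Sum>s\<in>U. K x t s * (G t x - XJ t x)) = (\<Sum>t\<in>U. \<phi> x t * (G t x - XJ t x))"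
        by (simp add: Ksum flip: sum_distrib_right)
      finally show ?thesis by simp
    qed
    have intG: "integrable \<mu> (\<lambda>x. \<phi> x t * G t x)" and EG: "expectation (\<lambda>x. \<phi> x t * G t x) \<le> S" if t: "t \<in> U" for t
    proof -
      have "integrable \<mu> (G t)" unfolding G_def by (intro integrable_Max_linear U) (auto simp: J_def)
      then have "integrable \<mu> (\<lambda>x. indicator (F t) x * G t x)"
        using Fs[OF t] by (auto intro: integrable_real_mult_indicator simp: mult.commute)
      then show "integrable \<mu> (\<lambda>x. \<phi> x t * G t x)" by (simp add: \<phi>_def)
      have "expectation (\<lambda>x. indicator (F t) x * G t x) \<le> prob (F t) * S"
        unfolding F_def G_def SX J_def by (intro orthant_noise_le D U t) (auto simp: D_def)
      then have "expectation (\<lambda>x. indicator (F t) x * G t x) / prob (F t) \<le> S"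
        using pF[OF t] w(1) by (simp add: divide_le_eq mult.commute)
      then show "expectation (\<lambda>x. \<phi> x t * G t x) \<le> S" by (simp add: \<phi>_def)
    qed
    have intX: "integrable \<mu> (\<lambda>x. \<phi> x t * XJ t x)" and EX: "expectation (\<lambda>x. \<phi> x t * XJ t x) = 0" if t: "t \<in> U" for t
    proof -
      have eq: "\<phi> x t * XJ t x = (\<Sum>i\<in>J t. a t i / prob (F t) * (indicator (F t) x * x i))" for x
        by (simp add: \<phi>_def XJ_def sum_distrib_left sum_divide_distrib algebra_simps)
      have I: "integrable \<mu> (\<lambda>x. indicator (F t) x * x i)" if "i \<in> J t" for i
        using that Fs[OF t] integrable_coord[of i] by (auto intro: integrable_real_mult_indicator simp: mult.commute J_def)
      show "integrable \<mu> (\<lambda>x. \<phi> x t * XJ t x)" unfolding eq using I by (intro Bochner_Integration.integrable_sum) auto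
      have "expectation (\<lambda>x. \<phi> x t * XJ t x) = (\<Sum>i\<in>J t. a t i / prob (F t) * expectation (\<lambda>x. indicator (F t) x * x i))"
        unfolding eq using I by (subst Bochner_Integration.integral_sum) auto
      also have "\<dots> = 0"
        unfolding F_def using D(1)[OF t] by (intro sum.neutral) (auto simp: J_def expectation_orthant_coord)
      finally show "expectation (\<lambda>x. \<phi> x t * XJ t x) = 0" .
    qed
    have "N * (\<Sum>t\<in>U. \<Sum>s\<in>U. R (t, s) * Y t s) = expectation (\<lambda>x. \<Sum>t\<in>U. \<Sum>s\<in>U. K x t s * Y t s)"
    proof -
      have "expectation (\<lambda>x. \<Sum>t\<in>U. \<Sum>s\<in>U. K x t s * Y t s) = (\<Sum>t\<in>U. expectation (\<lambda>x. \<Sum>s\<in>U. K x t s * Y t s))"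
        using Kint by (intro Bochner_Integration.integral_sum Bochner_Integration.integrable_sum) auto
      also have "\<dots> = (\<Sum>t\<in>U. \<Sum>s\<in>U. expectation (\<lambda>x. K x t s * Y t s))"
        using Kint by (intro sum.cong refl Bochner_Integration.integral_sum) auto
      finally show ?thesis using N0 by (simp add: R_def sum_distrib_left)
    qed
    also have "\<dots> \<le> expectation (\<lambda>x. \<Sum>t\<in>U. \<phi> x t * (G t x - XJ t x))"
      using Kint intG intX by (intro integral_mono pt Bochner_Integration.integrable_sum) (auto simp: right_diff_distrib)
    also have "\<dots> = (\<Sum>t\<in>U. expectation (\<lambda>x. \<phi> x t * G t x) - expectation (\<lambda>x. \<phi> x t * XJ t x))"
      using intG intX by (simp add: right_diff_distrib Bochner_Integration.integral_sum)
    also have "\<dots> \<le> (\<Sum>t\<in>U. S)" using EG EX by (intro sum_mono) auto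
    also have "\<dots> = N * S" by (simp add: N_def)
    finally show ?thesis using N0 by (simp add: Y_def S_def)
  qed
  ultimately show ?thesis by blast
qed

section \<open>Minoration for families of coordinate sets\<close>

lemma integrable_sum_abs_powr:
  assumes D: "D \<subseteq> {..<d}" and P: "P > 0"
  shows "integrable \<mu> (\<lambda>x. (\<Sum>i\<in>D. \<bar>b i * x i\<bar>) powr P)"
proof (rule Bochner_Integration.integrable_bound)
  have fin: "finite D" using D finite_subset by blast
  have "integrable \<mu> (\<lambda>x. \<bar>b i * x i\<bar> powr P)" if "i \<in> D" for i
  proof -
    have "i < d" using that D by auto
    then show ?thesis
      using integrable_inner_abs_powr[OF P, of "unit_coeff i (b i)"] by (simp add: inner_unit_coeff)
  qed
  then show "integrable \<mu> (\<lambda>x. real (card D) powr P * (\<Sum>i\<in>D. \<bar>b i * x i\<bar> powr P))" by simp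
  show "AE x in \<mu>. norm ((\<Sum>i\<in>D. \<bar>b i * x i\<bar>) powr P) \<le> norm (real (card D) powr P * (\<Sum>i\<in>D. \<bar>b i * x i\<bar> powr P))"
    by (intro AE_I2) (simp add: sum_nonneg powr_sum_le[OF fin P])
  have [measurable]: "(\<lambda>x. \<Sum>i\<in>D. \<bar>b i * x i\<bar>) \<in> borel_measurable \<mu>"
    using D by (intro borel_measurable_sum borel_measurable_abs borel_measurable_times measurable_coord) auto
  show "(\<lambda>x. (\<Sum>i\<in>D. \<bar>b i * x i\<bar>) powr P) \<in> borel_measurable \<mu>" by measurable
qed

text \<open>By \<open>replica_payoff\<close> each replica law is answered by some choice of forced
  subsets. Minimax turns these into one mixture of levels that is good against all replica laws, and
  \<open>exists_replica_law\<close> applied to the mixture bounds its payoff by the expected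
  maximum. The constant is 80 * 64, from v = \<alpha> P / 80 and half of v / 32.\<close>

lemma minoration_sets:
  fixes A :: "'t \<Rightarrow> nat set" and b :: "nat \<Rightarrow> real"
  assumes U: "finite U" "U \<noteq> {}" and A: "\<And>t. t \<in> U \<Longrightarrow> A t \<subseteq> {..<d}"
    and card_A: "\<And>t. t \<in> U \<Longrightarrow> real (card (A t)) \<le> P / 96"
    and P: "P \<ge> 6" and card_U: "real (card U) \<ge> exp (P / 2)" and \<alpha>: "\<alpha> > 0"
    and sep: "\<And>s t. s \<in> U \<Longrightarrow> t \<in> U \<Longrightarrow> s \<noteq> t \<Longrightarrow>
      expectation (\<lambda>x. (\<Sum>i\<in>A t - A s. \<bar>b i * x i\<bar>) powr P) \<ge> (4 * \<alpha> * P) powr P \<or>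
      expectation (\<lambda>x. (\<Sum>i\<in>A s - A t. \<bar>b i * x i\<bar>) powr P) \<ge> (4 * \<alpha> * P) powr P"
  shows "expectation (\<lambda>x. MAX t\<in>U. \<Sum>i\<in>A t. b i * x i) \<ge> \<alpha> * P / 5120"
proof -
  define big where "big = (\<lambda>D. D \<subseteq> {..<d} \<and> expectation (\<lambda>x. (\<Sum>i\<in>D. \<bar>b i * x i\<bar>) powr P) \<ge> (4 * \<alpha> * P) powr P)"
  \<comment> \<open>The exponent pays 1/96 for the cardinality and 5 * 1/80 for the level \<epsilon>
    = 1/80; then 5/96 + q = 1/8, as \<open>replica_payoff\<close> requires.\<close>
  define q where "q = (7/96 :: real)"
  define w where "w = exp (- q * P)"
  define v where "v = \<alpha> * P / 80"
  have v: "v > 0" using \<alpha> P by (simp add: v_def)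
  have finA: "finite (A t)" if "t \<in> U" for t using A[OF that] finite_subset by blast
  have level: "\<exists>z. (\<forall>i. 0 \<le> z i) \<and> (\<forall>i. i \<notin> D \<longrightarrow> z i = 0) \<and> sum z D = v \<and> prob (orthant (A t) b z) \<ge> w"
    if t: "t \<in> U" and D: "D \<subseteq> A t" and "big D" for t D
  proof -
    have c: "real (card (A t)) \<le> P" using card_A[OF t] P by simp
    obtain z where z: "\<And>i. 0 \<le> z i" "\<And>i. i \<notin> D \<Longrightarrow> z i = 0" "sum z D = 1/80 * \<alpha> * P"
      "prob (orthant (A t) b z) \<ge> exp (- (card (A t) + 5 * (1/80) * P))"
      by (rule exists_level_vector[OF A[OF t] D _ c \<alpha>, of "1/80"]) (use P \<open>big D\<close> in \<open>auto simp: big_def\<close>)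
    have "w \<le> exp (- (card (A t) + 5 * (1/80) * P))" using card_A[OF t] by (simp add: w_def q_def)
    then show ?thesis using z by (intro exI[of _ z]) (auto simp: v_def)
  qed
  define \<zeta> where "\<zeta> = (\<lambda>t D. SOME z. (\<forall>i. 0 \<le> z i) \<and> (\<forall>i. i \<notin> D \<longrightarrow> z i = 0) \<and> sum z D = v \<and> prob (orthant (A t) b z) \<ge> w)"
  have \<zeta>: "\<forall>i. 0 \<le> \<zeta> t D i" "\<forall>i. i \<notin> D \<longrightarrow> \<zeta> t D i = 0" "sum (\<zeta> t D) D = v" "prob (orthant (A t) b (\<zeta> t D)) \<ge> w"
    if "t \<in> U" "D \<subseteq> A t" "big D" for t D
    using someI_ex[OF level[OF that]] unfolding \<zeta>_def by auto
  \<comment> \<open>If D is not big nothing is forced; the level 0 is feasible too.\<close>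
  define Y where "Y = (\<lambda>t D i. if big D then \<zeta> t D i else 0)"
  have Y0: "0 \<le> Y t D i" and Y_off: "i \<notin> A t \<Longrightarrow> Y t D i = 0" and Y_prob: "prob (orthant (A t) b (Y t D)) \<ge> w"
    if t: "t \<in> U" and D: "D \<subseteq> A t" for t D i
  proof -
    show "0 \<le> Y t D i" using \<zeta>(1)[OF t D] by (auto simp: Y_def)
    show "i \<notin> A t \<Longrightarrow> Y t D i = 0" using \<zeta>(2)[OF t D] D by (auto simp: Y_def)
    show "prob (orthant (A t) b (Y t D)) \<ge> w"
    proof (cases "big D")
      case True
      then show ?thesis using \<zeta>(4)[OF t D] by (simp add: Y_def)
    next
      case False
      have "1 \<le> 2 ^ card (A t) * prob (orthant (A t) b (\<lambda>_. 0))"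
        using prob_abs_le_orthant[OF A[OF t], of "\<lambda>_. 0" b] by (simp add: prob_space)
      also have "\<dots> \<le> exp 1 ^ card (A t) * prob (orthant (A t) b (\<lambda>_. 0))"
        using exp_ge_add_one_self[of 1] by (intro mult_right_mono power_mono) auto
      also have "exp 1 ^ card (A t) = exp (real (card (A t)))" by (simp flip: exp_of_nat_mult)
      also have "\<dots> * prob (orthant (A t) b (\<lambda>_. 0)) \<le> exp (q * P) * prob (orthant (A t) b (\<lambda>_. 0))"
        using card_A[OF t] P by (intro mult_right_mono) (auto simp: q_def)
      finally show ?thesis using False by (simp add: Y_def w_def exp_minus field_simps)
    qed
  qed
  \<comment> \<open>Pure strategies, one subset of A t for each t. There are finitely many; the
    opponents are the replica laws.\<close>
  define Z where "Z = PiE U (\<lambda>t. Pow (A t))"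
  have finZ: "finite Z" using U finA by (auto simp: Z_def intro!: finite_PiE)
  have "(\<lambda>t\<in>U. {}) \<in> Z" by (auto simp: Z_def)
  then have Zne: "Z \<noteq> {}" by auto
  have ZD: "D t \<subseteq> A t" if "D \<in> Z" "t \<in> U" for D t using that by (auto simp: Z_def PiE_iff)
  define f where "f = (\<lambda>D R. \<Sum>t\<in>U. \<Sum>s\<in>U. R (t, s) * (\<Sum>i\<in>A t - A s. Y t (D t) i))"
  define K where "K = (\<Sum>D\<in>Z. \<Sum>t\<in>U. \<Sum>s\<in>U. \<Sum>i\<in>A t - A s. Y t (D t) i)"
  have inner0: "0 \<le> (\<Sum>i\<in>A t - A s. Y t (D t) i)" if "D \<in> Z" "t \<in> U" for D t s
    using Y0[OF that(2) ZD[OF that]] by (intro sum_nonneg) auto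
  have Rbnd: "0 \<le> R (t, s)" "R (t, s) \<le> 1" if R: "R \<in> replica_laws U w" and t: "t \<in> U" and s: "s \<in> U" for R t s
  proof -
    show "0 \<le> R (t, s)" using R t s by (simp add: replica_laws_def)
    have "R (t, s) \<le> (\<Sum>s\<in>U. R (t, s))" using R t s U by (intro member_le_sum) (auto simp: replica_laws_def)
    also have "\<dots> = 1 / real (card U)" using R t by (simp add: replica_laws_def)
    also have "\<dots> \<le> 1" using U by (simp add: card_gt_0_iff Suc_le_eq)
    finally show "R (t, s) \<le> 1" .
  qed
  obtain l where l: "\<And>D. D \<in> Z \<Longrightarrow> 0 \<le> l D" "sum l Z = 1"
    and l_val: "\<And>R. R \<in> replica_laws U w \<Longrightarrow> (\<Sum>D\<in>Z. l D * f D R) \<ge> v / 64"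
  \<comment> \<open>The lemma attains each value below v / 32; half of it is taken.\<close>
  proof (rule finite_minimax[OF finZ Zne, of "replica_laws U w" f K "v / 32" "v / 64"])
    show "(\<lambda>x. (1 - u) * R x + u * R' x) \<in> replica_laws U w"
      if "R \<in> replica_laws U w" "R' \<in> replica_laws U w" "0 \<le> u" "u \<le> 1" for R R' u
      using that by (rule replica_laws_convex)
    show "f D (\<lambda>x. (1 - u) * R x + u * R' x) = (1 - u) * f D R + u * f D R'" for D R R' u
      by (simp add: f_def distrib_right sum.distrib sum_distrib_left mult.assoc)
    show "\<bar>f D R\<bar> \<le> K" if D: "D \<in> Z" and R: "R \<in> replica_laws U w" for D R
    proof -
      have "0 \<le> f D R" unfolding f_def using inner0[OF D] Rbnd[OF R] by (intro sum_nonneg[of U] mult_nonneg_nonneg)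
      moreover have "f D R \<le> (\<Sum>t\<in>U. \<Sum>s\<in>U. \<Sum>i\<in>A t - A s. Y t (D t) i)"
        unfolding f_def using inner0[OF D] Rbnd[OF R] by (intro sum_mono mult_left_le_one_le)
      moreover have "\<dots> \<le> K"
        unfolding K_def using finZ D inner0 by (intro member_le_sum[of D Z] sum_nonneg[of U]) auto
      ultimately show ?thesis by simp
    qed
    show "\<exists>D\<in>Z. v / 32 \<le> f D R" if R: "R \<in> replica_laws U w" for R
    proof -
      have "\<exists>D. (\<forall>t\<in>U. D t \<subseteq> A t) \<and>
        (\<Sum>t\<in>U. \<Sum>s\<in>U. R (t, s) * (\<Sum>i\<in>A t - A s. if big (D t) then \<zeta> t (D t) i else 0)) \<ge> v / 32"
      proof (rule replica_payoff[where \<kappa> = "1/96" and q = q and P = P and w = w])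
        show "real (card (A t)) \<le> 1/96 * P" if "t \<in> U" for t using card_A[OF that] by simp
        show "big (A t - A s) \<or> big (A s - A t)" if "s \<in> U" "t \<in> U" "s \<noteq> t" for s t
          using sep[OF that] A[OF that(1)] A[OF that(2)] by (auto simp: big_def)
        show "big E" if "t \<in> U" "D \<subseteq> E" "E \<subseteq> A t" "big D" for t D E
        proof -
          have E: "E \<subseteq> {..<d}" "D \<subseteq> {..<d}" using that A[OF that(1)] by auto
          then have "finite E" using finite_subset by blast
          then have "expectation (\<lambda>x. (\<Sum>i\<in>D. \<bar>b i * x i\<bar>) powr P) \<le> expectation (\<lambda>x. (\<Sum>i\<in>E. \<bar>b i * x i\<bar>) powr P)"
            using E P \<open>D \<subseteq> E\<close> by (intro integral_mono integrable_sum_abs_powr powr_mono2 sum_mono2) (auto intro: sum_nonneg)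
          then show ?thesis using \<open>big D\<close> E by (simp add: big_def)
        qed
      qed (use U finA \<zeta> v card_U w_def P R in \<open>auto simp: q_def\<close>)
      then obtain D where D: "\<forall>t\<in>U. D t \<subseteq> A t"
        "(\<Sum>t\<in>U. \<Sum>s\<in>U. R (t, s) * (\<Sum>i\<in>A t - A s. Y t (D t) i)) \<ge> v / 32"
        by (auto simp: Y_def)
      have "restrict D U \<in> Z" using D(1) by (auto simp: Z_def)
      moreover have "v / 32 \<le> f (restrict D U) R" using D(2) by (simp add: f_def)
      ultimately show ?thesis by blast
    qed
  qed (use v in auto)
  \<comment> \<open>Mixing the levels, and not the events they force, keeps one likelihood for each
    t; the payoff is linear in the levels.\<close>
  define y where "y = (\<lambda>t i. if t \<in> U then \<Sum>D\<in>Z. l D * Y t (D t) i else 0)"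
  have "\<exists>R\<in>replica_laws U w.
    (\<Sum>t\<in>U. \<Sum>s\<in>U. R (t, s) * (\<Sum>i\<in>A t - A s. y t i)) \<le> expectation (\<lambda>x. MAX t\<in>U. \<Sum>i\<in>A t. b i * x i)"
  proof (rule exists_replica_law[OF U A])
    show "0 \<le> y t i" for t i using l(1) Y0 ZD by (auto simp: y_def intro!: sum_nonneg)
    show "y t i = 0" if "t \<in> U" "i \<notin> A t" for t i using that Y_off ZD by (auto simp: y_def intro!: sum.neutral)
    show "w > 0" by (simp add: w_def)
    show "w \<le> prob (orthant (A t) b (y t))" if t: "t \<in> U" for t
    proof -
      have "y t = (\<lambda>i. \<Sum>D\<in>Z. l D * Y t (D t) i)" using t by (simp add: y_def)
      then show ?thesis
        using orthant_convex_comb[OF A[OF t] finZ l(2,1), where b = b and w = "\<lambda>D. Y t (D t)" and q = w] Y_prob[OF t ZD[OF _ t]] by (simp add: w_def)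
    qed
  qed
  then obtain R where R: "R \<in> replica_laws U w"
    "(\<Sum>t\<in>U. \<Sum>s\<in>U. R (t, s) * (\<Sum>i\<in>A t - A s. y t i)) \<le> expectation (\<lambda>x. MAX t\<in>U. \<Sum>i\<in>A t. b i * x i)" by blast
  have "(\<Sum>D\<in>Z. l D * f D R) = (\<Sum>t\<in>U. \<Sum>s\<in>U. R (t, s) * (\<Sum>i\<in>A t - A s. y t i))"
  proof -
    have "(\<Sum>D\<in>Z. l D * f D R) = (\<Sum>D\<in>Z. \<Sum>t\<in>U. \<Sum>s\<in>U. l D * (R (t, s) * (\<Sum>i\<in>A t - A s. Y t (D t) i)))"
      by (simp add: f_def sum_distrib_left)
    also have "\<dots> = (\<Sum>t\<in>U. \<Sum>s\<in>U. \<Sum>D\<in>Z. l D * (R (t, s) * (\<Sum>i\<in>A t - A s. Y t (D t) i)))"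
      by (subst sum.swap, intro sum.cong refl, subst sum.swap, rule refl)
    also have "\<dots> = (\<Sum>t\<in>U. \<Sum>s\<in>U. R (t, s) * (\<Sum>i\<in>A t - A s. y t i))"
    proof (intro sum.cong refl)
      fix t s assume t: "t \<in> U"
      have "(\<Sum>i\<in>A t - A s. y t i) = (\<Sum>i\<in>A t - A s. \<Sum>D\<in>Z. l D * Y t (D t) i)" using t by (simp add: y_def)
      also have "\<dots> = (\<Sum>D\<in>Z. l D * (\<Sum>i\<in>A t - A s. Y t (D t) i))" by (subst sum.swap) (simp add: sum_distrib_left)
      finally show "(\<Sum>D\<in>Z. l D * (R (t, s) * (\<Sum>i\<in>A t - A s. Y t (D t) i))) = R (t, s) * (\<Sum>i\<in>A t - A s. y t i)"
        by (simp add: sum_distrib_left mult.left_commute)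
    qed
    finally show ?thesis .
  qed
  then have "v / 64 \<le> expectation (\<lambda>x. MAX t\<in>U. \<Sum>i\<in>A t. b i * x i)" using l_val[OF R(1)] R(2) by linarith
  then show ?thesis by (simp add: v_def)
qed

end

section \<open>The minoration\<close>

lemma powr_add_le_3:
  fixes x y z :: real
  assumes "p > 0"
  shows "\<bar>x + y + z\<bar> powr p \<le> 3 powr p * (\<bar>x\<bar> powr p + \<bar>y\<bar> powr p + \<bar>z\<bar> powr p)"
proof -
  have "\<bar>x + y + z\<bar> powr p \<le> (\<bar>x\<bar> + \<bar>y\<bar> + \<bar>z\<bar>) powr p" using assms by (intro powr_mono2) auto
  also have "\<dots> \<le> 3 powr p * (\<bar>x\<bar> powr p + \<bar>y\<bar> powr p + \<bar>z\<bar> powr p)"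
    using powr_sum_le[of "{0, 1, 2::nat}" p "\<lambda>i. if i = 0 then \<bar>x\<bar> else if i = 1 then \<bar>y\<bar> else \<bar>z\<bar>"] assms
    by (simp add: algebra_simps)
  finally show ?thesis .
qed

lemma powr_add_le_2:
  fixes x y :: real
  assumes "p > 0"
  shows "\<bar>x + y\<bar> powr p \<le> 2 powr p * (\<bar>x\<bar> powr p + \<bar>y\<bar> powr p)"
proof -
  have "\<bar>x + y\<bar> powr p \<le> (\<bar>x\<bar> + \<bar>y\<bar>) powr p" using assms by (intro powr_mono2) auto
  also have "\<dots> \<le> 2 powr p * (\<bar>x\<bar> powr p + \<bar>y\<bar> powr p)"
    using powr_sum_le[of "{0, 1::nat}" p "\<lambda>i. if i = 0 then \<bar>x\<bar> else \<bar>y\<bar>"] assms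
    by (simp add: algebra_simps)
  finally show ?thesis .
qed

context na_law
begin

lemma expectation_inner: "expectation (Rd_inner d u) = 0"
proof -
  have "expectation (Rd_inner d u) = expectation (\<lambda>x. Rd_inner d u (flip (\<lambda>_. -1) x))"
    by (rule integral_flip[symmetric]) auto
  then show ?thesis by (simp add: inner_flip_all)
qed

lemma expectation_Max_mono:
  assumes "finite T" "U \<subseteq> T" "U \<noteq> {}"
  shows "expectation (\<lambda>x. MAX t\<in>U. Rd_inner d t x) \<le> expectation (\<lambda>x. MAX t\<in>T. Rd_inner d t x)"
proof (rule integral_mono)
  have "finite U" "T \<noteq> {}" using assms finite_subset by auto
  then show "integrable \<mu> (\<lambda>x. MAX t\<in>U. Rd_inner d t x)" "integrable \<mu> (\<lambda>x. MAX t\<in>T. Rd_inner d t x)"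
    unfolding Rd_inner_def using assms by (auto intro!: integrable_Max_linear)
qed (use assms in \<open>auto intro!: Max_mono\<close>)

text \<open>For bounded \<open>P\<close> two points suffice, since all moments of a linear functional are comparable.\<close>

lemma minoration_small:
  assumes T: "finite T" "s \<in> T" "t \<in> T" and P: "1 \<le> P" "P \<le> 6" and a: "a > 0"
    and mom: "expectation (\<lambda>x. \<bar>Rd_inner d (\<lambda>i. t i - s i) x\<bar> powr P) \<ge> a powr P"
  shows "expectation (\<lambda>x. MAX t\<in>T. Rd_inner d t x) \<ge> a / 576"
proof -
  define u where "u = (\<lambda>i. t i - s i)"
  have u: "Rd_inner d u x = Rd_inner d t x - Rd_inner d s x" for x
    by (simp add: u_def Rd_inner_def left_diff_distrib sum_subtractf)
  define m where "m = expectation (\<lambda>x. \<bar>Rd_inner d u x\<bar>)"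
  have intu: "integrable \<mu> (\<lambda>x. \<bar>Rd_inner d u x\<bar>)" using integrable_inner by simp
  have m0: "m > 0"
  proof (rule ccontr)
    assume "\<not> m > 0"
    moreover have "m \<ge> 0" by (simp add: m_def)
    ultimately have "m = 0" by simp
    then have "AE x in \<mu>. Rd_inner d u x = 0"
      using integral_nonneg_eq_0_iff_AE[OF intu] by (simp add: m_def)
    then have "expectation (\<lambda>x. \<bar>Rd_inner d u x\<bar> powr P) = expectation (\<lambda>x. 0)"
      by (intro integral_cong_AE) auto
    moreover have "0 < a powr P" using a by simp
    ultimately show False using mom by (simp add: u_def)
  qed
  note E = exp_moment_mean[OF m_def[symmetric] m0]
  have "a powr P \<le> expectation (\<lambda>x. \<bar>Rd_inner d u x\<bar> powr P)" using mom by (simp add: u_def)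
  also have "\<dots> \<le> expectation (\<lambda>x. (4 * m) powr P * (P powr P * exp \<bar>Rd_inner d u x / (4 * m)\<bar>))"
  proof (rule integral_mono)
    show "integrable \<mu> (\<lambda>x. \<bar>Rd_inner d u x\<bar> powr P)" using P by (intro integrable_inner_abs_powr) auto
    show "integrable \<mu> (\<lambda>x. (4 * m) powr P * (P powr P * exp \<bar>Rd_inner d u x / (4 * m)\<bar>))" using E(1) by simp
    fix x
    have "\<bar>Rd_inner d u x\<bar> powr P = (4 * m) powr P * \<bar>Rd_inner d u x / (4 * m)\<bar> powr P"
      using m0 by (simp add: abs_divide flip: powr_mult)
    also have "\<dots> \<le> (4 * m) powr P * (P powr P * exp \<bar>Rd_inner d u x / (4 * m)\<bar>)"
      using P by (intro mult_left_mono powr_le_exp) auto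
    finally show "\<bar>Rd_inner d u x\<bar> powr P \<le> (4 * m) powr P * (P powr P * exp \<bar>Rd_inner d u x / (4 * m)\<bar>)" .
  qed
  also have "\<dots> = (4 * m) powr P * (P powr P * expectation (\<lambda>x. exp \<bar>Rd_inner d u x / (4 * m)\<bar>))"
    by simp
  also have "\<dots> \<le> (4 * m) powr P * (P powr P * 12)" using E(2) by (intro mult_left_mono) auto
  also have "\<dots> \<le> (4 * m) powr P * (P powr P * 12 powr P)" using P powr_mono[of 1 P 12] by (intro mult_left_mono) auto
  also have "\<dots> = (48 * m * P) powr P" using m0 P by (simp add: mult_ac flip: powr_mult)
  finally have "a powr P \<le> (48 * m * P) powr P" .
  then have "a \<le> 48 * m * P" using powr_less_mono2[of P "48 * m * P" a] m0 P by force
  also have "\<dots> \<le> 48 * m * 6" using P m0 by (intro mult_left_mono) auto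
  finally have am: "a / 576 \<le> m / 2" by simp
  have intM: "integrable \<mu> (\<lambda>x. MAX t\<in>T. Rd_inner d t x)"
    unfolding Rd_inner_def using T by (intro integrable_Max_linear) auto
  \<comment> \<open>Linear functionals have mean 0, and the larger of two numbers is half their sum
    plus half the modulus of their difference.\<close>
  have "m / 2 = expectation (\<lambda>x. (\<bar>Rd_inner d u x\<bar> + Rd_inner d t x + Rd_inner d s x) / 2)"
    using integrable_inner expectation_inner intu by (simp add: m_def)
  also have "\<dots> \<le> expectation (\<lambda>x. MAX t\<in>T. Rd_inner d t x)"
  proof (rule integral_mono)
    show "integrable \<mu> (\<lambda>x. (\<bar>Rd_inner d u x\<bar> + Rd_inner d t x + Rd_inner d s x) / 2)"
      using integrable_inner intu by simp
    fix x
    have "Rd_inner d r x \<le> (MAX t\<in>T. Rd_inner d t x)" if "r \<in> T" for r using that T by (intro Max_ge) auto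
    from this[OF T(2)] this[OF T(3)]
    show "(\<bar>Rd_inner d u x\<bar> + Rd_inner d t x + Rd_inner d s x) / 2 \<le> (MAX t\<in>T. Rd_inner d t x)"
      unfolding u by (simp add: abs_if)
  qed (rule intM)
  finally show ?thesis using am by linarith
qed

text \<open>
  In the units \<open>u t i = P (t i - t0 i) E|x i| / (\<delta> a)\<close>, the localized points have few coordinates
  \<open>\<ge> 1\<close>, which retention makes two-valued; the remaining part \<open>\<rho>\<close> is negligible in \<open>L\<^sup>P\<close>.
\<close>

lemma minoration_large:
  assumes T: "finite T" "T \<noteq> {}" and P: "P \<ge> 6" and card_T: "real (card T) \<ge> exp P" and a: "a > 0"
    and sep: "\<And>s t. s \<in> T \<Longrightarrow> t \<in> T \<Longrightarrow> s \<noteq> t \<Longrightarrow>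
      expectation (\<lambda>x. \<bar>Rd_inner d (\<lambda>i. t i - s i) x\<bar> powr P) \<ge> a powr P"
  shows "expectation (\<lambda>x. MAX t\<in>T. Rd_inner d t x) \<ge> a / 18432000"
proof (rule ccontr)
  define S where "S = expectation (\<lambda>x. MAX t\<in>T. Rd_inner d t x)"
  assume "\<not> ?thesis"
  then have S: "S < a / 18432000" by (simp add: S_def)
  \<comment> \<open>Localization and retention together lose a factor exp (117 \<kappa> P), at most
    exp (P / 2); also \<kappa> \<le> 1/96, for the cardinality of A t.\<close>
  define \<kappa> :: real where "\<kappa> = 1/240"
  \<comment> \<open>Chosen so that the neglected part has L^P norm at most 16 * 6 * \<delta> * a
    \<le> a / 12. The constant 18432000 is 64 / (\<kappa> \<delta>).\<close>
  define \<delta> :: real where "\<delta> = 1/1200"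
  define \<tau> where "\<tau> = (\<lambda>t i. 1 / (\<delta> * a) * (t i * mean_abs i - 0))"
  have \<delta>0: "\<delta> > 0" by (simp add: \<delta>_def)
  have \<delta>a: "\<delta> * a > 0" using a by (simp add: \<delta>_def)
  have "rad {..<d} T \<tau> = 1 / (\<delta> * a) * rad {..<d} T (\<lambda>t i. t i * mean_abs i)"
    unfolding \<tau>_def using T \<delta>a by (intro rad_affine) auto
  also have "\<dots> \<le> 1 / (\<delta> * a) * S"
    unfolding S_def Rd_inner_def using T \<delta>a by (intro mult_left_mono rad_le_expectation) auto
  also have "\<dots> \<le> 1 / (\<delta> * a) * (a / 18432000)" using S \<delta>a by (intro mult_left_mono) auto
  also have "\<dots> = \<kappa> / 64" using a by (simp add: \<delta>_def \<kappa>_def)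
  finally have rad: "rad {..<d} T \<tau> \<le> \<kappa> / 64" .
  obtain U0 t0 where U0: "U0 \<subseteq> T" "t0 \<in> T" "card U0 \<ge> card T * exp (- 100 * \<kappa> * P)"
    and ball: "\<And>t. t \<in> U0 \<Longrightarrow> (\<Sum>i<d. trunc_sq (P * (\<tau> t i - \<tau> t0 i))) \<le> \<kappa> * P"
    by (rule rademacher_localization[OF _ T _ _ rad, of P]) (use P in \<open>auto simp: \<kappa>_def\<close>)
  define u where "u = (\<lambda>t i. P * (\<tau> t i - \<tau> t0 i))"
  have finU0: "finite U0" using U0 T finite_subset by blast
  obtain v U where U: "U \<subseteq> U0" "card U \<ge> card U0 * exp (- 17 * (\<kappa> * P))"
    and ret: "\<And>t i. t \<in> U \<Longrightarrow> i \<in> {..<d} \<Longrightarrow> \<bar>u t i\<bar> \<ge> 1 \<Longrightarrow>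
       1 \<le> \<bar>v i\<bar> \<and> \<bar>v i\<bar> \<le> \<bar>u t i\<bar> \<and> \<bar>u t i - v i\<bar> \<le> 1/16"
    by (rule retention[OF _ finU0, of "{..<d}" u "\<kappa> * P"]) (use ball in \<open>auto simp: u_def\<close>)
  have UT: "U \<subseteq> T" using U U0 by auto
  have finU: "finite U" using UT T finite_subset by blast
  have ball_U: "(\<Sum>i<d. trunc_sq (u t i)) \<le> \<kappa> * P" if "t \<in> U" for t
    using ball U that by (auto simp: u_def)
  have card_U: "real (card U) \<ge> exp (P / 2)"
  proof -
    have "exp (P / 2) \<le> exp (P + - 100 * \<kappa> * P + - 17 * (\<kappa> * P))" using P by (simp add: \<kappa>_def)
    also have "\<dots> = exp P * exp (- 100 * \<kappa> * P) * exp (- 17 * (\<kappa> * P))" by (simp only: exp_add)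
    also have "\<dots> \<le> card T * exp (- 100 * \<kappa> * P) * exp (- 17 * (\<kappa> * P))" using card_T by (intro mult_right_mono) auto
    also have "\<dots> \<le> card U0 * exp (- 17 * (\<kappa> * P))" using U0 by (intro mult_right_mono) auto
    finally show ?thesis using U by linarith
  qed
  have Une: "U \<noteq> {}" using card_U by (metis card.empty exp_gt_zero not_less of_nat_0)
  \<comment> \<open>Converts the unit of u back to that of t; division by 0 makes it 0 on
    coordinates that vanish almost surely.\<close>
  define scale where "scale = (\<lambda>i. \<delta> * a / (P * mean_abs i))"
  have scale0: "scale i \<ge> 0" for i using \<delta>a P mean_abs_nonneg[of i] by (simp add: scale_def)
  have u_scale: "(u t i - u s i) * scale i = t i - s i" if "mean_abs i \<noteq> 0" for s t i
  proof -
    have "u t i - u s i = P * mean_abs i / (\<delta> * a) * (t i - s i)"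
      by (simp add: u_def \<tau>_def algebra_simps diff_divide_distrib)
    then show ?thesis using that \<delta>0 a P by (simp add: scale_def)
  qed
  have u_zero: "u t i = 0" if "mean_abs i = 0" for t i using that by (simp add: u_def \<tau>_def)
  have u_t0: "u t0 i = 0" for i by (simp add: u_def)
  define A where "A = (\<lambda>t. {i. i < d \<and> \<bar>u t i\<bar> \<ge> 1})"
  have A: "A t \<subseteq> {..<d}" for t by (auto simp: A_def)
  have finA: "finite (A t)" for t using A finite_subset by blast
  \<comment> \<open>Subtracting the sign is a soft threshold: a jump at \<bar>u t i\<bar> = 1 would
    destroy the Lipschitz bound \<open>\<psi>_lip\<close>, and with it the contraction from the sets
    back to the points.\<close>
  define b where "b = (\<lambda>i. (v i - sgn (v i)) * scale i)"
  define \<psi> where "\<psi> = (\<lambda>t i. if i \<in> A t then v i - sgn (v i) else 0)"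
  define \<rho> where "\<rho> = (\<lambda>t i. u t i - \<psi> t i)"
  have v_large: "1 \<le> \<bar>v i\<bar> \<and> \<bar>v i\<bar> \<le> \<bar>u t i\<bar> \<and> \<bar>u t i - v i\<bar> \<le> 1/16" if "t \<in> U" "i \<in> A t" for t i
    using ret[OF that(1)] that(2) by (simp add: A_def)
  have \<psi>_lip: "\<bar>\<psi> t i - \<psi> s i\<bar> \<le> \<bar>u t i - u s i\<bar>" if st: "s \<in> U" "t \<in> U" and i: "i < d" for s t i
  proof -
    have one: "\<bar>\<psi> t i - \<psi> s i\<bar> \<le> \<bar>u t i - u s i\<bar>" if "t \<in> U" "i \<in> A t" "i \<notin> A s" for s t
    proof -
      have "\<bar>\<psi> t i - \<psi> s i\<bar> = \<bar>v i\<bar> - 1"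
        using v_large[OF that(1,2)] that by (auto simp: \<psi>_def sgn_if abs_if)
      moreover have "\<bar>u s i\<bar> < 1" using that(3) i by (auto simp: A_def)
      ultimately show ?thesis using v_large[OF that(1,2)] by linarith
    qed
    consider "i \<in> A t" "i \<in> A s" | "i \<notin> A t" "i \<notin> A s" | "i \<in> A t" "i \<notin> A s" | "i \<notin> A t" "i \<in> A s" by blast
    then show ?thesis
    proof cases
      case 3 then show ?thesis using one st by blast
    next
      case 4 then show ?thesis using one[of s t] st by (simp add: abs_minus_commute)
    qed (auto simp: \<psi>_def)
  qed
  have card_A: "real (card (A t)) \<le> P / 96" if t: "t \<in> U" for t
  proof -
    have "real (card (A t)) = (\<Sum>i\<in>A t. 1)" by simp
    also have "\<dots> \<le> (\<Sum>i\<in>A t. trunc_sq (u t i))" by (intro sum_mono) (auto simp: A_def trunc_sq_large)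
    also have "\<dots> \<le> (\<Sum>i<d. trunc_sq (u t i))" using A by (intro sum_mono2) (auto simp: trunc_sq_nonneg)
    also have "\<dots> \<le> \<kappa> * P" by (rule ball_U[OF t])
    finally show ?thesis using P by (simp add: \<kappa>_def)
  qed
  have \<rho>2: "\<bar>\<rho> t i\<bar> \<le> 2" "(\<rho> t i)\<^sup>2 \<le> 4 * trunc_sq (u t i)" if t: "t \<in> U" and i: "i < d" for t i
  proof -
    have "\<bar>\<rho> t i\<bar> \<le> 2 \<and> (\<rho> t i)\<^sup>2 \<le> 4 * trunc_sq (u t i)"
    proof (cases "i \<in> A t")
      case True
      have "\<bar>\<rho> t i\<bar> \<le> 2" using v_large[OF t True] True by (auto simp: \<rho>_def \<psi>_def sgn_if abs_if split: if_splits)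
      moreover from this have "(\<rho> t i)\<^sup>2 \<le> 2\<^sup>2" by (metis abs_ge_zero power2_abs power_mono)
      moreover have "1 \<le> trunc_sq (u t i)" using True by (auto simp: A_def trunc_sq_large)
      ultimately show ?thesis by simp
    next
      case False
      then have "\<bar>u t i\<bar> < 1" using i by (simp add: A_def)
      then show ?thesis using False by (simp add: \<rho>_def \<psi>_def trunc_sq_small)
    qed
    then show "\<bar>\<rho> t i\<bar> \<le> 2" "(\<rho> t i)\<^sup>2 \<le> 4 * trunc_sq (u t i)" by auto
  qed
  define rest where "rest = (\<lambda>t i. \<rho> t i * scale i)"
  have rest_moment: "expectation (\<lambda>x. \<bar>Rd_inner d (rest t) x\<bar> powr P) \<le> (a / 12) powr P" if t: "t \<in> U" for t
  proof -
    \<comment> \<open>Normalized so that \<bar>\<rho> t i\<bar> \<le> 2 becomes the bound 1/8 of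
      \<open>moment_linear_le\<close>.\<close>
    define c where "c = (\<lambda>i. P / (16 * \<delta> * a) * rest t i)"
    have c_mean: "c i * mean_abs i = \<rho> t i / 16" if "mean_abs i \<noteq> 0" for i
      using that \<delta>0 a P by (simp add: c_def rest_def scale_def)
    have "expectation (\<lambda>x. \<bar>Rd_inner d c x\<bar> powr P) \<le> P powr P * (2 * exp (768 * (\<Sum>i<d. (c i * mean_abs i)\<^sup>2)))"
    proof (rule moment_linear_le)
      show "\<bar>c i\<bar> * mean_abs i \<le> 1/8" if "i < d" "mean_abs i \<noteq> 0" for i
      proof -
        have "\<bar>c i\<bar> * mean_abs i = \<bar>c i * mean_abs i\<bar>" using mean_abs_nonneg[of i] by (simp add: abs_mult)
        then show ?thesis using c_mean[OF that(2)] \<rho>2(1)[OF t that(1)] by simp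
      qed
      show "c i = 0" if "i < d" "mean_abs i = 0" for i using that by (simp add: c_def rest_def scale_def)
    qed (use P in simp)
    also have "(\<Sum>i<d. (c i * mean_abs i)\<^sup>2) \<le> (\<Sum>i<d. trunc_sq (u t i) / 64)"
    proof (intro sum_mono)
      fix i assume i: "i \<in> {..<d}"
      show "(c i * mean_abs i)\<^sup>2 \<le> trunc_sq (u t i) / 64"
      proof (cases "mean_abs i = 0")
        case False
        show ?thesis unfolding c_mean[OF False] using \<rho>2(2)[OF t, of i] i by (simp add: power_divide)
      qed (simp add: trunc_sq_nonneg)
    qed
    also have "\<dots> \<le> \<kappa> * P / 64" using ball_U[OF t] by (simp flip: sum_divide_distrib)
    finally have c_mom: "expectation (\<lambda>x. \<bar>Rd_inner d c x\<bar> powr P) \<le> P powr P * (2 * exp (P / 20))"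
      by (simp add: \<kappa>_def mult_left_mono)
    have "Rd_inner d (rest t) x = 16 * \<delta> * a / P * Rd_inner d c x" for x
      using \<delta>0 a P by (simp add: Rd_inner_def c_def sum_distrib_left)
    moreover define r where "r = 16 * \<delta> * a / P"
    moreover have "\<bar>r * y\<bar> powr P = r powr P * \<bar>y\<bar> powr P" for y
      using \<delta>0 a P by (simp add: r_def abs_mult flip: powr_mult)
    ultimately have "expectation (\<lambda>x. \<bar>Rd_inner d (rest t) x\<bar> powr P) = (16 * \<delta> * a / P) powr P * expectation (\<lambda>x. \<bar>Rd_inner d c x\<bar> powr P)"
      by simp
    also have "\<dots> \<le> (16 * \<delta> * a / P) powr P * (P powr P * (2 * exp (P / 20)))" using c_mom by (intro mult_left_mono) auto
    also have "\<dots> = (16 * \<delta> * a) powr P * (2 * exp (P / 20))" using \<delta>0 a P by (simp add: powr_divide)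
    also have "\<dots> \<le> (16 * \<delta> * a) powr P * (2 powr P * 3 powr P)"
    proof (intro mult_left_mono mult_mono)
      show "2 \<le> 2 powr P" using P powr_mono[of 1 P 2] by simp
      have "1 * P \<le> ln 3 * P" using P ln_ge_iff[of 3 1] exp_le by (intro mult_right_mono) auto
      then have "exp (P / 20) \<le> exp (ln 3 * P)" using P by simp
      then show "exp (P / 20) \<le> 3 powr P" by (simp add: powr_def mult.commute)
    qed auto
    also have "\<dots> = (16 * \<delta> * a * 6) powr P" using \<delta>0 a by (simp flip: powr_mult)
    also have "\<dots> \<le> (a / 12) powr P" using a P by (intro powr_mono2) (auto simp: \<delta>_def)
    finally show ?thesis .
  qed
  define g where "g = (\<lambda>t i. if i \<in> A t then b i else 0)"
  have g_eq: "g t i = \<psi> t i * scale i" for t i by (simp add: g_def \<psi>_def b_def)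
  have g_sum: "Rd_inner d (g t) x = (\<Sum>i\<in>A t. b i * x i)" for t x
    unfolding Rd_inner_def g_def using A by (intro sum.mono_neutral_cong_right) auto
  have sets_sep: "expectation (\<lambda>x. (\<Sum>i\<in>A t - A s. \<bar>b i * x i\<bar>) powr P) \<ge> (4 * (a / (96 * P)) * P) powr P \<or>
      expectation (\<lambda>x. (\<Sum>i\<in>A s - A t. \<bar>b i * x i\<bar>) powr P) \<ge> (4 * (a / (96 * P)) * P) powr P"
    if st: "s \<in> U" "t \<in> U" "s \<noteq> t" for s t
  proof -
    define h where "h = (\<lambda>i. g t i - g s i)"
    \<comment> \<open>Where \<open>mean_abs\<close> is 0, u does not determine t i - s i, but the
      coordinate vanishes almost surely.\<close>
    have "AE x in \<mu>. \<forall>i\<in>{..<d}. mean_abs i = 0 \<longrightarrow> x i = 0"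
    proof (rule AE_finite_allI)
      show "AE x in \<mu>. mean_abs i = 0 \<longrightarrow> x i = 0" if "i \<in> {..<d}" for i
        using that AE_coord_zero[of i] by (cases "mean_abs i = 0") auto
    qed simp
    then have ae: "AE x in \<mu>. \<bar>Rd_inner d (\<lambda>i. t i - s i) x\<bar> powr P
        \<le> 3 powr P * (\<bar>Rd_inner d h x\<bar> powr P + \<bar>Rd_inner d (rest t) x\<bar> powr P + \<bar>Rd_inner d (rest s) x\<bar> powr P)"
    proof eventually_elim
      case (elim x)
      have "(t i - s i) * x i = h i * x i + rest t i * x i + - (rest s i * x i)" if "i < d" for i
      proof (cases "mean_abs i = 0")
        case True
        then show ?thesis using elim that by simp
      next
        case False
        then have "(t i - s i) * x i = (u t i - u s i) * scale i * x i" by (simp add: u_scale)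
        also have "\<dots> = h i * x i + rest t i * x i + - (rest s i * x i)"
          by (simp add: h_def g_eq rest_def \<rho>_def algebra_simps)
        finally show ?thesis .
      qed
      then have "Rd_inner d (\<lambda>i. t i - s i) x = Rd_inner d h x + Rd_inner d (rest t) x + - Rd_inner d (rest s) x"
        unfolding Rd_inner_def by (simp add: sum.distrib sum_subtractf)
      then show ?case using P powr_add_le_3[of P "Rd_inner d h x" "Rd_inner d (rest t) x" "- Rd_inner d (rest s) x"] by simp
    qed
    have I: "integrable \<mu> (\<lambda>x. \<bar>Rd_inner d c x\<bar> powr P)" for c using P by (intro integrable_inner_abs_powr) auto
    have "a powr P \<le> expectation (\<lambda>x. \<bar>Rd_inner d (\<lambda>i. t i - s i) x\<bar> powr P)"
      using sep[of s t] st UT by auto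
    also have "\<dots> \<le> expectation (\<lambda>x. 3 powr P * (\<bar>Rd_inner d h x\<bar> powr P + \<bar>Rd_inner d (rest t) x\<bar> powr P + \<bar>Rd_inner d (rest s) x\<bar> powr P))"
      using I by (intro integral_mono_AE ae) auto
    also have "\<dots> = 3 powr P * (expectation (\<lambda>x. \<bar>Rd_inner d h x\<bar> powr P) + expectation (\<lambda>x. \<bar>Rd_inner d (rest t) x\<bar> powr P)
        + expectation (\<lambda>x. \<bar>Rd_inner d (rest s) x\<bar> powr P))"
      using I by simp
    also have "\<dots> \<le> 3 powr P * (expectation (\<lambda>x. \<bar>Rd_inner d h x\<bar> powr P) + (a / 12) powr P + (a / 12) powr P)"
      using rest_moment st by (intro mult_left_mono add_mono) auto
    finally have h1: "a powr P \<le> 3 powr P * (expectation (\<lambda>x. \<bar>Rd_inner d h x\<bar> powr P) + 2 * (a / 12) powr P)"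
      by (simp add: add_ac)
    have two: "2 \<le> 2 powr P" using P powr_mono[of 1 P 2] by simp
    \<comment> \<open>With p = 2 powr P \<ge> 2, the two error terms are absorbed by p * p - 2 \<ge>
      p.\<close>
    have h_mom: "(a / 6) powr P \<le> expectation (\<lambda>x. \<bar>Rd_inner d h x\<bar> powr P)"
    proof -
      define B where "B = (a / 12) powr P"
      define p where "p = 2 powr P"
      have "a powr P = 3 powr P * (p * p * B)" "(a / 6) powr P = p * B"
        using a by (simp_all add: B_def p_def flip: powr_mult)
      then have "3 powr P * (p * p * B) \<le> 3 powr P * (expectation (\<lambda>x. \<bar>Rd_inner d h x\<bar> powr P) + 2 * B)"
        using h1 by (simp add: B_def)
      then have "p * p * B - 2 * B \<le> expectation (\<lambda>x. \<bar>Rd_inner d h x\<bar> powr P)" by simp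
      moreover have "(p + 2) * B \<le> (p * p) * B"
      proof (rule mult_right_mono)
        have "2 \<le> p" using two by (simp add: p_def)
        then have "p * 2 \<le> p * p" by (intro mult_left_mono) auto
        then show "p + 2 \<le> p * p" using \<open>2 \<le> p\<close> by linarith
      qed (simp add: B_def)
      ultimately show ?thesis using \<open>(a / 6) powr P = p * B\<close> by (simp add: algebra_simps)
    qed
    define W1 where "W1 = (\<lambda>x. \<Sum>i\<in>A t - A s. \<bar>b i * x i\<bar>)"
    define W2 where "W2 = (\<lambda>x. \<Sum>i\<in>A s - A t. \<bar>b i * x i\<bar>)"
    have W0: "0 \<le> W1 x" "0 \<le> W2 x" for x by (auto simp: W1_def W2_def sum_nonneg)
    have h_le: "\<bar>Rd_inner d h x\<bar> powr P \<le> 2 powr P * (W1 x powr P + W2 x powr P)" for x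
    proof -
      \<comment> \<open>Common coordinates cancel because b i does not depend on the point; this is
        the gain from keeping a single large value per coordinate.\<close>
      have "Rd_inner d h x = (\<Sum>i\<in>A t. b i * x i) - (\<Sum>i\<in>A s. b i * x i)"
        unfolding g_sum[symmetric] by (simp add: h_def Rd_inner_def left_diff_distrib sum_subtractf)
      also have "\<dots> = (\<Sum>i\<in>A t - A s. b i * x i) - (\<Sum>i\<in>A s - A t. b i * x i)"
        using sum.Int_Diff[OF finA[of t], of "\<lambda>i. b i * x i" "A s"] sum.Int_Diff[OF finA[of s], of "\<lambda>i. b i * x i" "A t"]
        by (simp add: Int_commute)
      also have "\<bar>\<dots>\<bar> \<le> W1 x + W2 x"
        unfolding W1_def W2_def by (intro order_trans[OF abs_triangle_ineq4] add_mono sum_abs)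
      finally have "\<bar>Rd_inner d h x\<bar> powr P \<le> \<bar>W1 x + W2 x\<bar> powr P" using P by (intro powr_mono2) auto
      also have "\<dots> \<le> 2 powr P * (\<bar>W1 x\<bar> powr P + \<bar>W2 x\<bar> powr P)" using P by (intro powr_add_le_2) auto
      finally show ?thesis using W0 by simp
    qed
    have IW: "integrable \<mu> (\<lambda>x. W1 x powr P)" "integrable \<mu> (\<lambda>x. W2 x powr P)"
      unfolding W1_def W2_def using A P by (intro integrable_sum_abs_powr; force)+
    have "expectation (\<lambda>x. \<bar>Rd_inner d h x\<bar> powr P) \<le> expectation (\<lambda>x. 2 powr P * (W1 x powr P + W2 x powr P))"
      using IW by (intro integral_mono I h_le) auto
    with h_mom have "(a / 6) powr P \<le> expectation (\<lambda>x. 2 powr P * (W1 x powr P + W2 x powr P))" by (rule order_trans)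
    also have "\<dots> = 2 powr P * (expectation (\<lambda>x. W1 x powr P) + expectation (\<lambda>x. W2 x powr P))" using IW by simp
    also have "(a / 6) powr P = 2 powr P * (2 powr P * (a / 24) powr P)" using a by (simp flip: powr_mult)
    finally have "2 powr P * (a / 24) powr P \<le> expectation (\<lambda>x. W1 x powr P) + expectation (\<lambda>x. W2 x powr P)" by simp
    moreover have "2 * (a / 24) powr P \<le> 2 powr P * (a / 24) powr P" using two by (intro mult_right_mono) auto
    ultimately have "(a / 24) powr P \<le> expectation (\<lambda>x. W1 x powr P) \<or> (a / 24) powr P \<le> expectation (\<lambda>x. W2 x powr P)"
      by linarith
    moreover have "4 * (a / (96 * P)) * P = a / 24" using P by simp
    ultimately show ?thesis by (simp add: W1_def W2_def)
  qed
  have "a / (96 * P) * P / 5120 \<le> expectation (\<lambda>x. MAX t\<in>U. \<Sum>i\<in>A t. b i * x i)"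
    using a P by (intro minoration_sets finU Une A card_A card_U sets_sep) auto
  also have "\<dots> = expectation (\<lambda>x. MAX t\<in>U. \<Sum>i<d. g t i * x i)"
    using g_sum by (simp add: Rd_inner_def)
  also have "\<dots> \<le> expectation (\<lambda>x. MAX t\<in>U. \<Sum>i<d. t i * x i)"
  proof (rule expectation_contraction[OF finU Une])
    fix s t i assume st: "s \<in> U" "t \<in> U" and i: "i < d"
    show "\<bar>g t i - g s i\<bar> \<le> \<bar>t i - s i\<bar>"
    proof (cases "mean_abs i = 0")
      case True
      then show ?thesis by (simp add: g_eq scale_def)
    next
      case False
      have "\<bar>g t i - g s i\<bar> = \<bar>\<psi> t i - \<psi> s i\<bar> * scale i"
        using scale0[of i] by (simp add: g_eq abs_mult flip: left_diff_distrib)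
      also have "\<dots> \<le> \<bar>u t i - u s i\<bar> * scale i" using \<psi>_lip[OF st i] scale0 by (intro mult_right_mono) auto
      also have "\<dots> = \<bar>t i - s i\<bar>" using scale0[of i] u_scale[OF False, of t s] by (metis abs_mult abs_of_nonneg)
      finally show ?thesis .
    qed
  qed
  also have "\<dots> \<le> S" unfolding S_def using expectation_Max_mono[OF T(1) UT Une] by (simp add: Rd_inner_def)
  finally show False using S a P by simp
qed

end

theorem theorem1p1:
  "\<exists>c>0. \<forall>(d::nat) (\<mu> :: (nat \<Rightarrow> real) measure) (P::real) (T :: (nat \<Rightarrow> real) set) (a::real).
     d \<ge> 1 \<and> law_on_Rd d \<mu> \<and> unconditional_law d \<mu> \<and> log_concave_law d \<mu> \<and>
     negatively_associated \<mu> d (\<lambda>x i. \<bar>x i\<bar>) \<and>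
     P \<ge> 1 \<and> finite T \<and> T \<subseteq> Rd_space d \<and> real (card T) \<ge> exp P \<and> a > 0 \<and>
     (\<forall>s\<in>T. \<forall>t\<in>T. s \<noteq> t \<longrightarrow> Lp_norm \<mu> P (\<lambda>x. Rd_inner d (\<lambda>i. t i - s i) x) \<ge> a)
     \<longrightarrow> (\<integral>x. (MAX t\<in>T. Rd_inner d t x) \<partial>\<mu>) \<ge> c * a"
proof -
  have "1/18432000 * a \<le> (\<integral>x. (MAX t\<in>T. Rd_inner d t x) \<partial>\<mu>)"
    if "law_on_Rd d \<mu>" "unconditional_law d \<mu>" "log_concave_law d \<mu>"
    "negatively_associated \<mu> d (\<lambda>x i. \<bar>x i\<bar>)"
    and P: "P \<ge> 1" and T: "finite T" "real (card T) \<ge> exp P" and a: "a > 0"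
    and sep: "\<forall>s\<in>T. \<forall>t\<in>T. s \<noteq> t \<longrightarrow> Lp_norm \<mu> P (\<lambda>x. Rd_inner d (\<lambda>i. t i - s i) x) \<ge> a"
    for d \<mu> P T and a :: real
  proof -
    interpret na_law d \<mu> using that(1-4) by unfold_locales
    have mom: "expectation (\<lambda>x. \<bar>Rd_inner d (\<lambda>i. t i - s i) x\<bar> powr P) \<ge> a powr P" if "s \<in> T" "t \<in> T" "s \<noteq> t" for s t
    proof -
      define E where "E = expectation (\<lambda>x. \<bar>Rd_inner d (\<lambda>i. t i - s i) x\<bar> powr P)"
      have "E \<ge> 0" by (simp add: E_def)
      have "a powr P \<le> (E powr (1 / P)) powr P"
        using sep that a P by (intro powr_mono2) (auto simp: Lp_norm_def E_def)
      also have "\<dots> = E" using \<open>E \<ge> 0\<close> P by (simp add: powr_powr)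
      finally show ?thesis by (simp add: E_def)
    qed
    have "1 + P \<le> real (card T)" using T exp_ge_add_one_self[of P] by linarith
    then have "card T \<ge> 2" using P by linarith
    then obtain s t where st: "s \<in> T" "t \<in> T" "s \<noteq> t"
      by (metis card_2_iff' card_le_Suc0_iff_eq T(1) numeral_2_eq_2 not_less_eq_eq)
    show "(\<integral>x. (MAX t\<in>T. Rd_inner d t x) \<partial>\<mu>) \<ge> 1/18432000 * a"
    proof (cases "P \<le> 6")
      case True
      have "a / 576 \<le> expectation (\<lambda>x. MAX t\<in>T. Rd_inner d t x)"
        using st True by (intro minoration_small[OF T(1) st(1,2) P _ a mom]) auto
      then show ?thesis using a by simp
    next
      case False
      have "a / 18432000 \<le> expectation (\<lambda>x. MAX t\<in>T. Rd_inner d t x)"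
      proof (rule minoration_large[OF T(1) _ _ T(2) a])
        show "T \<noteq> {}" using st by auto
        show "P \<ge> 6" using False by simp
      qed (rule mom)
      then show ?thesis by simp
    qed
  qed
  then show ?thesis by (intro exI[of _ "1/18432000"] conjI allI impI; (elim conjE)?) simp_all
qed

end
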